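(* Let $G$ be a tourney on $K_n$ of size $k$. Then the procedure Join applied to $G$ returns a tourney of size at most $k$, and it runs in time $O(n^2)$.
   Context: For $n\in\mathbb{N}$, the knight's graph $K_n$ is the undirected graph on the $n^2$ cells of an $n\times n$ chessboard, with an edge between two cells iff a chess knight can move between them. For cells $u,v$ joined by a knight move, $\mathrm{km}(u,v)$ denotes the knight move (displacement vector) from $u$ to $v$. A tourney on $K_n$ is a vertex-disjoint cycle cover of $K_n$, i.e. a set of (nontrivial) cycles in $K_n$ such that every vertex lies in exactly one cycle; its size is the number of cycles (a closed knight's tour is a tourney of size 1). Tourneys are regarded as subgraphs of $K_n$ and represented by adjacency lists. A rail in a subgraph $G$ of $K_n$ is an unordered pair of edges $(e,e')$ of $G$ with $e=(v_0,v_1)$, $e'=(v_2,v_3)$, $\mathrm{km}(v_0,v_1)=\mathrm{km}(v_2,v_3)$, $\mathrm{km}(v_0,v_2)=\mathrm{km}(v_1,v_3)$, and $(v_0,v_2),(v_1,v_3)$ edges of $K_n$ not in $G$. Switching a rail means deleting its two edges $(v_0,v_1),(v_2,v_3)$ from the graph and adding the two edges $(v_0,v_2),(v_1,v_3)$. The rail graph of a tourney is the multigraph with one vertex for each cycle of the tourney and, for each rail whose two edges lie in two distinct cycles $u\neq v$, an edge between $u$ and $v$. The procedure Join, given a tourney $G$: (1) finds the set of all rails of $G$; (2) constructs the rail graph $R$ of $G$; (3) finds a spanning forest $T$ of $R$; (4) lets $D$ be the set of rails corresponding to the edges of $T$; (5) switches each rail in $D$; and (6) returns the resulting graph.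
   Formalization: In step (5) the rails of D are switched one after another, and a pair that is no longer a rail of the current graph is skipped; switching two rails that share an edge would give degree-3 cells, so the literal claim fails. For edge-disjoint rails nothing changes. *)

theory Defs
  imports Complex_Main "HOL-Library.Product_Plus" "HOL-Library.Landau_Symbols"
begin

section \<open>The knight's graph and tourneys\<close>

type_synonym cell = "int \<times> int"
type_synonym edge = "cell set"

text \<open>A subgraph of the knight's graph is given by its set of edges; its vertex set is always
  the whole board.\<close>

type_synonym graph = "edge set"

definition cells :: "nat \<Rightarrow> cell set" where
  "cells n = {0..<int n} \<times> {0..<int n}"

definition km :: "cell \<Rightarrow> cell \<Rightarrow> int \<times> int" where
  "km u v = v - u"

definition knight_move :: "int \<times> int \<Rightarrow> bool" where
  "knight_move d \<longleftrightarrow>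
     \<bar>fst d\<bar> = 1 \<and> \<bar>snd d\<bar> = 2 \<or> \<bar>fst d\<bar> = 2 \<and> \<bar>snd d\<bar> = 1"

definition knight_graph :: "nat \<Rightarrow> graph" where
  "knight_graph n = {{u, v} | u v. u \<in> cells n \<and> v \<in> cells n \<and> knight_move (km u v)}"

definition cycle_edges :: "cell list \<Rightarrow> edge set" where
  "cycle_edges vs = {{vs ! i, vs ! (Suc i mod length vs)} | i. i < length vs}"

definition is_cycle :: "nat \<Rightarrow> edge set \<Rightarrow> bool" where
  "is_cycle n C \<longleftrightarrow> C \<subseteq> knight_graph n \<and>
     (\<exists>vs. 3 \<le> length vs \<and> distinct vs \<and> C = cycle_edges vs)"

text \<open>A tourney is a set \<open>\<C>\<close> of cycles; regarded as a subgraph it is \<open>\<Union>\<C>\<close>, and its size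
  is \<open>card \<C>\<close>.\<close>

definition tourney :: "nat \<Rightarrow> edge set set \<Rightarrow> bool" where
  "tourney n \<C> \<longleftrightarrow> (\<forall>C\<in>\<C>. is_cycle n C) \<and> (\<forall>v\<in>cells n. \<exists>!C. C \<in> \<C> \<and> v \<in> \<Union>C)"


section \<open>Rails\<close>

type_synonym rail = "edge set"

definition parallel_edges :: "cell \<Rightarrow> cell \<Rightarrow> cell \<Rightarrow> cell \<Rightarrow> bool" where
  "parallel_edges v0 v1 v2 v3 \<longleftrightarrow> km v0 v1 = km v2 v3 \<and> km v0 v2 = km v1 v3"

definition rails :: "nat \<Rightarrow> graph \<Rightarrow> rail set" where
  "rails n G = {{{v0, v1}, {v2, v3}} | v0 v1 v2 v3.
     {v0, v1} \<in> G \<and> {v2, v3} \<in> G \<and> parallel_edges v0 v1 v2 v3 \<and>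
     {v0, v2} \<in> knight_graph n \<and> {v0, v2} \<notin> G \<and>
     {v1, v3} \<in> knight_graph n \<and> {v1, v3} \<notin> G}"

text \<open>The two edges added when a rail is switched. A rail, being the unordered pair of its edges,
  determines them: only the exchanges \<open>(v0, v1, v2, v3) \<mapsto> (v1, v0, v3, v2)\<close> and
  \<open>(v0, v1, v2, v3) \<mapsto> (v2, v3, v0, v1)\<close> preserve the condition on the displacements.\<close>

definition new_edges :: "rail \<Rightarrow> edge set" where
  "new_edges r = \<Union>{{{v0, v2}, {v1, v3}} | v0 v1 v2 v3.
     r = {{v0, v1}, {v2, v3}} \<and> parallel_edges v0 v1 v2 v3}"

definition switch :: "rail \<Rightarrow> graph \<Rightarrow> graph" where
  "switch r G = (G - r) \<union> new_edges r"


section \<open>Spanning forests of multigraphs\<close>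

text \<open>A multigraph has a vertex set \<open>V\<close>, an edge set \<open>E\<close>, and a map \<open>ends\<close> from edges to their
  sets of endpoints.\<close>

definition mg_connected :: "('e \<Rightarrow> 'v set) \<Rightarrow> 'e set \<Rightarrow> 'v \<Rightarrow> 'v \<Rightarrow> bool" where
  "mg_connected ends E u v \<longleftrightarrow> (u, v) \<in> {(x, y). \<exists>e\<in>E. ends e = {x, y}}\<^sup>*"

text \<open>Loops and pairs of parallel edges count as cycles.\<close>

definition mg_cycle :: "('e \<Rightarrow> 'v set) \<Rightarrow> 'e set \<Rightarrow> 'v list \<Rightarrow> 'e list \<Rightarrow> bool" where
  "mg_cycle ends E vs es \<longleftrightarrow>
     vs \<noteq> [] \<and> length es = length vs \<and> distinct vs \<and> distinct es \<and> set es \<subseteq> E \<and>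
     (\<forall>i<length vs. ends (es ! i) = {vs ! i, vs ! (Suc i mod length vs)})"

definition spanning_forest :: "'v set \<Rightarrow> 'e set \<Rightarrow> ('e \<Rightarrow> 'v set) \<Rightarrow> 'e set \<Rightarrow> bool" where
  "spanning_forest V E ends T \<longleftrightarrow>
     T \<subseteq> E \<and> (\<nexists>vs es. mg_cycle ends T vs es) \<and>
     (\<forall>u\<in>V. \<forall>v\<in>V. mg_connected ends E u v \<longrightarrow> mg_connected ends T u v)"


section \<open>The procedure Join\<close>

text \<open>The rail graph has the vertex set \<open>\<C>\<close>; its edges are the rails themselves.\<close>

definition rail_graph_edges :: "nat \<Rightarrow> edge set set \<Rightarrow> rail set" where
  "rail_graph_edges n \<C> = {r \<in> rails n (\<Union>\<C>).
     \<exists>e e' C C'. r = {e, e'} \<and> C \<in> \<C> \<and> C' \<in> \<C> \<and> C \<noteq> C' \<and> e \<in> C \<and> e' \<in> C'}"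

definition rail_ends :: "edge set set \<Rightarrow> rail \<Rightarrow> edge set set" where
  "rail_ends \<C> r = {C \<in> \<C>. r \<inter> C \<noteq> {}}"

text \<open>Two rails of a spanning forest may share an edge. Once one of them has been switched, the
  other is no longer a rail of the current graph and there is nothing to switch: deleting and
  adding its edges anyway would create vertices of degree three. Such a pair is passed over.
  Lemma \<open>fold_switch_rail_eq\<close> below shows that this makes no difference when the chosen rails are
  pairwise edge-disjoint.\<close>

definition switch_rail :: "nat \<Rightarrow> rail \<Rightarrow> graph \<Rightarrow> graph" where
  "switch_rail n r H = (if r \<in> rails n H then switch r H else H)"

text \<open>Join is nondeterministic: any spanning forest may be found, and its rails may be switched in
  any order.\<close>

definition join :: "nat \<Rightarrow> edge set set \<Rightarrow> graph \<Rightarrow> bool" where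
  "join n \<C> H \<longleftrightarrow>
     (\<exists>D ds. spanning_forest \<C> (rail_graph_edges n \<C>) (rail_ends \<C>) D \<and>
        distinct ds \<and> set ds = D \<and> H = fold (switch_rail n) ds (\<Union>\<C>))"


section \<open>Random access machines\<close>

text \<open>A unit-cost random access machine with addition and truncated subtraction, programmed in a
  structured language. The state consists of registers and an addressable memory, and each
  operator, operand and memory access takes one step.\<close>

type_synonym state = "(nat \<Rightarrow> nat) \<times> (nat \<Rightarrow> nat)"

datatype aexp = Const nat | Reg nat | Load aexp | Add aexp aexp | Sub aexp aexp

datatype bexp = Less aexp aexp | Equal aexp aexp | Neg bexp | Conj bexp bexp

datatype com =
    Skip
  | Assign nat aexp
  | Store aexp aexp
  | Seq com com
  | Cond bexp com com
  | While bexp com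

fun aval :: "aexp \<Rightarrow> state \<Rightarrow> nat" where
  "aval (Const k) s = k"
| "aval (Reg x) s = fst s x"
| "aval (Load a) s = snd s (aval a s)"
| "aval (Add a b) s = aval a s + aval b s"
| "aval (Sub a b) s = aval a s - aval b s"

fun acost :: "aexp \<Rightarrow> nat" where
  "acost (Const k) = 1"
| "acost (Reg x) = 1"
| "acost (Load a) = 1 + acost a"
| "acost (Add a b) = 1 + acost a + acost b"
| "acost (Sub a b) = 1 + acost a + acost b"

fun bval :: "bexp \<Rightarrow> state \<Rightarrow> bool" where
  "bval (Less a b) s \<longleftrightarrow> aval a s < aval b s"
| "bval (Equal a b) s \<longleftrightarrow> aval a s = aval b s"
| "bval (Neg p) s \<longleftrightarrow> \<not> bval p s"
| "bval (Conj p q) s \<longleftrightarrow> bval p s \<and> bval q s"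

fun bcost :: "bexp \<Rightarrow> nat" where
  "bcost (Less a b) = 1 + acost a + acost b"
| "bcost (Equal a b) = 1 + acost a + acost b"
| "bcost (Neg p) = 1 + bcost p"
| "bcost (Conj p q) = 1 + bcost p + bcost q"

text \<open>\<open>exec c s t s'\<close>: started in state \<open>s\<close>, the program \<open>c\<close> halts in state \<open>s'\<close> after \<open>t\<close>
  steps.\<close>

inductive exec :: "com \<Rightarrow> state \<Rightarrow> nat \<Rightarrow> state \<Rightarrow> bool" where
  Skip: "exec Skip s 1 s"
| Assign: "exec (Assign x a) s (1 + acost a) ((fst s)(x := aval a s), snd s)"
| Store: "exec (Store a b) s (1 + acost a + acost b) (fst s, (snd s)(aval a s := aval b s))"
| Seq: "exec c1 s1 t1 s2 \<Longrightarrow> exec c2 s2 t2 s3 \<Longrightarrow> exec (Seq c1 c2) s1 (t1 + t2) s3"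
| Cond_True: "bval p s \<Longrightarrow> exec c1 s t s' \<Longrightarrow> exec (Cond p c1 c2) s (bcost p + t) s'"
| Cond_False: "\<not> bval p s \<Longrightarrow> exec c2 s t s' \<Longrightarrow> exec (Cond p c1 c2) s (bcost p + t) s'"
| While_False: "\<not> bval p s \<Longrightarrow> exec (While p c) s (bcost p) s"
| While_True: "bval p s1 \<Longrightarrow> exec c s1 t1 s2 \<Longrightarrow> exec (While p c) s2 t2 s3 \<Longrightarrow>
    exec (While p c) s1 (bcost p + t1 + t2) s3"


section \<open>Adjacency lists\<close>

definition cell_index :: "nat \<Rightarrow> cell \<Rightarrow> nat" where
  "cell_index n v = nat (fst v) * n + nat (snd v)"

definition adjacency_lists :: "nat \<Rightarrow> graph \<Rightarrow> nat list list \<Rightarrow> bool" where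
  "adjacency_lists n G L \<longleftrightarrow> length L = n * n \<and>
     (\<forall>v\<in>cells n. distinct (L ! cell_index n v) \<and>
        set (L ! cell_index n v) = cell_index n ` {w. {v, w} \<in> G})"

text \<open>In memory, \<open>n\<close> is followed by the adjacency lists in order, each preceded by its length.\<close>

definition encode :: "nat \<Rightarrow> nat list list \<Rightarrow> nat list" where
  "encode n L = n # concat (map (\<lambda>l. length l # l) L)"

definition initial_state :: "nat list \<Rightarrow> state" where
  "initial_state xs = (\<lambda>_. 0, \<lambda>i. if i < length xs then xs ! i else 0)"

definition holds_output :: "state \<Rightarrow> nat list \<Rightarrow> bool" where
  "holds_output s ys \<longleftrightarrow> (\<forall>i<length ys. snd s i = ys ! i)"

text \<open>\<open>P\<close> implements Join within time \<open>T\<close>: given adjacency lists of any tourney, it halts after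
  at most \<open>T n\<close> steps and leaves behind adjacency lists of a possible result of Join.\<close>

definition implements_join :: "com \<Rightarrow> (nat \<Rightarrow> nat) \<Rightarrow> bool" where
  "implements_join P T \<longleftrightarrow>
     (\<forall>n \<C> L. tourney n \<C> \<and> adjacency_lists n (\<Union>\<C>) L \<longrightarrow>
        (\<exists>t s' H L'. exec P (initial_state (encode n L)) t s' \<and> t \<le> T n \<and>
           join n \<C> H \<and> adjacency_lists n H L' \<and> holds_output s' (encode n L')))"


section \<open>Switching edge-disjoint rails\<close>

lemma tourney_cycle_unique:
  assumes "tourney n \<C>" "C \<in> \<C>" "C' \<in> \<C>" "e \<in> C" "e' \<in> C'" "v \<in> e" "v \<in> e'"
  shows "C = C'"
proof -
  have "e \<in> knight_graph n" using assms by (auto simp: tourney_def is_cycle_def)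
  then have "v \<in> cells n" using \<open>v \<in> e\<close> by (auto simp: knight_graph_def)
  then have "\<exists>!C. C \<in> \<C> \<and> v \<in> \<Union>C" using assms(1) by (simp add: tourney_def)
  then show ?thesis using assms by blast
qed

lemma rail_ends_new_edge:
  assumes t: "tourney n \<C>" and r: "r \<in> rails n (\<Union>\<C>)" and f: "f \<in> new_edges r"
  shows "rail_ends \<C> r = {C \<in> \<C>. f \<inter> \<Union>C \<noteq> {}}"
proof -
  from f obtain v0 v1 v2 v3 where r_eq: "r = {{v0, v1}, {v2, v3}}"
    and f_eq: "f = {v0, v2} \<or> f = {v1, v3}"
    by (auto simp: new_edges_def)
  have "r \<subseteq> \<Union>\<C>" using r by (auto simp: rails_def)
  then have "{v0, v1} \<in> \<Union>\<C>" "{v2, v3} \<in> \<Union>\<C>" by (simp_all add: r_eq)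
  then obtain A B where A: "A \<in> \<C>" "{v0, v1} \<in> A" and B: "B \<in> \<C>" "{v2, v3} \<in> B"
    by (elim UnionE)
  have vA: "v \<in> \<Union>C \<longleftrightarrow> C = A" if C: "C \<in> \<C>" and v: "v \<in> {v0, v1}" for C v
  proof
    assume "v \<in> \<Union>C"
    then obtain e where "e \<in> C" "v \<in> e" by (elim UnionE)
    then show "C = A" using tourney_cycle_unique[OF t C A(1) _ A(2) _ v] by simp
  next
    assume "C = A"
    then show "v \<in> \<Union>C" using A(2) v by (intro UnionI[of "{v0, v1}"]) simp_all
  qed
  have vB: "v \<in> \<Union>C \<longleftrightarrow> C = B" if C: "C \<in> \<C>" and v: "v \<in> {v2, v3}" for C v
  proof
    assume "v \<in> \<Union>C"
    then obtain e where "e \<in> C" "v \<in> e" by (elim UnionE)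
    then show "C = B" using tourney_cycle_unique[OF t C B(1) _ B(2) _ v] by simp
  next
    assume "C = B"
    then show "v \<in> \<Union>C" using B(2) v by (intro UnionI[of "{v2, v3}"]) simp_all
  qed
  have "r \<inter> C \<noteq> {} \<longleftrightarrow> f \<inter> \<Union>C \<noteq> {}" if C: "C \<in> \<C>" for C
  proof -
    have "{v0, v1} \<in> C \<longleftrightarrow> C = A"
    proof
      assume "{v0, v1} \<in> C"
      then have "v0 \<in> \<Union>C" by (rule UnionI) simp
      then show "C = A" using vA[OF C, of v0] by simp
    qed (use A(2) in simp)
    moreover have "{v2, v3} \<in> C \<longleftrightarrow> C = B"
    proof
      assume "{v2, v3} \<in> C"
      then have "v2 \<in> \<Union>C" by (rule UnionI) simp
      then show "C = B" using vB[OF C, of v2] by simp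
    qed (use B(2) in simp)
    moreover have "r \<inter> C \<noteq> {} \<longleftrightarrow> {v0, v1} \<in> C \<or> {v2, v3} \<in> C"
      unfolding r_eq by (simp add: disjoint_iff ex_disj_distrib)
    moreover have "f \<inter> \<Union>C \<noteq> {} \<longleftrightarrow> C = A \<or> C = B"
      using f_eq
    proof
      assume f: "f = {v0, v2}"
      show ?thesis unfolding f
        using vA[OF C, of v0] vB[OF C, of v2] by (simp del: Union_iff add: Int_insert_left)
    next
      assume f: "f = {v1, v3}"
      show ?thesis unfolding f
        using vA[OF C, of v1] vB[OF C, of v3] by (simp del: Union_iff add: Int_insert_left)
    qed
    ultimately show ?thesis by simp
  qed
  then show ?thesis unfolding rail_ends_def by (intro Collect_cong conj_cong refl)
qed

lemma new_edges_disjoint: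
  assumes t: "tourney n \<C>"
    and T: "spanning_forest \<C> (rail_graph_edges n \<C>) (rail_ends \<C>) D"
    and r: "r \<in> D" "r' \<in> D" "r \<noteq> r'"
  shows "new_edges r \<inter> new_edges r' = {}"
proof (rule ccontr)
  assume "new_edges r \<inter> new_edges r' \<noteq> {}"
  then obtain f where f: "f \<in> new_edges r" "f \<in> new_edges r'" by blast
  have rr: "r \<in> rail_graph_edges n \<C>" "r' \<in> rail_graph_edges n \<C>"
    using T r by (auto simp: spanning_forest_def)
  then have ends: "rail_ends \<C> r = rail_ends \<C> r'"
    using rail_ends_new_edge[OF t] f by (simp add: rail_graph_edges_def)
  from rr(1) obtain e e' A B
    where r_eq: "r = {e, e'}" and AB: "A \<in> \<C>" "B \<in> \<C>" "A \<noteq> B" "e \<in> A" "e' \<in> B"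
    and R: "r \<in> rails n (\<Union>\<C>)"
    by (auto simp: rail_graph_edges_def)
  have ne: "e \<noteq> {}" "e' \<noteq> {}" using R by (auto simp: rails_def r_eq doubleton_eq_iff)
  have "C = A \<or> C = B" if "C \<in> \<C>" "r \<inter> C \<noteq> {}" for C
    using that AB ne tourney_cycle_unique[OF t that(1) AB(1) _ AB(4)]
      tourney_cycle_unique[OF t that(1) AB(2) _ AB(5)] unfolding r_eq by blast
  then have "rail_ends \<C> r = {A, B}" using AB by (auto simp: rail_ends_def r_eq)
  then have "mg_cycle (rail_ends \<C>) D [A, B] [r, r']"
    using ends r AB by (auto simp: mg_cycle_def less_Suc_eq)
  then show False using T by (auto simp: spanning_forest_def)
qed

lemma rails_transfer:
  assumes "r \<in> rails n G" "r \<subseteq> H" "new_edges r \<inter> H = {}"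
  shows "r \<in> rails n H"
proof -
  from assms(1) obtain v0 v1 v2 v3 where v: "r = {{v0, v1}, {v2, v3}}"
    "parallel_edges v0 v1 v2 v3" "{v0, v2} \<in> knight_graph n" "{v1, v3} \<in> knight_graph n"
    by (auto simp: rails_def)
  then have "{v0, v2} \<in> new_edges r" "{v1, v3} \<in> new_edges r"
    unfolding new_edges_def by blast+
  then have "{v0, v2} \<notin> H" "{v1, v3} \<notin> H" using assms(3) by auto
  then show ?thesis using v assms(2) unfolding rails_def by blast
qed

lemma new_edges_eqI:
  assumes p: "parallel_edges v0 v1 v2 v3" "parallel_edges w0 w1 w2 w3"
    and e: "{w0, w1} = {v0, v1}" "{w2, w3} = {v2, v3}"
  shows "{{w0, w2}, {w1, w3}} = {{v0, v2}, {v1, v3}}"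
proof -
  have d: "v1 - v0 = v3 - v2" "w1 - w0 = w3 - w2"
    using p by (simp_all add: parallel_edges_def km_def)
  have flip: "x = y" if "x - y = y - x" for x y :: cell
    using that by (simp add: prod_eq_iff)
  have e1: "w0 = v0 \<and> w1 = v1 \<or> w0 = v1 \<and> w1 = v0" using e(1) by (simp only: doubleton_eq_iff)
  have e2: "w2 = v2 \<and> w3 = v3 \<or> w2 = v3 \<and> w3 = v2" using e(2) by (simp only: doubleton_eq_iff)
  show ?thesis
  proof (cases "v0 = v1")
    case True
    then have "v2 = v3" using d(1) by simp
    then show ?thesis using True e1 e2 by blast
  next
    case False
    have "\<not> (w0 = v0 \<and> w1 = v1 \<and> w2 = v3 \<and> w3 = v2)"
    proof
      assume w: "w0 = v0 \<and> w1 = v1 \<and> w2 = v3 \<and> w3 = v2"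
      then have "v3 - v2 = v2 - v3" using d by simp
      then show False using flip[of v3 v2] d(1) False by simp
    qed
    moreover have "\<not> (w0 = v1 \<and> w1 = v0 \<and> w2 = v2 \<and> w3 = v3)"
    proof
      assume w: "w0 = v1 \<and> w1 = v0 \<and> w2 = v2 \<and> w3 = v3"
      then have "v0 - v1 = v1 - v0" using d by simp
      then show False using flip[of v0 v1] False by simp
    qed
    ultimately have "w0 = v0 \<and> w1 = v1 \<and> w2 = v2 \<and> w3 = v3 \<or>
        w0 = v1 \<and> w1 = v0 \<and> w2 = v3 \<and> w3 = v2"
      using e1 e2 by blast
    then show ?thesis by (elim disjE conjE) (simp_all add: insert_commute)
  qed
qed

lemma new_edges_eq:
  assumes r: "r = {{v0, v1}, {v2, v3}}" and p: "parallel_edges v0 v1 v2 v3"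
  shows "new_edges r = {{v0, v2}, {v1, v3}}"
proof -
  have "{{w0, w2}, {w1, w3}} = {{v0, v2}, {v1, v3}}"
    if w: "r = {{w0, w1}, {w2, w3}}" "parallel_edges w0 w1 w2 w3" for w0 w1 w2 w3
  proof -
    have "{{w0, w1}, {w2, w3}} = {{v0, v1}, {v2, v3}}" using w(1) r by simp
    then consider "{w0, w1} = {v0, v1}" "{w2, w3} = {v2, v3}"
      | "{w2, w3} = {v0, v1}" "{w0, w1} = {v2, v3}"
      by (metis doubleton_eq_iff)
    then show ?thesis
    proof cases
      case 1
      then show ?thesis using new_edges_eqI[OF p w(2)] by simp
    next
      case 2
      have "parallel_edges w2 w3 w0 w1"
        using w(2) by (auto simp: parallel_edges_def km_def prod_eq_iff)
      then have "{{w2, w0}, {w3, w1}} = {{v0, v2}, {v1, v3}}" using new_edges_eqI[OF p _ 2] by simp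
      then show ?thesis by (simp only: insert_commute[of w2] insert_commute[of w3])
    qed
  qed
  note uniq = this
  define S where "S = {{{w0, w2}, {w1, w3}} | w0 w1 w2 w3.
      r = {{w0, w1}, {w2, w3}} \<and> parallel_edges w0 w1 w2 w3}"
  have "x = {{v0, v2}, {v1, v3}}" if "x \<in> S" for x
    using that unfolding S_def
  proof (elim CollectE exE conjE)
    fix w0 w1 w2 w3
    assume x: "x = {{w0, w2}, {w1, w3}}"
      and w: "r = {{w0, w1}, {w2, w3}}" "parallel_edges w0 w1 w2 w3"
    show ?thesis unfolding x using w by (rule uniq)
  qed
  moreover have "{{v0, v2}, {v1, v3}} \<in> S"
    unfolding S_def by (intro CollectI exI conjI, rule refl, rule r, rule p)
  ultimately have "S = {{{v0, v2}, {v1, v3}}}" by blast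
  moreover have "new_edges r = \<Union>S" unfolding S_def new_edges_def ..
  ultimately show ?thesis by simp
qed

lemma new_edges_notin:
  assumes r: "r \<in> rails n G"
  shows "new_edges r \<inter> G = {}"
proof -
  from r obtain v0 v1 v2 v3 where "r = {{v0, v1}, {v2, v3}}" "parallel_edges v0 v1 v2 v3"
    "{v0, v2} \<notin> G" "{v1, v3} \<notin> G"
    by (auto simp: rails_def)
  then show ?thesis by (simp add: new_edges_eq)
qed

lemma fold_switch_rail_eq:
  assumes t: "tourney n \<C>"
    and T: "spanning_forest \<C> (rail_graph_edges n \<C>) (rail_ends \<C>) D"
    and ds: "distinct ds" "set ds \<subseteq> D" and disj: "\<forall>r\<in>D. \<forall>r'\<in>D. r \<noteq> r' \<longrightarrow> r \<inter> r' = {}"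
  shows "fold (switch_rail n) ds (\<Union>\<C>) = fold switch ds (\<Union>\<C>)"
proof -
  have R: "r \<in> rails n (\<Union>\<C>)" if "r \<in> D" for r
    using T that by (auto simp: spanning_forest_def rail_graph_edges_def)
  have "fold (switch_rail n) ds (\<Union>\<C>) = fold switch ds (\<Union>\<C>) \<and>
      (\<Union>\<C>) - \<Union>(set ds) \<subseteq> fold switch ds (\<Union>\<C>) \<and>
      fold switch ds (\<Union>\<C>) \<subseteq> \<Union>\<C> \<union> \<Union>(new_edges ` set ds)"
    using ds
  proof (induction ds rule: rev_induct)
    case Nil
    then show ?case by simp
  next
    case (snoc r ds)
    define H where "H = fold switch ds (\<Union>\<C>)"
    have IH: "fold (switch_rail n) ds (\<Union>\<C>) = H" "\<Union>\<C> - \<Union>(set ds) \<subseteq> H"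
      "H \<subseteq> \<Union>\<C> \<union> \<Union>(new_edges ` set ds)"
      using snoc unfolding H_def by auto
    have r: "r \<in> D" "r \<notin> set ds" "set ds \<subseteq> D" using snoc.prems by auto
    have "r \<subseteq> \<Union>\<C>" using R[OF r(1)] by (auto simp: rails_def)
    moreover have "r \<inter> r' = {}" if "r' \<in> set ds" for r'
      using disj r that by (metis subsetD)
    then have "r \<inter> \<Union>(set ds) = {}" by (simp add: Int_Union)
    ultimately have sub: "r \<subseteq> H" using IH(2) by blast
    have "new_edges r \<inter> new_edges r' = {}" if "r' \<in> set ds" for r'
      using new_edges_disjoint[OF t T r(1), of r'] r that by (metis subsetD)
    then have "new_edges r \<inter> \<Union>(new_edges ` set ds) = {}" by (simp add: Int_UN_distrib)
    then have "new_edges r \<inter> H = {}"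
      using new_edges_notin[OF R[OF r(1)]] Int_mono[OF order_refl IH(3), of "new_edges r"]
      by (simp add: Int_Un_distrib)
    then have "r \<in> rails n H" using rails_transfer[OF R[OF r(1)] sub] by blast
    then have "switch_rail n r H = switch r H" by (simp add: switch_rail_def)
    moreover have "\<Union>\<C> - \<Union>(set (ds @ [r])) \<subseteq> switch r H"
      using IH(2) by (auto simp: switch_def)
    moreover have "switch r H \<subseteq> \<Union>\<C> \<union> \<Union>(new_edges ` set (ds @ [r]))"
      using IH(3) by (auto simp: switch_def)
    ultimately show ?case using IH(1) by (simp add: H_def)
  qed
  then show ?thesis by blast
qed

end

theory Submission
  imports Defs
begin

text \<open>Switching a rail whose edges lie in two different cycles merges these cycles into one: cut both
  cycles open at the edges of the rail and join the two paths by the new edges. While the rails of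
  a forest are switched one after the other, every current cycle consists of original cycles that
  are connected by the rails already passed, so the next rail always has its edges in two
  different current cycles, and the number of cycles never grows.

  For the running time, a breadth-first search keeps a queue of cells which, between two steps,
  is a union of whole cycles. A removed cell is tested against the eight knight moves for each of
  its two edges; a rail that leads to an unvisited cell is chosen, and the cycle of that cell is
  walked along and appended to the queue. Every cell enters the queue once, which pays for the
  walks.\<close>

section \<open>Merging cycles\<close>

text \<open>The search can test rails cheaply because the set of visited cells is closed under
  adjacency. An unvisited \<open>v2\<close> then lies on another cycle than the current cell
  \<open>v0\<close>. Hence the two new edges of the shifted pair cannot belong to the tourney, its
  ends in the rail graph are distinct, and the cycle of \<open>v2\<close> becomes a new leaf of the
  forest; visited flags on cells replace cycle labels and a union-find structure. Conversely, a rail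
  leading to a visited cell may be ignored. If that cell has been processed, the rail was examined
  from there; if it still waits in the queue, both cells belong to the tree under construction.
  Rails of the forest may share an edge, so one of them can cease to be a rail before its turn
  comes. Connectivity is therefore measured in all rails passed, switched or not. Every cell of a
  tourney has exactly two neighbours. The input thus consists of records of constant width three
  after the initial \<open>n\<close>, which is the origin of \<open>3 * (n * n) + 1\<close>, and a
  switch exchanges one entry in each of four lists in place.\<close>

fun path_edges :: "cell list \<Rightarrow> edge set" where
  "path_edges [] = {}"
| "path_edges [x] = {}"
| "path_edges (x # y # xs) = insert {x, y} (path_edges (y # xs))"

lemma path_edges_append:
  assumes "xs \<noteq> []" "ys \<noteq> []"
  shows "path_edges (xs @ ys) = insert {last xs, hd ys} (path_edges xs \<union> path_edges ys)"
  using assms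
proof (induction xs rule: path_edges.induct)
  case (2 x)
  then show ?case by (cases ys) auto
qed auto

lemma path_edges_rev: "path_edges (rev xs) = path_edges xs"
proof (induction xs rule: path_edges.induct)
  case (3 x y xs)
  have "path_edges (rev (y # xs) @ [x]) = insert {last (rev (y # xs)), x} (path_edges (rev (y # xs)))"
    by (subst path_edges_append) auto
  then show ?case using 3 by (simp add: last_rev insert_commute)
qed auto

lemma path_edges_conv_nth: "path_edges xs = {{xs ! i, xs ! Suc i} | i. Suc i < length xs}"
proof (induction xs rule: path_edges.induct)
  case (3 x y xs)
  have "{{(x # y # xs) ! i, (x # y # xs) ! Suc i} | i. Suc i < length (x # y # xs)} =
      insert {x, y} {{(y # xs) ! i, (y # xs) ! Suc i} | i. Suc i < length (y # xs)}" (is "?L = ?R")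
  proof (intro equalityI subsetI)
    fix e assume "e \<in> ?L"
    then obtain i where "e = {(x # y # xs) ! i, (x # y # xs) ! Suc i}" "Suc i < length (x # y # xs)"
      by blast
    then show "e \<in> ?R" by (cases i) auto
  next
    fix e assume "e \<in> ?R"
    then consider "e = {x, y}"
      | i where "e = {(y # xs) ! i, (y # xs) ! Suc i}" "Suc i < length (y # xs)" by blast
    then show "e \<in> ?L"
    proof cases
      case 1
      then show ?thesis by (intro CollectI exI[of _ 0]) simp
    next
      case 2
      then show ?thesis by (intro CollectI exI[of _ "Suc i"]) simp
    qed
  qed
  then show ?case using 3 by simp
qed auto

text \<open>Trades the index modulo the length for a path plus one closing edge, the form in which
  cycles are cut and glued.\<close>

lemma cycle_edges_eq:
  assumes "xs \<noteq> []"
  shows "cycle_edges xs = insert {last xs, hd xs} (path_edges xs)"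
proof -
  define l where "l = length xs"
  have l: "l > 0" "last xs = xs ! (l - 1)" "hd xs = xs ! 0"
    using assms by (simp_all add: l_def last_conv_nth hd_conv_nth)
  show ?thesis
    unfolding cycle_edges_def path_edges_conv_nth l_def[symmetric]
  proof (intro equalityI subsetI)
    fix e assume "e \<in> {{xs ! i, xs ! (Suc i mod l)} | i. i < l}"
    then obtain i where i: "e = {xs ! i, xs ! (Suc i mod l)}" "i < l" by blast
    show "e \<in> insert {last xs, hd xs} {{xs ! i, xs ! Suc i} | i. Suc i < l}"
    proof (cases "Suc i < l")
      case True
      then show ?thesis using i by auto
    next
      case False
      then have "Suc i = l" using i by simp
      then show ?thesis using i l by auto
    qed
  next
    fix e assume "e \<in> insert {last xs, hd xs} {{xs ! i, xs ! Suc i} | i. Suc i < l}"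
    then consider "e = {last xs, hd xs}" | i where "e = {xs ! i, xs ! Suc i}" "Suc i < l" by blast
    then show "e \<in> {{xs ! i, xs ! (Suc i mod l)} | i. i < l}"
    proof cases
      case 1
      then show ?thesis using l by (intro CollectI exI[of _ "l - 1"]) simp
    next
      case 2
      then show ?thesis by (intro CollectI exI[of _ i]) simp
    qed
  qed
qed

lemma cycle_edges_rev: "cycle_edges (rev xs) = cycle_edges xs"
proof (cases "xs = []")
  case False
  then show ?thesis
    by (simp add: cycle_edges_eq path_edges_rev last_rev hd_rev insert_commute)
qed simp

lemma cycle_edges_append_commute: "cycle_edges (xs @ ys) = cycle_edges (ys @ xs)"
proof (cases "xs = [] \<or> ys = []")
  case False
  then show ?thesis by (auto simp: cycle_edges_eq path_edges_append)
qed auto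

lemma cycle_edges_rotate: "cycle_edges (rotate k xs) = cycle_edges xs"
  by (metis rotate_drop_take cycle_edges_append_commute append_take_drop_id)

lemma Union_cycle_edges: "\<Union>(cycle_edges xs) = set xs"
proof (intro equalityI subsetI)
  fix v assume "v \<in> \<Union>(cycle_edges xs)"
  then obtain i where "i < length xs" "v = xs ! i \<or> v = xs ! (Suc i mod length xs)"
    by (auto simp: cycle_edges_def)
  moreover from this have "Suc i mod length xs < length xs" by (intro mod_less_divisor) auto
  ultimately show "v \<in> set xs" by auto
next
  fix v assume "v \<in> set xs"
  then obtain i where "i < length xs" "v = xs ! i" by (auto simp: in_set_conv_nth)
  then show "v \<in> \<Union>(cycle_edges xs)" by (auto simp: cycle_edges_def)
qed

text \<open>Rotation moves the edge into the closing position and, if necessary, reversal gives it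
  the required direction. Cutting the cycle at this edge then leaves the list itself as a
  path.\<close>

lemma cycle_edges_reorder:
  assumes e: "{a, b} \<in> cycle_edges vs"
  obtains xs where "set xs = set vs" "distinct xs = distinct vs" "length xs = length vs"
    "cycle_edges xs = cycle_edges vs" "last xs = a" "hd xs = b"
proof -
  from e obtain i where i: "{a, b} = {vs ! i, vs ! (Suc i mod length vs)}" "i < length vs"
    by (auto simp: cycle_edges_def)
  have ne: "vs \<noteq> []" using i by auto
  define xs where "xs = rotate (Suc i) vs"
  have xs: "set xs = set vs" "distinct xs = distinct vs" "length xs = length vs"
    "cycle_edges xs = cycle_edges vs" "xs \<noteq> []"
    unfolding xs_def using ne
    by (simp_all only: set_rotate distinct_rotate length_rotate cycle_edges_rotate
        rotate_is_Nil_conv not_False_eq_True)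
  have hd: "hd xs = vs ! (Suc i mod length vs)"
    unfolding xs_def using ne by (rule hd_rotate_conv_nth)
  have "last xs = xs ! (length vs - 1)" using xs by (simp add: last_conv_nth)
  also have "\<dots> = vs ! ((length vs - 1 + Suc i) mod length vs)"
    unfolding xs_def using ne by (subst nth_rotate) (simp_all add: add.commute)
  also have "(length vs - 1 + Suc i) mod length vs = i" using i(2) ne
    by (cases "length vs") (simp_all add: mod_if)
  finally have last: "last xs = vs ! i" .
  consider "a = last xs" "b = hd xs" | "a = hd xs" "b = last xs"
    using i(1) hd last by (auto simp: doubleton_eq_iff)
  then show thesis
  proof cases
    case 1
    then show ?thesis using that xs by blast
  next
    case 2
    then show ?thesis using that[of "rev xs"] xs by (simp add: last_rev hd_rev cycle_edges_rev)
  qed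
qed

text \<open>With two vertices the closing edge would run back along the only edge of the path, hence
  the bound three.\<close>

lemma path_edges_closing_notin:
  assumes "distinct xs" "3 \<le> length xs"
  shows "{last xs, hd xs} \<notin> path_edges xs"
proof
  assume "{last xs, hd xs} \<in> path_edges xs"
  moreover have "xs \<noteq> []" using assms by auto
  ultimately obtain i where i: "{xs ! (length xs - 1), xs ! 0} = {xs ! i, xs ! Suc i}"
    "Suc i < length xs"
    by (auto simp: path_edges_conv_nth last_conv_nth hd_conv_nth)
  have "0 < length xs" "length xs - 1 < length xs" using assms by auto
  then show False using i assms by (auto simp: doubleton_eq_iff nth_eq_iff_index_eq)
qed

lemma path_edges_eq_cycle_edges:
  assumes "distinct xs" "3 \<le> length xs"
  shows "path_edges xs = cycle_edges xs - {{last xs, hd xs}}"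
proof -
  have "xs \<noteq> []" using assms by auto
  then show ?thesis using path_edges_closing_notin[OF assms] by (auto simp: cycle_edges_eq)
qed

lemma path_edges_subset: "e \<in> path_edges xs \<Longrightarrow> e \<subseteq> set xs"
  by (auto simp: path_edges_conv_nth)

lemma finite_knight_graph: "finite (knight_graph n)"
proof -
  have "knight_graph n \<subseteq> Pow (cells n)" by (auto simp: knight_graph_def)
  then show ?thesis by (rule finite_subset) (simp add: cells_def)
qed

lemma finite_tourney:
  assumes "tourney n \<C>"
  shows "finite \<C>"
proof -
  have "\<C> \<subseteq> Pow (knight_graph n)" using assms by (auto simp: tourney_def is_cycle_def)
  then show ?thesis by (rule finite_subset) (simp add: finite_knight_graph)
qed

lemma tourney_subset: "tourney n \<C> \<Longrightarrow> \<Union>\<C> \<subseteq> knight_graph n"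
  by (auto simp: tourney_def is_cycle_def)

lemma knight_graph_neq: "{u, v} \<in> knight_graph n \<Longrightarrow> u \<noteq> v"
  by (auto simp: knight_graph_def doubleton_eq_iff knight_move_def km_def)

lemma parallel_edges_swap: "parallel_edges v0 v1 v2 v3 \<Longrightarrow> parallel_edges v2 v3 v0 v1"
  by (auto simp: parallel_edges_def km_def prod_eq_iff)

lemma parallel_edges_flip: "parallel_edges v0 v1 v2 v3 \<Longrightarrow> parallel_edges v1 v0 v3 v2"
  by (auto simp: parallel_edges_def km_def prod_eq_iff)

text \<open>A rail is an unordered pair of edges; exchanging the two edges preserves all its
  conditions, so the quadruple can be adapted to any given order of them.\<close>

lemma rails_ordered:
  assumes r: "{e, e'} \<in> rails n G"
  obtains v0 v1 v2 v3 where "e = {v0, v1}" "e' = {v2, v3}" "parallel_edges v0 v1 v2 v3"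
    "{v0, v1} \<in> G" "{v2, v3} \<in> G" "{v0, v2} \<in> knight_graph n" "{v1, v3} \<in> knight_graph n"
    "{v0, v2} \<notin> G" "{v1, v3} \<notin> G"
proof -
  from r obtain v0 v1 v2 v3 where v: "{e, e'} = {{v0, v1}, {v2, v3}}"
    "parallel_edges v0 v1 v2 v3"
    "{v0, v1} \<in> G" "{v2, v3} \<in> G" "{v0, v2} \<in> knight_graph n" "{v1, v3} \<in> knight_graph n"
    "{v0, v2} \<notin> G" "{v1, v3} \<notin> G"
    unfolding rails_def by blast
  from v(1) consider "e = {v0, v1}" "e' = {v2, v3}" | "e = {v2, v3}" "e' = {v0, v1}"
    by (metis doubleton_eq_iff)
  then show thesis
  proof cases
    case 1
    then show ?thesis using that v(2-) by blast
  next
    case 2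
    have "{v2, v0} = {v0, v2}" "{v3, v1} = {v1, v3}" by auto
    then show ?thesis using that[OF 2 parallel_edges_swap[OF v(2)]] v(3-) by simp
  qed
qed

text \<open>Cut at the rail, the cycles become paths from \<open>v1\<close> to \<open>v0\<close> and
  from \<open>v2\<close> to \<open>v3\<close>. Their concatenation passes from \<open>v0\<close> to
  \<open>v2\<close> and closes from \<open>v3\<close> to \<open>v1\<close>, which are exactly the
  new edges. The clause on \<open>\<Union>X\<close> lets the induction over all rails track the
  cells of the merged cycle.\<close>

lemma tourney_switch:
  assumes t: "tourney n \<C>" and r: "{e, e'} \<in> rails n (\<Union>\<C>)"
    and C: "C \<in> \<C>" "C' \<in> \<C>" "C \<noteq> C'" "e \<in> C" "e' \<in> C'"
  shows "\<exists>X. tourney n (insert X (\<C> - {C, C'})) \<and>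
    \<Union>(insert X (\<C> - {C, C'})) = switch {e, e'} (\<Union>\<C>) \<and> \<Union>X = \<Union>C \<union> \<Union>C'"
proof -
  from r obtain v0 v1 v2 v3 where v: "e = {v0, v1}" "e' = {v2, v3}" "parallel_edges v0 v1 v2 v3"
    "{v0, v2} \<in> knight_graph n" "{v1, v3} \<in> knight_graph n"
    by (rule rails_ordered)
  have new: "new_edges {e, e'} = {{v0, v2}, {v1, v3}}"
    unfolding v(1,2) by (rule new_edges_eq[OF refl v(3)])
  have "is_cycle n C" "is_cycle n C'" using t C by (auto simp: tourney_def)
  then obtain xs' ys' where xs': "3 \<le> length xs'" "distinct xs'" "C = cycle_edges xs'"
    and ys': "3 \<le> length ys'" "distinct ys'" "C' = cycle_edges ys'"
    and kg: "C \<subseteq> knight_graph n" "C' \<subseteq> knight_graph n"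
    unfolding is_cycle_def by blast
  have "{v0, v1} \<in> cycle_edges xs'" using C v xs' by simp
  then obtain xs where xs: "3 \<le> length xs" "distinct xs" "C = cycle_edges xs"
    "last xs = v0" "hd xs = v1"
    using cycle_edges_reorder[of v0 v1 xs'] xs' by metis
  have "{v3, v2} \<in> cycle_edges ys'" using C v ys' by (simp add: insert_commute)
  then obtain ys where ys: "3 \<le> length ys" "distinct ys" "C' = cycle_edges ys"
    "last ys = v3" "hd ys = v2"
    using cycle_edges_reorder[of v3 v2 ys'] ys' by metis
  have ne: "xs \<noteq> []" "ys \<noteq> []" using xs ys by auto
  have U: "\<Union>C = set xs" "\<Union>C' = set ys" using xs ys by (simp_all add: Union_cycle_edges)
  have disj: "set xs \<inter> set ys = {}"
    unfolding U[symmetric] using tourney_cycle_unique[OF t C(1,2)] C(3) by blast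
  define X where "X = cycle_edges (xs @ ys)"
  have UX: "\<Union>X = \<Union>C \<union> \<Union>C'" unfolding X_def U by (simp add: Union_cycle_edges)
  have px: "path_edges xs = C - {e}" "path_edges ys = C' - {e'}"
    using path_edges_eq_cycle_edges xs ys v by (auto simp: insert_commute)
  have X: "X = (C - {e}) \<union> (C' - {e'}) \<union> {{v0, v2}, {v1, v3}}"
  proof -
    have "X = insert {v3, v1} (insert {v0, v2} (path_edges xs \<union> path_edges ys))"
      unfolding X_def using ne xs(4,5) ys(4,5) by (simp add: cycle_edges_eq path_edges_append)
    moreover have "{v3, v1} = {v1, v3}" by (rule insert_commute)
    ultimately show ?thesis unfolding px by blast
  qed
  have "X \<subseteq> knight_graph n" unfolding X using kg v by auto
  moreover have "3 \<le> length (xs @ ys)" "distinct (xs @ ys)" using xs ys disj by auto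
  ultimately have cyc: "is_cycle n X" unfolding is_cycle_def X_def by blast
  let ?D = "insert X (\<C> - {C, C'})"
  have uniq: "\<exists>!Y. Y \<in> ?D \<and> v \<in> \<Union>Y" if "v \<in> cells n" for v
  proof -
    have ex1: "\<exists>!Y. Y \<in> \<C> \<and> v \<in> \<Union>Y" using t that by (simp add: tourney_def)
    show ?thesis
    proof (cases "v \<in> \<Union>C \<union> \<Union>C'")
      case True
      then have "Y = C \<or> Y = C'" if "Y \<in> \<C>" "v \<in> \<Union>Y" for Y
        using ex1 that C by blast
      moreover have "v \<in> \<Union>X" using True UX by simp
      ultimately show ?thesis by (intro ex1I[of _ X]) blast+
    next
      case False
      then have "v \<notin> \<Union>X" using UX by simp
      then show ?thesis using ex1 False
        by (smt (verit, del_insts) DiffE DiffI Un_iff empty_iff insertE insertI2)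
    qed
  qed
  have all: "is_cycle n Y" if "Y \<in> ?D" for Y using t cyc that by (auto simp: tourney_def)
  have "tourney n ?D" unfolding tourney_def by (intro conjI ballI all uniq)
  moreover have "\<Union>?D = switch {e, e'} (\<Union>\<C>)"
  proof -
    have ne': "e \<noteq> {}" "e' \<noteq> {}" using v by auto
    define R where "R = \<Union>(\<C> - {C, C'})"
    have R: "\<Union>\<C> = C \<union> C' \<union> R" "\<Union>?D = X \<union> R" using C(1,2) unfolding R_def by blast+
    \<comment> \<open>Cycles share no cells, so deleting the two edges from the whole union affects
      only the two merged cycles.\<close>
    have "e \<notin> Y" "e' \<notin> Y" if "Y \<in> \<C> - {C, C'}" for Y
      using that ne' tourney_cycle_unique[OF t _ C(1) _ C(4)] tourney_cycle_unique[OF t _ C(2) _ C(5)]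
      by blast+
    then have "e \<notin> R" "e' \<notin> R" unfolding R_def by blast+
    moreover have "e \<notin> C'" "e' \<notin> C"
      using ne' tourney_cycle_unique[OF t C(2,1) _ C(4)] tourney_cycle_unique[OF t C(1,2) _ C(5)] C(3)
      by blast+
    ultimately have "X \<union> R = C \<union> C' \<union> R - {e, e'} \<union> {{v0, v2}, {v1, v3}}"
      unfolding X using C(4,5) by blast
    then have "\<Union>?D = \<Union>\<C> - {e, e'} \<union> {{v0, v2}, {v1, v3}}" by (simp only: R)
    then show ?thesis by (simp only: switch_def new)
  qed
  ultimately show ?thesis using UX by blast
qed

lemma tourney_switch_card:
  assumes "tourney n \<C>" "C \<in> \<C>" "C' \<in> \<C>" "C \<noteq> C'"
  shows "card (insert X (\<C> - {C, C'})) \<le> card \<C>"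
proof -
  have fin: "finite \<C>" using assms(1) by (rule finite_tourney)
  have "\<C> - {C, C'} \<subset> \<C>" using assms by blast
  then have "card (\<C> - {C, C'}) < card \<C>" by (rule psubset_card_mono[OF fin])
  moreover have "card (insert X (\<C> - {C, C'})) \<le> Suc (card (\<C> - {C, C'}))"
    by (rule card_insert_le_m1) auto
  ultimately show ?thesis by simp
qed

section \<open>Connectivity in multigraphs and the effect of switching a forest\<close>

definition cycle_of :: "edge set set \<Rightarrow> cell \<Rightarrow> edge set" where
  "cycle_of \<C> v = (THE C. C \<in> \<C> \<and> v \<in> \<Union>C)"

lemma cycle_of_eq:
  assumes "tourney n \<C>" "C \<in> \<C>" "v \<in> \<Union>C"
  shows "cycle_of \<C> v = C"
  unfolding cycle_of_def
proof (rule the_equality)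
  show "C \<in> \<C> \<and> v \<in> \<Union>C" using assms by blast
  fix C' assume "C' \<in> \<C> \<and> v \<in> \<Union>C'"
  then show "C' = C" using assms tourney_cycle_unique by blast
qed

lemma cycle_of_mem:
  assumes "tourney n \<C>" "v \<in> cells n"
  shows "cycle_of \<C> v \<in> \<C>" "v \<in> \<Union>(cycle_of \<C> v)"
proof -
  obtain C where "C \<in> \<C>" "v \<in> \<Union>C" using assms unfolding tourney_def by blast
  then show "cycle_of \<C> v \<in> \<C>" "v \<in> \<Union>(cycle_of \<C> v)"
    using cycle_of_eq[OF assms(1)] by metis+
qed

lemma tourney_edge_cells:
  assumes "tourney n \<C>" "e \<in> \<Union>\<C>"
  shows "e \<subseteq> cells n"
  using assms tourney_subset[of n \<C>] by (auto simp: knight_graph_def)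

text \<open>Since cycles share no cells, no third cycle meets the rail: it is an ordinary edge of
  the multigraph with two distinct ends.\<close>

lemma rail_ends_eq:
  assumes t: "tourney n \<C>" and r: "r \<in> rail_graph_edges n \<C>"
  obtains e e' C C' where "r = {e, e'}" "C \<in> \<C>" "C' \<in> \<C>" "C \<noteq> C'" "e \<in> C" "e' \<in> C'"
    "rail_ends \<C> r = {C, C'}"
proof -
  from r obtain e e' C C'
    where r_eq: "r = {e, e'}" and CC: "C \<in> \<C>" "C' \<in> \<C>" "C \<noteq> C'" "e \<in> C" "e' \<in> C'"
    and R: "r \<in> rails n (\<Union>\<C>)"
    by (auto simp: rail_graph_edges_def)
  have ne: "e \<noteq> {}" "e' \<noteq> {}" using R unfolding r_eq by (auto elim!: rails_ordered)
  have "Y = C \<or> Y = C'" if "Y \<in> \<C>" "r \<inter> Y \<noteq> {}" for Y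
    using that CC ne tourney_cycle_unique[OF t that(1) CC(1) _ CC(4)]
      tourney_cycle_unique[OF t that(1) CC(2) _ CC(5)] unfolding r_eq by blast
  then have "rail_ends \<C> r = {C, C'}" using CC unfolding rail_ends_def r_eq by blast
  then show thesis using that r_eq CC by blast
qed

lemma mg_connected_refl: "mg_connected ends E u u"
  by (simp add: mg_connected_def)

lemma mg_connected_trans:
  "mg_connected ends E u v \<Longrightarrow> mg_connected ends E v w \<Longrightarrow> mg_connected ends E u w"
  unfolding mg_connected_def by (rule rtrancl_trans)

lemma mg_connected_sym:
  assumes "mg_connected ends E u v"
  shows "mg_connected ends E v u"
proof -
  have "sym {(x, y). \<exists>e\<in>E. ends e = {x, y}}" by (auto simp: sym_def insert_commute)
  then show ?thesis using assms unfolding mg_connected_def by (meson sym_rtrancl symD)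
qed

lemma mg_connected_edge: "e \<in> E \<Longrightarrow> ends e = {u, v} \<Longrightarrow> mg_connected ends E u v"
  unfolding mg_connected_def by (intro r_into_rtrancl) auto

lemma mg_connected_mono: "mg_connected ends E u v \<Longrightarrow> E \<subseteq> F \<Longrightarrow> mg_connected ends F u v"
  unfolding mg_connected_def by (erule rtrancl_mono[THEN subsetD, rotated]) blast

text \<open>If the vertex put in front already occurs on the path, everything before that occurrence
  is a detour and is dropped.\<close>

lemma mg_connected_simple_path:
  assumes "mg_connected ends E u v"
  shows "\<exists>vs. vs \<noteq> [] \<and> hd vs = u \<and> last vs = v \<and> distinct vs \<and>
    successively (\<lambda>x y. \<exists>e\<in>E. ends e = {x, y}) vs"
  using assms unfolding mg_connected_def
proof (induction rule: converse_rtrancl_induct)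
  case base
  show ?case by (intro exI[of _ "[v]"]) simp
next
  case (step u w)
  then obtain vs where vs: "vs \<noteq> []" "hd vs = w" "last vs = v" "distinct vs"
    "successively (\<lambda>x y. \<exists>e\<in>E. ends e = {x, y}) vs" by blast
  show ?case
  proof (cases "u \<in> set vs")
    case True
    then obtain as bs where "vs = as @ u # bs" by (auto dest: split_list)
    then show ?thesis using vs by (intro exI[of _ "u # bs"]) (auto simp: successively_append_iff)
  next
    case False
    then show ?thesis using vs step(1)
      by (intro exI[of _ "u # vs"]) (auto simp: successively_Cons)
  qed
qed

text \<open>A simple path closed up by \<open>r\<close>. If the path is a single edge, the result is
  a pair of parallel edges, which \<open>mg_cycle\<close> counts as a cycle.\<close>

lemma mg_cycle_if_connected:
  assumes conn: "mg_connected ends E u v" and r: "u \<noteq> v" "r \<notin> E" "ends r = {u, v}"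
  shows "\<exists>vs es. mg_cycle ends (insert r E) vs es"
proof -
  obtain vs where vs: "vs \<noteq> []" "hd vs = u" "last vs = v" "distinct vs"
    "successively (\<lambda>x y. \<exists>e\<in>E. ends e = {x, y}) vs"
    using mg_connected_simple_path[OF conn] by blast
  define m where "m = length vs - 1"
  have len: "length vs = Suc m" using vs(1) by (simp add: m_def)
  have u: "vs ! 0 = u" and v: "vs ! m = v"
    using vs(1-3) len by (simp_all add: hd_conv_nth last_conv_nth)
  have "\<exists>e\<in>E. ends e = {vs ! i, vs ! Suc i}" if "i < m" for i
    using vs(5) that len by (simp add: successively_conv_nth)
  then obtain f where f: "f i \<in> E" "ends (f i) = {vs ! i, vs ! Suc i}" if "i < m" for i
    by metis
  have inj: "i = j" if "vs ! i = vs ! j" "i \<le> m" "j \<le> m" for i j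
    using that vs(4) len by (simp add: nth_eq_iff_index_eq)
  \<comment> \<open>Edges along a simple path are distinct: two equal ones would have equal ends,
    which forces \<open>i = Suc j\<close> and \<open>Suc i = j\<close> at once.\<close>
  have "i = j" if "i < m" "j < m" "f i = f j" for i j
  proof -
    have eq: "{vs ! i, vs ! Suc i} = {vs ! j, vs ! Suc j}" using f that by metis
    show ?thesis
    proof (rule ccontr)
      assume "i \<noteq> j"
      then have "vs ! i = vs ! Suc j" "vs ! Suc i = vs ! j"
        using eq inj[of i j] that by (auto simp: doubleton_eq_iff)
      then have "i = Suc j" "Suc i = j" using inj[of i "Suc j"] inj[of "Suc i" j] that by auto
      then show False by simp
    qed
  qed
  then have "inj_on f {0..<m}" by (auto simp: inj_on_def)
  moreover define es where "es = map f [0..<m] @ [r]"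
  ultimately have "distinct es" using f r(2) by (auto simp: distinct_map)
  moreover have "ends (es ! i) = {vs ! i, vs ! (Suc i mod Suc m)}" if "i < Suc m" for i
  proof (cases "i < m")
    case True
    then show ?thesis using f by (simp add: es_def nth_append)
  next
    case False
    then have "i = m" using that by simp
    then show ?thesis using r(3) u v by (simp add: es_def nth_append insert_commute)
  qed
  moreover have "length es = Suc m" "set es \<subseteq> insert r E" using f by (auto simp: es_def)
  ultimately have "mg_cycle ends (insert r E) vs es"
    using vs(1,4) len by (simp add: mg_cycle_def)
  then show ?thesis by blast
qed

lemma mg_cycle_mono: "mg_cycle ends E vs es \<Longrightarrow> E \<subseteq> F \<Longrightarrow> mg_cycle ends F vs es"
  by (auto simp: mg_cycle_def)

text \<open>The conjunct on connectivity strengthens the induction. It refers to all of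
  \<open>set ds\<close>, including rails that \<open>switch_rail\<close> left alone, so passing over
  a rail preserves it by monotonicity.\<close>

lemma fold_switch_rail_tourney:
  assumes t: "tourney n \<C>" and sub: "set ds \<subseteq> rail_graph_edges n \<C>" and d: "distinct ds"
    and acyc: "\<nexists>vs es. mg_cycle (rail_ends \<C>) (set ds) vs es"
  shows "\<exists>\<D>. tourney n \<D> \<and> fold (switch_rail n) ds (\<Union>\<C>) = \<Union>\<D> \<and> card \<D> \<le> card \<C> \<and>
    (\<forall>X\<in>\<D>. \<forall>u\<in>\<Union>X. \<forall>v\<in>\<Union>X.
       mg_connected (rail_ends \<C>) (set ds) (cycle_of \<C> u) (cycle_of \<C> v))"
  using sub d acyc
proof (induction ds rule: rev_induct)
  case Nil
  have "mg_connected (rail_ends \<C>) {} (cycle_of \<C> u) (cycle_of \<C> v)"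
    if "X \<in> \<C>" "u \<in> \<Union>X" "v \<in> \<Union>X" for X u v
    using cycle_of_eq[OF t that(1,2)] cycle_of_eq[OF t that(1,3)] by (simp add: mg_connected_refl)
  then show ?case using t by (intro exI[of _ \<C>]) simp
next
  case (snoc r ds)
  let ?conn = "mg_connected (rail_ends \<C>)"
  have ds: "set ds \<subseteq> rail_graph_edges n \<C>" "distinct ds" using snoc.prems by auto
  have ds': "\<nexists>vs es. mg_cycle (rail_ends \<C>) (set ds) vs es"
    using snoc.prems(3) mg_cycle_mono[of _ "set ds" _ _ "set (ds @ [r])"]
    by (metis set_append Un_upper1)
  obtain \<D> where \<D>: "tourney n \<D>" "fold (switch_rail n) ds (\<Union>\<C>) = \<Union>\<D>"
    "card \<D> \<le> card \<C>"
    and "\<forall>X\<in>\<D>. \<forall>u\<in>\<Union>X. \<forall>v\<in>\<Union>X. ?conn (set ds) (cycle_of \<C> u) (cycle_of \<C> v)"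
    using snoc.IH[OF ds ds'] by metis
  then have conn: "\<And>X u v. X \<in> \<D> \<Longrightarrow> u \<in> \<Union>X \<Longrightarrow> v \<in> \<Union>X \<Longrightarrow>
      ?conn (set ds) (cycle_of \<C> u) (cycle_of \<C> v)"
    by metis
  have mono: "?conn (set (ds @ [r])) C C'" if "?conn (set ds) C C'" for C C'
    using that by (rule mg_connected_mono) auto
  show ?case
  proof (cases "r \<in> rails n (\<Union>\<D>)")
    case False
    then have "fold (switch_rail n) (ds @ [r]) (\<Union>\<C>) = \<Union>\<D>"
      using \<D>(2) by (simp add: switch_rail_def[of n r])
    then show ?thesis using \<D>(1,3) by (intro exI[of _ \<D>] conjI ballI mono conn)
  next
    case True
    have "r \<in> rail_graph_edges n \<C>" using snoc.prems(1) by simp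
    then obtain e e' C C' where r: "r = {e, e'}" and C: "C \<in> \<C>" "C' \<in> \<C>" "C \<noteq> C'"
      "e \<in> C" "e' \<in> C'" "rail_ends \<C> r = {C, C'}"
      by (rule rail_ends_eq[OF t])
    obtain v0 v1 v2 v3 where v: "e = {v0, v1}" "e' = {v2, v3}"
      "{v0, v1} \<in> \<Union>\<D>" "{v2, v3} \<in> \<Union>\<D>"
      using True unfolding r by (rule rails_ordered)
    then obtain X Y where XY: "X \<in> \<D>" "Y \<in> \<D>" "e \<in> X" "e' \<in> Y" by blast
    have mem: "v0 \<in> \<Union>C" "v2 \<in> \<Union>C'" "v0 \<in> \<Union>X" "v2 \<in> \<Union>Y" using C(4,5) XY(3,4) v by blast+
    then have cyc: "cycle_of \<C> v0 = C" "cycle_of \<C> v2 = C'" using cycle_of_eq[OF t] C by blast+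
    \<comment> \<open>The only use of acyclicity: in a common current cycle the ends of
      \<open>r\<close> would be connected without \<open>r\<close>, and \<open>r\<close> would close
      a cycle.\<close>
    have "X \<noteq> Y"
    proof
      assume "X = Y"
      then have "?conn (set ds) C C'" using conn[OF XY(1), of v0 v2] mem cyc by simp
      moreover have "r \<notin> set ds" using snoc.prems(2) by simp
      ultimately show False
        using mg_cycle_if_connected[of "rail_ends \<C>" "set ds" C C' r] C snoc.prems(3) by simp
    qed
    then obtain Z where Z: "tourney n (insert Z (\<D> - {X, Y}))"
      "\<Union>(insert Z (\<D> - {X, Y})) = switch r (\<Union>\<D>)" "\<Union>Z = \<Union>X \<union> \<Union>Y"
      using tourney_switch[OF \<D>(1) True[unfolded r] XY(1,2) _ XY(3,4)] r by metis
    have "card (insert Z (\<D> - {X, Y})) \<le> card \<C>"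
      using tourney_switch_card[OF \<D>(1) XY(1,2) \<open>X \<noteq> Y\<close>, of Z] \<D>(3) by simp
    moreover have "fold (switch_rail n) (ds @ [r]) (\<Union>\<C>) = \<Union>(insert Z (\<D> - {X, Y}))"
      using True \<D>(2) Z(2) by (simp add: switch_rail_def[of n r])
    moreover have "?conn (set (ds @ [r])) (cycle_of \<C> u) (cycle_of \<C> v)"
      if "W \<in> insert Z (\<D> - {X, Y})" "u \<in> \<Union>W" "v \<in> \<Union>W" for W u v
    proof (cases "W = Z")
      case False
      then show ?thesis using that conn mono by blast
    next
      case True
      \<comment> \<open>All cells of the merged cycle are compared with the original cycle
        \<open>C\<close>; those coming from \<open>Y\<close> reach it through \<open>C'\<close> and
        the rail \<open>r\<close> itself.\<close>
      have base: "?conn (set (ds @ [r])) (cycle_of \<C> w) C" if "w \<in> \<Union>Z" for w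
      proof (cases "w \<in> \<Union>X")
        case True
        then show ?thesis using conn[OF XY(1) _ mem(3), of w] cyc mono by simp
      next
        case False
        then have "w \<in> \<Union>Y" using that Z(3) by blast
        then have "?conn (set (ds @ [r])) (cycle_of \<C> w) C'"
          using conn[OF XY(2) _ mem(4), of w] cyc mono by simp
        moreover have "?conn (set (ds @ [r])) C' C"
          using C(6) by (intro mg_connected_edge[of r]) (auto simp: insert_commute)
        ultimately show ?thesis by (rule mg_connected_trans)
      qed
      have "u \<in> \<Union>Z" "v \<in> \<Union>Z" using that(2,3) unfolding True .
      then show ?thesis by (intro mg_connected_trans[OF base mg_connected_sym[OF base]])
    qed
    ultimately show ?thesis using Z(1) by (intro exI[of _ "insert Z (\<D> - {X, Y})"] conjI ballI)
  qed
qed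

lemma join_tourney:
  assumes t: "tourney n \<C>" and j: "join n \<C> H"
  shows "\<exists>\<D>. tourney n \<D> \<and> H = \<Union>\<D> \<and> card \<D> \<le> card \<C>"
proof -
  from j obtain D ds where D: "spanning_forest \<C> (rail_graph_edges n \<C>) (rail_ends \<C>) D"
    "distinct ds" "set ds = D" "H = fold (switch_rail n) ds (\<Union>\<C>)"
    unfolding join_def by blast
  then show ?thesis
    using fold_switch_rail_tourney[OF t, of ds] unfolding spanning_forest_def by metis
qed

section \<open>Searching the rail graph\<close>

definition nbrs :: "graph \<Rightarrow> cell \<Rightarrow> cell set" where
  "nbrs G v = {w. {v, w} \<in> G}"

lemma nbrs_sym: "w \<in> nbrs G v \<longleftrightarrow> v \<in> nbrs G w"
  by (simp add: nbrs_def insert_commute)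

lemma nbrs_cells: "tourney n \<C> \<Longrightarrow> w \<in> nbrs (\<Union>\<C>) v \<Longrightarrow> v \<in> cells n \<and> w \<in> cells n"
  using tourney_edge_cells[of n \<C> "{v, w}"] by (auto simp: nbrs_def)

lemma nbrs_irrefl: "tourney n \<C> \<Longrightarrow> v \<notin> nbrs (\<Union>\<C>) v"
  using tourney_subset[of n \<C>] knight_graph_neq[of v v n] by (auto simp: nbrs_def)

lemma nbrs_cycle_of:
  assumes t: "tourney n \<C>" and w: "w \<in> nbrs (\<Union>\<C>) v"
  shows "cycle_of \<C> w = cycle_of \<C> v"
proof -
  from w obtain C where C: "C \<in> \<C>" "{v, w} \<in> C" by (auto simp: nbrs_def)
  then have "v \<in> \<Union>C" "w \<in> \<Union>C" by blast+
  then show ?thesis using cycle_of_eq[OF t C(1)] by simp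
qed

text \<open>The cycle is opened at an edge incident with \<open>v\<close>. Removing \<open>v\<close>
  leaves a path whose two ends are the neighbours, and these differ because the path has at least
  two cells.\<close>

lemma tourney_nbrs:
  assumes t: "tourney n \<C>" and v: "v \<in> cells n"
  obtains a b where "a \<noteq> b" "nbrs (\<Union>\<C>) v = {a, b}"
proof -
  obtain C where C: "C \<in> \<C>" "v \<in> \<Union>C" using cycle_of_mem[OF t v] by blast
  have "is_cycle n C" using t C by (simp add: tourney_def)
  then obtain vs where vs: "3 \<le> length vs" "distinct vs" "C = cycle_edges vs"
    by (auto simp: is_cycle_def)
  from C(2) obtain e where e: "e \<in> C" "v \<in> e" by blast
  have "e \<in> knight_graph n" using t C(1) e(1) tourney_subset by blast
  then obtain b where b: "e = {v, b}" using e(2) by (auto simp: knight_graph_def)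
  then have "{v, b} \<in> cycle_edges vs" using e vs by simp
  then obtain xs where xs: "3 \<le> length xs" "distinct xs" "C = cycle_edges xs"
    "last xs = v" "hd xs = b"
    using cycle_edges_reorder[of v b vs] vs by metis
  define ys where "ys = butlast xs"
  have xs_eq: "xs = ys @ [v]" using xs by (cases xs rule: rev_cases) (auto simp: ys_def)
  have ys: "2 \<le> length ys" "distinct ys" "v \<notin> set ys" "ys \<noteq> []"
    using xs(1,2) by (auto simp: xs_eq)
  have "C = insert {v, hd ys} (insert {last ys, v} (path_edges ys))"
    using ys(4) unfolding xs(3) by (simp add: cycle_edges_eq xs_eq path_edges_append)
  moreover have "{v, w} \<notin> path_edges ys" for w
    using path_edges_subset[of "{v, w}" ys] ys(3) by auto
  ultimately have "{v, w} \<in> C \<longleftrightarrow> w = hd ys \<or> w = last ys" for w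
    by (auto simp: doubleton_eq_iff)
  moreover have "{v, w} \<in> \<Union>\<C> \<longleftrightarrow> {v, w} \<in> C" for w
    using tourney_cycle_unique[OF t _ C(1)] C by blast
  ultimately have "nbrs (\<Union>\<C>) v = {hd ys, last ys}" by (auto simp: nbrs_def)
  moreover have "hd ys \<noteq> last ys" using ys
    by (simp add: hd_conv_nth last_conv_nth nth_eq_iff_index_eq)
  ultimately show thesis using that by blast
qed

text \<open>Listed from \<open>v\<close> on, each cell of the cycle is a neighbour of its
  predecessor, so a closed set swallows the cycle. This turns knowledge about visited cells into
  knowledge about whole cycles.\<close>

lemma closed_cycle_of:
  assumes t: "tourney n \<C>" and cl: "\<And>v. v \<in> S \<Longrightarrow> nbrs (\<Union>\<C>) v \<subseteq> S" and v: "v \<in> S" "v \<in> cells n"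
    and w: "w \<in> cells n" "cycle_of \<C> w = cycle_of \<C> v"
  shows "w \<in> S"
proof -
  define C where "C = cycle_of \<C> v"
  have C: "C \<in> \<C>" "v \<in> \<Union>C" "w \<in> \<Union>C"
    using cycle_of_mem[OF t v(2)] cycle_of_mem[OF t w(1)] w(2) by (auto simp: C_def)
  have "is_cycle n C" using t C by (simp add: tourney_def)
  then obtain vs where vs: "3 \<le> length vs" "distinct vs" "C = cycle_edges vs"
    by (auto simp: is_cycle_def)
  have "v \<in> set vs" using C(2) vs(3) by (simp add: Union_cycle_edges)
  then obtain as bs where "vs = as @ v # bs" by (auto dest: split_list)
  then have "cycle_edges vs = cycle_edges ((v # bs) @ as)" "set vs = set ((v # bs) @ as)"
    using cycle_edges_append_commute[of as "v # bs"] by auto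
  then obtain xs where xs: "C = cycle_edges (v # xs)" "w \<in> set (v # xs)"
    using C(3) vs(3) by (auto simp: Union_cycle_edges)
  have "(v # xs) ! i \<in> S" if "i < length (v # xs)" for i
    using that
  proof (induction i)
    case 0
    then show ?case using v by simp
  next
    case (Suc i)
    have "{(v # xs) ! i, (v # xs) ! Suc i} \<in> path_edges (v # xs)"
      using Suc.prems unfolding path_edges_conv_nth by blast
    then have "{(v # xs) ! i, (v # xs) ! Suc i} \<in> \<Union>\<C>"
      using C(1) xs(1) by (auto simp: cycle_edges_eq)
    then have "(v # xs) ! Suc i \<in> nbrs (\<Union>\<C>) ((v # xs) ! i)" by (simp add: nbrs_def)
    then show ?case using cl[OF Suc.IH] Suc.prems by auto
  qed
  then show ?thesis using xs(2) by (metis in_set_conv_nth)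
qed

text \<open>A cycle through \<open>r\<close> would reach \<open>w\<close> by a second edge, but no
  edge of \<open>E\<close> touches \<open>w\<close>; and \<open>r\<close> is not a loop.\<close>

lemma acyclic_insert_leaf:
  assumes acyc: "\<nexists>vs es. mg_cycle ends E vs es"
    and r: "ends r = {u, w}" "u \<noteq> w" and w: "\<And>e. e \<in> E \<Longrightarrow> w \<notin> ends e"
  shows "\<nexists>vs es. mg_cycle ends (insert r E) vs es"
proof
  assume "\<exists>vs es. mg_cycle ends (insert r E) vs es"
  then obtain vs es where c: "mg_cycle ends (insert r E) vs es" by blast
  define l where "l = length vs"
  have l: "0 < l" "length es = l" "distinct vs" "distinct es" "set es \<subseteq> insert r E"
    and en: "\<And>i. i < l \<Longrightarrow> ends (es ! i) = {vs ! i, vs ! (Suc i mod l)}"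
    using c by (auto simp: mg_cycle_def l_def)
  have "r \<in> set es"
  proof (rule ccontr)
    assume "r \<notin> set es"
    then have "mg_cycle ends E vs es" using c by (auto simp: mg_cycle_def)
    then show False using acyc by blast
  qed
  then obtain i where i: "i < l" "es ! i = r" using l by (auto simp: in_set_conv_nth)
  have "l \<noteq> 1" using en[OF i(1)] i r by (auto simp: doubleton_eq_iff)
  then have l2: "2 \<le> l" using l(1) by simp
  have only: "k = i" if "k < l" "w \<in> ends (es ! k)" for k
  proof -
    have "es ! k \<in> set es" using l(2) that(1) by simp
    then have "es ! k \<in> insert r E" using l(5) by blast
    then have "es ! k = r" using w that(2) by blast
    then show ?thesis using i that(1) l by (simp add: nth_eq_iff_index_eq[symmetric, of es])
  qed
  have m: "Suc i mod l < l" using l(1) by simp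
  from en[OF i(1)] i r consider "w = vs ! i" | "w = vs ! (Suc i mod l)"
    by (auto simp: doubleton_eq_iff)
  then show False
  proof cases
    case 1
    \<comment> \<open>The position of the other cycle edge at \<open>vs ! i\<close>, with
      wrap-around.\<close>
    define k where "k = (if i = 0 then l - 1 else i - 1)"
    have k: "k < l" "Suc k mod l = i" "k \<noteq> i" using i(1) l2 by (auto simp: k_def)
    then have "w \<in> ends (es ! k)" using en[OF k(1)] 1 by simp
    then show False using only k by blast
  next
    case 2
    then have "w \<in> ends (es ! (Suc i mod l))" using en[OF m] by simp
    then have "Suc i mod l = i" using only m by blast
    then show False using i(1) l2 by (cases "Suc i < l") (auto simp: mod_if split: if_splits)
  qed
qed

lemma rails_subset: "r \<in> rails n G \<Longrightarrow> r \<subseteq> G"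
  by (auto simp: rails_def)

definition knight_moves :: "(int \<times> int) list" where
  "knight_moves = [(1, 2), (1, -2), (-1, 2), (-1, -2), (2, 1), (2, -1), (-2, 1), (-2, -1)]"

lemma knight_move_iff: "knight_move d \<longleftrightarrow> d \<in> set knight_moves"
proof -
  have "\<bar>x\<bar> = 1 \<longleftrightarrow> x = 1 \<or> x = -1" "\<bar>x\<bar> = 2 \<longleftrightarrow> x = 2 \<or> x = -2" for x :: int by arith+
  then show ?thesis unfolding knight_move_def knight_moves_def
    by (cases d) (simp only: fst_conv snd_conv list.set insert_iff empty_iff prod.inject, blast)
qed

text \<open>Chosen rails are stored as quadruples, because the switching program must know which
  cell is shifted to which.\<close>

fun rail_of :: "cell \<times> cell \<times> cell \<times> cell \<Rightarrow> rail" where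
  "rail_of (v0, v1, v2, v3) = {{v0, v1}, {v2, v3}}"

section \<open>Invariants of the walk and of the search, independent of the machine\<close>

locale tourney_search =
  fixes n :: nat and \<C> :: "edge set set"
  assumes tourney: "tourney n \<C>"
begin

abbreviation "nb \<equiv> nbrs (\<Union>\<C>)"

lemma nb_facts:
  assumes "a \<in> nb x"
  shows "a \<in> cells n" "x \<in> cells n" "cycle_of \<C> a = cycle_of \<C> x" "x \<in> nb a"
  using nbrs_cells[OF tourney assms] nbrs_cycle_of[OF tourney assms] assms nbrs_sym[of a]
  by simp_all

text \<open>\<open>x\<close> and \<open>y\<close> are the loose ends of the arc walked so far: a
  neighbour of a queue cell that is missing from the queue is one of them. Each has a neighbour in
  the queue, so by degree two, marking it brings up at most one further missing cell. Once both ends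
  are in the queue, it is closed.\<close>

definition walk_inv :: "cell list \<Rightarrow> edge set \<Rightarrow> cell list \<Rightarrow> cell \<Rightarrow> cell \<Rightarrow> bool" where
  "walk_inv Q0 C Q x y \<longleftrightarrow> distinct Q \<and> set Q \<subseteq> cells n \<and>
     (\<exists>W. Q = Q0 @ W \<and> (\<forall>w\<in>set W. cycle_of \<C> w = C)) \<and>
     x \<in> cells n \<and> y \<in> cells n \<and> cycle_of \<C> x = C \<and> cycle_of \<C> y = C \<and>
     (\<forall>v\<in>set Q. nb v \<subseteq> insert x (insert y (set Q))) \<and>
     nb x \<inter> set Q \<noteq> {} \<and> nb y \<inter> set Q \<noteq> {}"

lemma walk_inv_start:
  assumes Q: "distinct Q" "set Q \<subseteq> cells n" "\<And>v. v \<in> set Q \<Longrightarrow> nb v \<subseteq> set Q"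
    and x: "x \<in> cells n" "x \<notin> set Q" and ab: "nb x = {a, b}"
  shows "walk_inv (Q @ [x]) (cycle_of \<C> x) (Q @ [x]) a b"
proof -
  have "a \<in> nb x" "b \<in> nb x" using ab by auto
  then have "a \<in> cells n" "b \<in> cells n" "cycle_of \<C> a = cycle_of \<C> x"
    "cycle_of \<C> b = cycle_of \<C> x" "x \<in> nb a" "x \<in> nb b"
    by (auto dest: nb_facts)
  moreover have "nb v \<subseteq> insert a (insert b (set (Q @ [x])))" if "v \<in> set (Q @ [x])" for v
  proof (cases "v = x")
    case False
    then show ?thesis using Q(3)[of v] that by auto
  qed (use ab in auto)
  moreover have "\<exists>W. Q @ [x] = (Q @ [x]) @ W \<and> (\<forall>w\<in>set W. cycle_of \<C> w = cycle_of \<C> x)"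
    by (intro exI[of _ "[]"]) simp
  moreover have "distinct (Q @ [x])" "set (Q @ [x]) \<subseteq> cells n" "x \<in> set (Q @ [x])"
    using Q(1,2) x by auto
  ultimately show ?thesis unfolding walk_inv_def by blast
qed

text \<open>At least one neighbour of \<open>x\<close> is in the queue. If it is \<open>a\<close>,
  the next cell is \<open>b\<close>; should \<open>b\<close> be visited as well, the walk is about
  to stop.\<close>

lemma walk_inv_step:
  assumes I: "walk_inv Q0 C Q x y" and x: "x \<notin> set Q" and ab: "nb x = {a, b}"
  shows "walk_inv Q0 C (Q @ [x]) (if a \<notin> set Q then a else b) y"
proof -
  have "a \<in> nb x" "b \<in> nb x" using ab by auto
  then have F: "a \<in> cells n" "b \<in> cells n" "cycle_of \<C> a = cycle_of \<C> x"
    "cycle_of \<C> b = cycle_of \<C> x" "x \<in> nb a" "x \<in> nb b"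
    by (auto dest: nb_facts)
  obtain W where W: "Q = Q0 @ W" "\<forall>w\<in>set W. cycle_of \<C> w = C"
    using I by (auto simp: walk_inv_def)
  have J: "distinct Q" "set Q \<subseteq> cells n" "x \<in> cells n" "y \<in> cells n" "cycle_of \<C> x = C"
    "cycle_of \<C> y = C" "nb y \<inter> set Q \<noteq> {}" "a \<in> set Q \<or> b \<in> set Q"
    and cl: "\<And>v. v \<in> set Q \<Longrightarrow> nb v \<subseteq> insert x (insert y (set Q))"
    using I ab by (auto simp: walk_inv_def)
  define z where "z = (if a \<notin> set Q then a else b)"
  have z: "z \<in> cells n" "cycle_of \<C> z = C" "x \<in> nb z" using F J(5) by (auto simp: z_def)
  have "nb v \<subseteq> insert z (insert y (set (Q @ [x])))" if "v \<in> set (Q @ [x])" for v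
  proof (cases "v = x")
    case True
    then show ?thesis using ab J(8) by (auto simp: z_def)
  next
    case False
    then show ?thesis using cl[of v] that by auto
  qed
  moreover have "\<exists>W. Q @ [x] = Q0 @ W \<and> (\<forall>w\<in>set W. cycle_of \<C> w = C)"
    using W J(5) by (intro exI[of _ "W @ [x]"]) auto
  moreover have "nb z \<inter> set (Q @ [x]) \<noteq> {}" "nb y \<inter> set (Q @ [x]) \<noteq> {}" using z(3) J(7) by auto
  moreover have "distinct (Q @ [x])" "set (Q @ [x]) \<subseteq> cells n" using J(1-3) x by auto
  ultimately show ?thesis
    unfolding walk_inv_def z_def[symmetric] using z(1,2) J(4,6) by (intro conjI ballI)
qed

text \<open>An end absorbed by the queue is no longer loose, so the other end can take both roles
  and be moved by a second walk.\<close>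

lemma walk_inv_switch: "walk_inv Q0 C Q x y \<Longrightarrow> x \<in> set Q \<Longrightarrow> walk_inv Q0 C Q y y"
  unfolding walk_inv_def by auto

lemma walk_inv_finish:
  assumes "walk_inv Q0 C Q y y" "y \<in> set Q"
  shows "distinct Q" "set Q \<subseteq> cells n" "\<And>v. v \<in> set Q \<Longrightarrow> nb v \<subseteq> set Q"
    "\<exists>W. Q = Q0 @ W \<and> (\<forall>w\<in>set W. cycle_of \<C> w = C)"
  using assms unfolding walk_inv_def by auto

definition linked :: "(cell \<times> cell \<times> cell \<times> cell) list \<Rightarrow> edge set \<Rightarrow> edge set \<Rightarrow> bool" where
  "linked ds = mg_connected (rail_ends \<C>) (rail_of ` set ds)"

definition spanned :: "(cell \<times> cell \<times> cell \<times> cell) list \<Rightarrow> rail \<Rightarrow> bool" where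
  "spanned ds r \<longleftrightarrow> (\<forall>C\<in>rail_ends \<C> r. \<forall>C'\<in>rail_ends \<C> r. linked ds C C')"

text \<open>The part of being a rail that depends only on the board. It is unaffected by switching,
  so that only four adjacency queries remain to be made at switching time.\<close>

fun shifted_edge :: "cell \<times> cell \<times> cell \<times> cell \<Rightarrow> bool" where
  "shifted_edge (v0, v1, v2, v3) \<longleftrightarrow> parallel_edges v0 v1 v2 v3 \<and> v0 \<noteq> v1 \<and>
     {v0, v2} \<in> knight_graph n \<and> {v1, v3} \<in> knight_graph n"

text \<open>The last conjunct says that all waiting cells belong to one tree; it can be maintained
  because a new root is taken only when the queue is exhausted. The bound
  \<open>length ds \<le> length Q\<close> limits the number of switches by the number of
  cells.\<close>

definition search_inv ::
    "cell list \<Rightarrow> nat \<Rightarrow> (cell \<times> cell \<times> cell \<times> cell) list \<Rightarrow> bool" where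
  "search_inv Q p ds \<longleftrightarrow> distinct Q \<and> set Q \<subseteq> cells n \<and> (\<forall>v\<in>set Q. nb v \<subseteq> set Q) \<and>
     (\<forall>d\<in>set ds. shifted_edge d \<and> rail_of d \<in> rail_graph_edges n \<C> \<and> \<Union>(rail_of d) \<subseteq> set Q) \<and>
     distinct (map rail_of ds) \<and>
     (\<nexists>vs es. mg_cycle (rail_ends \<C>) (rail_of ` set ds) vs es) \<and>
     p \<le> length Q \<and> length ds \<le> length Q \<and>
     (\<forall>i<p. \<forall>r\<in>rail_graph_edges n \<C>. Q ! i \<in> \<Union>r \<longrightarrow> spanned ds r) \<and>
     (\<forall>i<length Q. \<forall>j<length Q. p \<le> i \<longrightarrow> p \<le> j \<longrightarrow>
        linked ds (cycle_of \<C> (Q ! i)) (cycle_of \<C> (Q ! j)))"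

lemma search_inv_explored:
  "search_inv Q p ds \<Longrightarrow> i < p \<Longrightarrow> r \<in> rail_graph_edges n \<C> \<Longrightarrow> Q ! i \<in> \<Union>r \<Longrightarrow> spanned ds r"
  by (simp add: search_inv_def del: Union_iff)

lemma search_inv_rail:
  assumes "search_inv Q p ds" "d \<in> set ds"
  shows "shifted_edge d" "rail_of d \<in> rail_graph_edges n \<C>" "\<Union>(rail_of d) \<subseteq> set Q"
  using assms by (simp_all add: search_inv_def del: Union_iff)

lemma search_inv_linked:
  "search_inv Q p ds \<Longrightarrow> i < length Q \<Longrightarrow> j < length Q \<Longrightarrow> p \<le> i \<Longrightarrow> p \<le> j \<Longrightarrow>
    linked ds (cycle_of \<C> (Q ! i)) (cycle_of \<C> (Q ! j))"
  by (simp add: search_inv_def del: Union_iff)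

lemma linked_refl: "linked ds C C"
  by (simp add: linked_def mg_connected_refl)

lemma linked_sym: "linked ds C C' \<Longrightarrow> linked ds C' C"
  unfolding linked_def by (rule mg_connected_sym)

lemma linked_trans: "linked ds C C' \<Longrightarrow> linked ds C' C'' \<Longrightarrow> linked ds C C''"
  unfolding linked_def by (rule mg_connected_trans)

lemma linked_append: "linked ds C C' \<Longrightarrow> linked (ds @ ds') C C'"
  unfolding linked_def by (erule mg_connected_mono) auto

lemma spanned_append: "spanned ds r \<Longrightarrow> spanned (ds @ ds') r"
  unfolding spanned_def using linked_append by blast

lemma search_inv_init: "search_inv [] 0 []"
  by (auto simp: search_inv_def mg_cycle_def)

text \<open>No cell is waiting, so the clause on linked cells concerns only the appended cycle,
  which starts a new tree.\<close>

lemma search_inv_root: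
  assumes I: "search_inv Q (length Q) ds"
    and Q': "distinct (Q @ W)" "set (Q @ W) \<subseteq> cells n"
      "\<And>v. v \<in> set (Q @ W) \<Longrightarrow> nb v \<subseteq> set (Q @ W)"
    and W: "\<And>w. w \<in> set W \<Longrightarrow> cycle_of \<C> w = C"
  shows "search_inv (Q @ W) (length Q) ds"
proof -
  have "linked ds (cycle_of \<C> ((Q @ W) ! i)) (cycle_of \<C> ((Q @ W) ! j))"
    if "i < length (Q @ W)" "j < length (Q @ W)" "length Q \<le> i" "length Q \<le> j" for i j
  proof -
    have "(Q @ W) ! i \<in> set W" "(Q @ W) ! j \<in> set W" using that by (auto simp: nth_append)
    then show ?thesis using W by (simp add: linked_refl)
  qed
  moreover have "(Q @ W) ! i = Q ! i" if "i < length Q" for i using that by (simp add: nth_append)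
  moreover have "set Q \<subseteq> set (Q @ W)" by auto
  ultimately show ?thesis using I Q' unfolding search_inv_def by (auto 0 4)
qed

text \<open>Naming the ends of a rail by cells connects the rail graph with the queue, which
  contains cells and not cycles.\<close>

lemma rail_graph_edge_ends:
  assumes r: "{{v0, v1}, {v2, v3}} \<in> rail_graph_edges n \<C>"
  shows "rail_ends \<C> {{v0, v1}, {v2, v3}} = {cycle_of \<C> v0, cycle_of \<C> v2}"
proof -
  have "{{v0, v1}, {v2, v3}} \<in> rails n (\<Union>\<C>)" using r by (simp add: rail_graph_edges_def)
  then have "{{v0, v1}, {v2, v3}} \<subseteq> \<Union>\<C>" by (rule rails_subset)
  then have G: "{v0, v1} \<in> \<Union>\<C>" "{v2, v3} \<in> \<Union>\<C>" by (simp_all only: insert_subset)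
  have *: "{u, v} \<in> C \<longleftrightarrow> C = cycle_of \<C> u" if C: "C \<in> \<C>" and uv: "{u, v} \<in> \<Union>\<C>" for u v C
  proof
    assume "{u, v} \<in> C"
    then have "u \<in> \<Union>C" by blast
    then show "C = cycle_of \<C> u" using cycle_of_eq[OF tourney C] by simp
  next
    assume Cu: "C = cycle_of \<C> u"
    obtain C' where C': "C' \<in> \<C>" "{u, v} \<in> C'" using uv by blast
    then have "u \<in> \<Union>C'" by blast
    then have "cycle_of \<C> u = C'" using cycle_of_eq[OF tourney C'(1)] by simp
    then show "{u, v} \<in> C" using Cu C' by simp
  qed
  have "v0 \<in> cells n" "v2 \<in> cells n" using G tourney_edge_cells[OF tourney] by blast+
  then have "cycle_of \<C> v0 \<in> \<C>" "cycle_of \<C> v2 \<in> \<C>" using cycle_of_mem[OF tourney] by auto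
  moreover have "{{v0, v1}, {v2, v3}} \<inter> C \<noteq> {} \<longleftrightarrow> {v0, v1} \<in> C \<or> {v2, v3} \<in> C" for C
    by (simp add: disjoint_iff ex_disj_distrib)
  ultimately show ?thesis unfolding rail_ends_def using *[OF _ G(1)] *[OF _ G(2)] by auto
qed

text \<open>If \<open>v2\<close> is processed, its rails have all been examined; if it is waiting,
  it is linked to the front of the queue.\<close>

lemma search_inv_rail_seen:
  assumes I: "search_inv Q p ds" and p: "p < length Q"
    and r: "{{Q ! p, v1}, {v2, v3}} \<in> rail_graph_edges n \<C>" and v2: "v2 \<in> set Q"
  shows "spanned ds {{Q ! p, v1}, {v2, v3}}"
proof -
  obtain i where i: "i < length Q" "v2 = Q ! i" using v2 by (auto simp: in_set_conv_nth)
  show ?thesis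
  proof (cases "i < p")
    case True
    have "Q ! i \<in> \<Union>{{Q ! p, v1}, {v2, v3}}" using i by simp
    then show ?thesis by (rule search_inv_explored[OF I True r])
  next
    case False
    then have "linked ds (cycle_of \<C> (Q ! p)) (cycle_of \<C> v2)"
      using search_inv_linked[OF I p i(1)] i(2) by simp
    then show ?thesis
      unfolding spanned_def rail_graph_edge_ends[OF r] using linked_refl linked_sym by auto
  qed
qed

lemma search_inv_rail_new:
  assumes I: "search_inv Q p ds" and p: "p < length Q"
    and v1: "v1 \<in> nb (Q ! p)" and v3: "v3 \<in> nb v2"
    and sh: "parallel_edges (Q ! p) v1 v2 v3" "knight_move (km (Q ! p) v2)"
    and v2: "v2 \<notin> set Q"
    and Q': "distinct (Q @ W)" "set (Q @ W) \<subseteq> cells n"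
      "\<And>v. v \<in> set (Q @ W) \<Longrightarrow> nb v \<subseteq> set (Q @ W)"
    and W: "v2 \<in> set W" "\<And>w. w \<in> set W \<Longrightarrow> cycle_of \<C> w = cycle_of \<C> v2"
  shows "search_inv (Q @ W) p (ds @ [(Q ! p, v1, v2, v3)])"
    "{{Q ! p, v1}, {v2, v3}} \<in> rail_graph_edges n \<C>"
    "spanned (ds @ [(Q ! p, v1, v2, v3)]) {{Q ! p, v1}, {v2, v3}}"
proof -
  define v0 where "v0 = Q ! p"
  define ds' where "ds' = ds @ [(v0, v1, v2, v3)]"
  let ?r = "{{v0, v1}, {v2, v3}}"
  have v0: "v0 \<in> set Q" using p by (simp add: v0_def)
  have cl: "nb v \<subseteq> set Q" if "v \<in> set Q" for v using I that by (simp add: search_inv_def)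
  have c: "v0 \<in> cells n" "v1 \<in> cells n" "v2 \<in> cells n" "v3 \<in> cells n"
    using nbrs_cells[OF tourney v1] nbrs_cells[OF tourney v3] by (auto simp: v0_def)
  \<comment> \<open>A closed queue containing \<open>v0\<close> contains the whole cycle of
    \<open>v0\<close>, and \<open>v2\<close> is not in the queue.\<close>
  have ne: "cycle_of \<C> v0 \<noteq> cycle_of \<C> v2"
    using closed_cycle_of[OF tourney cl v0 c(1,3)] v2 by auto
  have cyc: "cycle_of \<C> v1 = cycle_of \<C> v0" "cycle_of \<C> v3 = cycle_of \<C> v2"
    using nbrs_cycle_of[OF tourney] v1 v3 v0_def by auto
  have G: "{v0, v1} \<in> \<Union>\<C>" "{v2, v3} \<in> \<Union>\<C>" using v1 v3 by (auto simp: nbrs_def v0_def)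
  \<comment> \<open>An edge of the tourney never leaves its cycle, so the new edges are absent
    without any test.\<close>
  have nG: "{v0, v2} \<notin> \<Union>\<C>" "{v1, v3} \<notin> \<Union>\<C>"
    using nbrs_cycle_of[OF tourney, of v2 v0] nbrs_cycle_of[OF tourney, of v3 v1] ne cyc
    by (auto simp: nbrs_def)
  have "km v1 v3 = km v0 v2" using sh(1) by (simp add: parallel_edges_def v0_def)
  then have "knight_move (km v0 v2)" "knight_move (km v1 v3)" using sh(2) by (simp_all add: v0_def)
  then have kg: "{v0, v2} \<in> knight_graph n" "{v1, v3} \<in> knight_graph n"
    using c unfolding knight_graph_def by blast+
  have rails: "?r \<in> rails n (\<Union>\<C>)"
    using G nG kg sh(1) unfolding rails_def v0_def[symmetric] by blast
  obtain C C' where CC: "C \<in> \<C>" "{v0, v1} \<in> C" "C' \<in> \<C>" "{v2, v3} \<in> C'" using G by blast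
  have "cycle_of \<C> v0 = C" "cycle_of \<C> v2 = C'"
    using cycle_of_eq[OF tourney] CC by blast+
  then have rge: "?r \<in> rail_graph_edges n \<C>"
    using rails CC ne unfolding rail_graph_edges_def by blast
  then show "{{Q ! p, v1}, {v2, v3}} \<in> rail_graph_edges n \<C>" by (simp add: v0_def)
  note ends = rail_graph_edge_ends[OF rge]
  have "linked ds' (cycle_of \<C> v0) (cycle_of \<C> v2)"
    unfolding linked_def ds'_def by (rule mg_connected_edge[of ?r]) (use ends in auto)
  then have lk: "linked ds' (cycle_of \<C> v2) (cycle_of \<C> v0)" by (rule linked_sym)
  then have "spanned ds' ?r" unfolding spanned_def ends using linked_refl linked_sym by auto
  then show "spanned (ds @ [(Q ! p, v1, v2, v3)]) {{Q ! p, v1}, {v2, v3}}"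
    by (simp add: ds'_def v0_def)
  have v2': "v2 \<notin> \<Union>(rail_of d)" if "d \<in> set ds" for d
    using search_inv_rail(3)[OF I that] v2 by blast
  \<comment> \<open>The cells of earlier rails all lie in the closed set \<open>Q\<close>, which
    misses \<open>v2\<close>; so the new cycle is a leaf.\<close>
  have old: "cycle_of \<C> v2 \<notin> rail_ends \<C> (rail_of d)" if d: "d \<in> set ds" for d
  proof
    obtain u0 u1 u2 u3 where du: "d = (u0, u1, u2, u3)" by (metis prod_cases4)
    assume "cycle_of \<C> v2 \<in> rail_ends \<C> (rail_of d)"
    moreover have du': "rail_of d \<in> rail_graph_edges n \<C>" "\<Union>(rail_of d) \<subseteq> set Q"
      by (rule search_inv_rail[OF I d])+
    ultimately have "cycle_of \<C> v2 = cycle_of \<C> u0 \<or> cycle_of \<C> v2 = cycle_of \<C> u2"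
      using rail_graph_edge_ends[of u0 u1 u2 u3] du by simp
    then obtain u where u: "cycle_of \<C> v2 = cycle_of \<C> u" "u \<in> {u0, u2}" by blast
    then have "u \<in> set Q" using du' du by auto
    moreover have "u \<in> cells n" using \<open>u \<in> set Q\<close> I by (auto simp: search_inv_def)
    ultimately show False using closed_cycle_of[OF tourney cl _ _ c(3) u(1)] v2 by auto
  qed
  have "\<nexists>vs es. mg_cycle (rail_ends \<C>) (insert ?r (rail_of ` set ds)) vs es"
    using I ends ne old
    by (intro acyclic_insert_leaf[of _ _ _ "cycle_of \<C> v0" "cycle_of \<C> v2"])
      (auto simp: search_inv_def)
  then have acyc: "\<nexists>vs es. mg_cycle (rail_ends \<C>) (rail_of ` set ds') vs es"
    by (simp add: ds'_def)
  have "?r \<notin> rail_of ` set ds" using v2' by blast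
  then have dist: "distinct (map rail_of ds')" using I by (auto simp: ds'_def search_inv_def)
  have cl': "nb v \<subseteq> set (Q @ W)" if "v \<in> set (Q @ W)" for v using Q'(3) that .
  have "v1 \<in> set Q" "v3 \<in> set (Q @ W)"
    using cl[OF v0] v1 cl'[of v2] W(1) v3 by (auto simp: v0_def)
  then have sub: "\<Union>?r \<subseteq> set (Q @ W)" using v0 W(1) by auto
  have "v0 \<noteq> v1" using v1 nbrs_irrefl[OF tourney, of v0] by (auto simp: v0_def)
  then have she: "shifted_edge (v0, v1, v2, v3)" using sh(1) kg by (simp add: v0_def)
  have ds: "shifted_edge d" "rail_of d \<in> rail_graph_edges n \<C>" "\<Union>(rail_of d) \<subseteq> set (Q @ W)"
    if "d \<in> set ds'" for d
  proof -
    consider "d \<in> set ds" | "d = (v0, v1, v2, v3)" using \<open>d \<in> set ds'\<close> by (auto simp: ds'_def)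
    then have "shifted_edge d \<and> rail_of d \<in> rail_graph_edges n \<C> \<and> \<Union>(rail_of d) \<subseteq> set (Q @ W)"
    proof cases
      case 1
      then show ?thesis using search_inv_rail[OF I 1] by auto
    next
      case 2
      then show ?thesis using she rge sub by simp
    qed
    then show "shifted_edge d" "rail_of d \<in> rail_graph_edges n \<C>" "\<Union>(rail_of d) \<subseteq> set (Q @ W)"
      by simp_all
  qed
  have expl: "spanned ds' r" if "i < p" "r \<in> rail_graph_edges n \<C>" "(Q @ W) ! i \<in> \<Union>r" for i r
  proof -
    have "(Q @ W) ! i = Q ! i" using that(1) p by (simp add: nth_append)
    then have "spanned ds r" using search_inv_explored[OF I that(1,2)] that(3) by simp
    then show ?thesis unfolding ds'_def by (rule spanned_append)
  qed
  \<comment> \<open>Cells that were waiting are linked to \<open>v0\<close> by the invariant, and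
    cells of the new cycle by the new rail.\<close>
  have base: "linked ds' (cycle_of \<C> ((Q @ W) ! i)) (cycle_of \<C> v0)"
    if "i < length (Q @ W)" "p \<le> i" for i
  proof (cases "i < length Q")
    case True
    then have "linked ds (cycle_of \<C> (Q ! i)) (cycle_of \<C> v0)"
      using search_inv_linked[OF I True p that(2)] by (simp add: v0_def)
    then show ?thesis unfolding ds'_def using True by (simp add: nth_append linked_append)
  next
    case False
    then have "(Q @ W) ! i \<in> set W" using that by (auto simp: nth_append)
    then show ?thesis using W(2) lk by simp
  qed
  have lnk: "linked ds' (cycle_of \<C> ((Q @ W) ! i)) (cycle_of \<C> ((Q @ W) ! j))"
    if "i < length (Q @ W)" "j < length (Q @ W)" "p \<le> i" "p \<le> j" for i j
    using base[OF that(1,3)] base[OF that(2,4)] linked_sym linked_trans by blast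
  have "length ds \<le> length Q" using I by (simp add: search_inv_def)
  \<comment> \<open>Each chosen rail brings at least one new cell, which keeps the number of rails
    below the length of the queue or equal to it.\<close>
  moreover have "length W > 0" using W(1) by (cases W) auto
  ultimately have "p \<le> length (Q @ W)" "length ds' \<le> length (Q @ W)"
    using p unfolding ds'_def length_append list.size by linarith+
  then have "search_inv (Q @ W) p ds'"
    unfolding search_inv_def using Q'(1,2) dist acyc
    by (intro conjI ballI allI impI ds expl lnk cl')
  then show "search_inv (Q @ W) p (ds @ [(Q ! p, v1, v2, v3)])" by (simp add: ds'_def v0_def)
qed

text \<open>Exchanging the two edges and reversing both of them brings the front cell into the place
  of \<open>v0\<close>. Then \<open>v2\<close> and \<open>v3\<close> are the translates of
  \<open>v0\<close> and \<open>v1\<close> by one knight move, so the hypothesis covers every rail at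
  this cell.\<close>

lemma search_inv_next:
  assumes I: "search_inv Q p ds" and p: "p < length Q"
    and sp: "\<And>v1 d. v1 \<in> nb (Q ! p) \<Longrightarrow> d \<in> set knight_moves \<Longrightarrow>
      {{Q ! p, v1}, {Q ! p + d, v1 + d}} \<in> rail_graph_edges n \<C> \<Longrightarrow>
      spanned ds {{Q ! p, v1}, {Q ! p + d, v1 + d}}"
  shows "search_inv Q (Suc p) ds"
proof -
  have *: "spanned ds r" if r: "r \<in> rail_graph_edges n \<C>" and v: "Q ! p \<in> \<Union>r" for r
  proof -
    obtain e e' where ee: "r = {e, e'}" "Q ! p \<in> e"
    proof -
      from r obtain e e' where "r = {e, e'}" by (auto simp: rail_graph_edges_def)
      moreover from this have "r = {e', e}" by (simp add: insert_commute)
      ultimately show thesis using v that by blast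
    qed
    have "{e, e'} \<in> rails n (\<Union>\<C>)" using r ee by (simp add: rail_graph_edges_def)
    then obtain v0 v1 v2 v3 where w: "e = {v0, v1}" "e' = {v2, v3}" "parallel_edges v0 v1 v2 v3"
      "{v0, v1} \<in> \<Union>\<C>" "{v0, v2} \<in> knight_graph n" "{v1, v3} \<in> knight_graph n"
      by (rule rails_ordered)
    have kg: "knight_move (km u w)" if "{u, w} \<in> knight_graph n" for u w
      using that by (auto simp: knight_graph_def doubleton_eq_iff knight_move_def km_def)
    have *: "spanned ds r" if "r = {{Q ! p, u1}, {u2, u3}}" "{Q ! p, u1} \<in> \<Union>\<C>"
      "parallel_edges (Q ! p) u1 u2 u3" "{Q ! p, u2} \<in> knight_graph n" for u1 u2 u3
    proof -
      have "u2 = Q ! p + km (Q ! p) u2" "u3 = u1 + km (Q ! p) u2"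
        using that(3) by (auto simp: parallel_edges_def km_def prod_eq_iff)
      moreover have "km (Q ! p) u2 \<in> set knight_moves"
        using kg[OF that(4)] by (simp add: knight_move_iff)
      moreover have "u1 \<in> nb (Q ! p)" using that(2) by (simp add: nbrs_def)
      ultimately show ?thesis using sp[of u1 "km (Q ! p) u2"] that(1) r by simp
    qed
    from ee(2) w(1) consider "Q ! p = v0" | "Q ! p = v1" by auto
    then show ?thesis
    proof cases
      case 1
      then show ?thesis using *[of v1 v2 v3] ee w by simp
    next
      case 2
      then show ?thesis using *[of v0 v3 v2] ee w parallel_edges_flip[OF w(3)]
        by (simp add: insert_commute)
    qed
  qed
  have "spanned ds r" if "i < Suc p" "r \<in> rail_graph_edges n \<C>" "Q ! i \<in> \<Union>r" for i r
    using that * search_inv_explored[OF I, of i r] by (cases "i = p") auto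
  then show ?thesis using I p unfolding search_inv_def by (auto simp: Suc_le_eq)
qed

text \<open>Every rail has a cell on the board and each such cell is processed, so the ends of every
  rail are linked; this transfers along paths of the rail graph edge by edge.\<close>

lemma search_inv_spanning_forest:
  assumes I: "search_inv Q (length Q) ds" and all: "cells n \<subseteq> set Q"
  shows "spanning_forest \<C> (rail_graph_edges n \<C>) (rail_ends \<C>) (set (map rail_of ds))"
proof -
  have sp: "spanned ds r" if r: "r \<in> rail_graph_edges n \<C>" for r
  proof -
    obtain e e' where ee: "r = {e, e'}" using r by (auto simp: rail_graph_edges_def)
    then have "{e, e'} \<in> rails n (\<Union>\<C>)" using r by (simp add: rail_graph_edges_def)
    then obtain v0 v1 where v: "e = {v0, v1}" "{v0, v1} \<in> \<Union>\<C>" by (rule rails_ordered)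
    then have "v0 \<in> set Q" using tourney_edge_cells[OF tourney v(2)] all by auto
    then obtain i where i: "i < length Q" "Q ! i = v0" by (auto simp: in_set_conv_nth)
    then have "Q ! i \<in> \<Union>r" using ee v by auto
    then show ?thesis by (rule search_inv_explored[OF I i(1) r])
  qed
  have "linked ds u v" if "mg_connected (rail_ends \<C>) (rail_graph_edges n \<C>) u v" for u v
    using that unfolding mg_connected_def
  proof (induction rule: rtrancl_induct)
    case base
    show ?case by (rule linked_refl)
  next
    case (step w z)
    then obtain r where "r \<in> rail_graph_edges n \<C>" "rail_ends \<C> r = {w, z}" by blast
    then have "linked ds w z" using sp[of r] by (simp add: spanned_def)
    then show ?case using step.IH linked_trans by blast
  qed
  then show ?thesis using I unfolding spanning_forest_def search_inv_def linked_def by auto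
qed

end

section \<open>Machine programs\<close>

fun loop_free :: "com \<Rightarrow> bool" where
  "loop_free (Seq c1 c2) \<longleftrightarrow> loop_free c1 \<and> loop_free c2"
| "loop_free (Cond p c1 c2) \<longleftrightarrow> loop_free c1 \<and> loop_free c2"
| "loop_free (While p c) \<longleftrightarrow> False"
| "loop_free c \<longleftrightarrow> True"

text \<open>Together with \<open>max_cost\<close> this reduces loop-free code to rewriting and a
  constant bound on its time. The values at \<open>While\<close> are dummies, ruled out by
  \<open>loop_free\<close>.\<close>

fun effect :: "com \<Rightarrow> state \<Rightarrow> state" where
  "effect Skip s = s"
| "effect (Assign x a) s = ((fst s)(x := aval a s), snd s)"
| "effect (Store a b) s = (fst s, (snd s)(aval a s := aval b s))"
| "effect (Seq c1 c2) s = effect c2 (effect c1 s)"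
| "effect (Cond p c1 c2) s = (if bval p s then effect c1 s else effect c2 s)"
| "effect (While p c) s = s"

fun max_cost :: "com \<Rightarrow> nat" where
  "max_cost Skip = 1"
| "max_cost (Assign x a) = 1 + acost a"
| "max_cost (Store a b) = 1 + acost a + acost b"
| "max_cost (Seq c1 c2) = max_cost c1 + max_cost c2"
| "max_cost (Cond p c1 c2) = bcost p + max (max_cost c1) (max_cost c2)"
| "max_cost (While p c) = 0"

lemma exec_loop_free:
  "loop_free c \<Longrightarrow> \<exists>t. exec c s t (effect c s) \<and> t \<le> max_cost c"
proof (induction c arbitrary: s)
  case (Seq c1 c2)
  then show ?case by (fastforce intro: exec.Seq add_mono)
next
  case (Cond p c1 c2)
  show ?case
  proof (cases "bval p s")
    case True
    then obtain t where "exec c1 s t (effect c1 s)" "t \<le> max_cost c1" using Cond by fastforce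
    then show ?thesis using True exec.Cond_True[of p s c1 t] by fastforce
  next
    case False
    then obtain t where "exec c2 s t (effect c2 s)" "t \<le> max_cost c2" using Cond by fastforce
    then show ?thesis using False exec.Cond_False[of p s c2 t] by fastforce
  qed
next
  case Skip
  show ?case by (auto intro: exec.Skip)
next
  case (Assign x a)
  show ?case unfolding effect.simps max_cost.simps by (rule exI, rule conjI, rule exec.Assign, rule order_refl)
next
  case (Store a b)
  show ?case unfolding effect.simps max_cost.simps by (rule exI, rule conjI, rule exec.Store, rule order_refl)
qed simp

lemma bcost_pos: "0 < bcost p"
  by (cases p) auto

text \<open>The ghost state \<open>g\<close> carries the abstract data that the machine state represents, and
  \<open>\<Phi>\<close> is a potential that pays for every iteration.\<close>

lemma exec_While_potential:
  assumes "I g s"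
    and step: "\<And>g s. I g s \<Longrightarrow> bval p s \<Longrightarrow>
      \<exists>t s' g'. exec c s t s' \<and> I g' s' \<and> t + bcost p + \<Phi> g' \<le> \<Phi> g"
  shows "\<exists>t s' g'. exec (While p c) s t s' \<and> I g' s' \<and> \<not> bval p s' \<and>
    t + \<Phi> g' \<le> \<Phi> g + bcost p"
  using assms(1)
proof (induction "\<Phi> g" arbitrary: g s rule: less_induct)
  case less
  show ?case
  proof (cases "bval p s")
    case False
    then show ?thesis using less.prems exec.While_False[of p s c]
      by (intro exI[of _ "bcost p"] exI[of _ s] exI[of _ g]) simp
  next
    case True
    then obtain t1 s1 g1 where 1: "exec c s t1 s1" "I g1 s1" "t1 + bcost p + \<Phi> g1 \<le> \<Phi> g"
      using step[OF less.prems] by blast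
    then have "\<Phi> g1 < \<Phi> g" using bcost_pos[of p] by linarith
    then obtain t2 s2 g2 where 2: "exec (While p c) s1 t2 s2" "I g2 s2" "\<not> bval p s2"
      "t2 + \<Phi> g2 \<le> \<Phi> g1 + bcost p"
      using less.hyps[OF _ 1(2)] by blast
    have "exec (While p c) s (bcost p + t1 + t2) s2"
      using True 1(1) 2(1) by (rule exec.While_True)
    moreover have "bcost p + t1 + t2 + \<Phi> g2 \<le> \<Phi> g + bcost p" using 1(3) 2(4) by linarith
    ultimately show ?thesis using 2(2,3) by blast
  qed
qed

text \<open>The machine cannot multiply. A constant factor is unrolled into additions, so the cost
  does not depend on the input.\<close>

fun scaled :: "nat \<Rightarrow> aexp \<Rightarrow> aexp" where
  "scaled 0 a = Const 0"
| "scaled (Suc k) a = Add a (scaled k a)"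

lemma aval_scaled [simp]: "aval (scaled k a) s = k * aval a s"
  by (induction k) auto

text \<open>The memory below \<open>3n\<^sup>2 + 1\<close> holds the adjacency lists. Above it there is one record of eight
  fields for each \<open>i < n\<^sup>2\<close>: row, column and visited flag of the \<open>i\<close>-th cell, the \<open>i\<close>-th entry of
  the search queue, and the four cells of the \<open>i\<close>-th chosen rail.

  Registers: 0 holds \<open>n\<close>, 1 holds \<open>n\<^sup>2\<close>, 2 the address of the first record, 3 the current cell or
  rail of a loop, 4 and 5 a row and a column, 6 and 7 the end and the front of the queue, 8 and 14
  the two ends of a walk, 9 to 12 the cells of a rail, 13 the number of chosen rails.\<close>

definition adj :: "nat \<Rightarrow> nat \<Rightarrow> nat" where
  "adj k i = 3 * i + k"

definition fld :: "nat \<Rightarrow> nat \<Rightarrow> nat \<Rightarrow> nat" where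
  "fld b f i = b + 8 * i + f"

definition Adj :: "nat \<Rightarrow> aexp \<Rightarrow> aexp" where
  "Adj k a = Add (scaled 3 a) (Const k)"

definition Fld :: "nat \<Rightarrow> aexp \<Rightarrow> aexp" where
  "Fld f a = Add (Add (Reg 2) (scaled 8 a)) (Const f)"

lemma aval_Adj [simp]: "aval (Adj k a) s = adj k (aval a s)"
  by (simp add: Adj_def adj_def)

lemma aval_Fld [simp]: "aval (Fld f a) s = fld (fst s 2) f (aval a s)"
  by (simp add: Fld_def fld_def)

text \<open>Offset 1 is the length of a list, offsets 2 and 3 are its entries; they start at 1
  because address 0 holds \<open>n\<close>.\<close>

lemma adj_eq_iff [simp]:
  "0 < k \<Longrightarrow> k \<le> 3 \<Longrightarrow> 0 < l \<Longrightarrow> l \<le> 3 \<Longrightarrow> adj k i = adj l j \<longleftrightarrow> k = l \<and> i = j"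
  unfolding adj_def by presburger

lemma fld_eq_iff [simp]:
  "f < 8 \<Longrightarrow> g < 8 \<Longrightarrow> fld b f i = fld b g j \<longleftrightarrow> f = g \<and> i = j"
proof -
  assume fg: "f < 8" "g < 8"
  have "(8 * i + f) div 8 = i" "(8 * i + f) mod 8 = f" "(8 * j + g) div 8 = j" "(8 * j + g) mod 8 = g"
    using fg by simp_all
  then have "8 * i + f = 8 * j + g \<longleftrightarrow> f = g \<and> i = j" by metis
  then show ?thesis by (simp add: fld_def)
qed

lemma adj_neq_0 [simp]: "0 < k \<Longrightarrow> adj k i \<noteq> 0" "0 < k \<Longrightarrow> 0 \<noteq> adj k i"
  by (auto simp: adj_def)

section \<open>Row-major numbering of the cells\<close>

lemma cell_index_less:
  assumes "v \<in> cells n"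
  shows "cell_index n v < n * n"
proof -
  have "nat (fst v) < n" "nat (snd v) < n" using assms by (auto simp: cells_def)
  then have "nat (fst v) * n + nat (snd v) < Suc (nat (fst v)) * n" by simp
  also have "\<dots> \<le> n * n" using \<open>nat (fst v) < n\<close> by (intro mult_le_mono1) simp
  finally show ?thesis by (simp add: cell_index_def)
qed

lemma cell_index_div_mod:
  assumes "v \<in> cells n"
  shows "cell_index n v div n = nat (fst v)" "cell_index n v mod n = nat (snd v)"
proof -
  have "nat (snd v) < n" using assms by (auto simp: cells_def)
  then show "cell_index n v div n = nat (fst v)" "cell_index n v mod n = nat (snd v)"
    by (simp_all add: cell_index_def)
qed

lemma cell_index_eq_iff:
  assumes "v \<in> cells n" "w \<in> cells n"
  shows "cell_index n v = cell_index n w \<longleftrightarrow> v = w"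
proof
  assume "cell_index n v = cell_index n w"
  then have "nat (fst v) = nat (fst w)" "nat (snd v) = nat (snd w)"
    using cell_index_div_mod assms by metis+
  then show "v = w" using assms by (auto simp: cells_def)
qed simp

lemma cell_index_surj:
  assumes "i < n * n"
  obtains v where "v \<in> cells n" "cell_index n v = i"
proof -
  have "0 < n" using assms by (cases n) auto
  then have "i div n < n" "i mod n < n" using assms by (auto simp: less_mult_imp_div_less)
  then show thesis
    by (intro that[of "(int (i div n), int (i mod n))"]) (auto simp: cells_def cell_index_def)
qed

lemma card_cells: "card (cells n) = n * n"
  by (simp add: cells_def)

text \<open>The condition \<open>0 \<le> a + e < n\<close>, raised by two so that a backward step of
  a knight stays nonnegative.\<close>

definition inside_test :: "nat \<Rightarrow> nat \<Rightarrow> int \<Rightarrow> bexp" where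
  "inside_test f x e = Conj (Less (Const 1) (Add (Load (Fld f (Reg x))) (Const (nat (e + 2)))))
     (Less (Add (Load (Fld f (Reg x))) (Const (nat (e + 2)))) (Add (Reg 0) (Const 2)))"

text \<open>Coordinates are tested instead of the index, since an index does not reveal a step
  across the left or right border. They are read from the records because the machine cannot
  divide.\<close>

definition on_board_test :: "nat \<Rightarrow> int \<times> int \<Rightarrow> bexp" where
  "on_board_test x d = Conj (inside_test 0 x (fst d)) (inside_test 1 x (snd d))"

text \<open>Both coordinates of the move are raised by two, since the machine has no negative numbers.\<close>

definition shift_exp :: "nat \<Rightarrow> int \<times> int \<Rightarrow> aexp" where
  "shift_exp x d = Sub (Add (Add (Reg x) (scaled (nat (fst d + 2)) (Reg 0))) (Const (nat (snd d + 2))))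
     (Add (scaled 2 (Reg 0)) (Const 2))"

text \<open>Raising both coordinates by two adds \<open>2 * n + 2\<close> to the index. For a target
  on the board the difference is nonnegative, so truncated subtraction is exact.\<close>

lemma cell_index_shift:
  assumes "v \<in> cells n" "v + d \<in> cells n" "-2 \<le> fst d" "-2 \<le> snd d"
  shows "cell_index n v + nat (fst d + 2) * n + nat (snd d + 2) - (2 * n + 2) = cell_index n (v + d)"
proof -
  have pos: "0 \<le> fst v" "0 \<le> snd v" "0 \<le> fst v + fst d" "0 \<le> snd v + snd d"
    using assms(1,2) by (simp_all add: cells_def mem_Times_iff)
  have "int (cell_index n (v + d)) + int (2 * n + 2) =
      int (cell_index n v + nat (fst d + 2) * n + nat (snd d + 2))"
    using pos assms(3,4) by (simp add: cell_index_def algebra_simps)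
  then show ?thesis by linarith
qed

lemma shifted_in_cells_iff:
  assumes "v \<in> cells n" "-2 \<le> fst d" "-2 \<le> snd d"
  shows "v + d \<in> cells n \<longleftrightarrow>
    1 < nat (fst v) + nat (fst d + 2) \<and> nat (fst v) + nat (fst d + 2) < n + 2 \<and>
    1 < nat (snd v) + nat (snd d + 2) \<and> nat (snd v) + nat (snd d + 2) < n + 2"
proof -
  have *: "0 \<le> a + e \<and> a + e < int n \<longleftrightarrow> 1 < nat a + nat (e + 2) \<and> nat a + nat (e + 2) < n + 2"
    if "0 \<le> a" "-2 \<le> e" for a e :: int
    using that by linarith
  have "0 \<le> fst v" "0 \<le> snd v" using assms by (auto simp: cells_def)
  then show ?thesis using *[of "fst v" "fst d"] *[of "snd v" "snd d"] assms(2,3)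
    by (auto simp: cells_def mem_Times_iff)
qed

section \<open>Program fragments for walking along a cycle and trying a knight move\<close>

definition mark_code :: com where
  "mark_code = Seq (Store (Fld 2 (Reg 8)) (Const 1)) (Seq (Store (Fld 3 (Reg 6)) (Reg 8))
     (Assign 6 (Add (Reg 6) (Const 1))))"

definition step_code :: com where
  "step_code = Seq mark_code (Cond (Equal (Load (Fld 2 (Load (Adj 2 (Reg 8))))) (Const 0))
     (Assign 8 (Load (Adj 2 (Reg 8)))) (Assign 8 (Load (Adj 3 (Reg 8)))))"

definition walk_test :: bexp where
  "walk_test = Equal (Load (Fld 2 (Reg 8))) (Const 0)"

definition start_code :: com where
  "start_code = Seq mark_code
     (Seq (Assign 14 (Load (Adj 3 (Reg 8)))) (Assign 8 (Load (Adj 2 (Reg 8)))))"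

text \<open>The second walk brings the other loose end into the queue. Closure thus follows from
  \<open>walk_inv\<close> without an argument that the first walk went all the way round.\<close>

definition cycle_code :: com where
  "cycle_code = Seq start_code (Seq (While walk_test step_code)
     (Seq (Assign 8 (Reg 14)) (While walk_test step_code)))"

definition record_code :: com where
  "record_code = Seq (Store (Fld 4 (Reg 13)) (Reg 9)) (Seq (Store (Fld 5 (Reg 13)) (Reg 10))
     (Seq (Store (Fld 6 (Reg 13)) (Reg 11)) (Seq (Store (Fld 7 (Reg 13)) (Reg 12))
     (Seq (Assign 13 (Add (Reg 13) (Const 1))) (Assign 8 (Reg 11))))))"

definition has_nbr_test :: "nat \<Rightarrow> nat \<Rightarrow> bexp" where
  "has_nbr_test x y = Neg (Conj (Neg (Equal (Load (Adj 2 (Reg x))) (Reg y)))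
     (Neg (Equal (Load (Adj 3 (Reg x))) (Reg y))))"

definition shift_code :: "int \<times> int \<Rightarrow> com" where
  "shift_code d = Seq (Assign 11 (shift_exp 9 d)) (Assign 12 (shift_exp 10 d))"

text \<open>Absence of the new edges from the tourney is not tested: it follows from
  \<open>v2\<close> being unvisited, see \<open>search_inv_rail_new\<close>.\<close>

definition fresh_test :: bexp where
  "fresh_test = Conj (Equal (Load (Fld 2 (Reg 11))) (Const 0)) (has_nbr_test 11 12)"

definition both_on_board_test :: "int \<times> int \<Rightarrow> bexp" where
  "both_on_board_test d = Conj (on_board_test 9 d) (on_board_test 10 d)"

definition try_code :: "int \<times> int \<Rightarrow> com" where
  "try_code d = Cond (both_on_board_test d)
     (Seq (shift_code d) (Cond fresh_test (Seq record_code cycle_code) Skip)) Skip"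

definition tries_code :: "(int \<times> int) list \<Rightarrow> com" where
  "tries_code ms = foldr (\<lambda>d. Seq (try_code d)) ms Skip"

definition walk_cost :: nat where
  "walk_cost = max_cost step_code + bcost walk_test"

text \<open>The overhead of \<open>cycle_code\<close> beyond the price of the appended cells: the
  start, the failing test of each walk, and two steps for the register copy in between.\<close>

definition cycle_cost :: nat where
  "cycle_cost = max_cost start_code + 2 * bcost walk_test + 2"

text \<open>The branches are charged together, with 1 for \<open>Skip\<close>. Cells appended by the
  walks are paid for by the potential instead.\<close>

definition try_cost :: "int \<times> int \<Rightarrow> nat" where
  "try_cost d = bcost (both_on_board_test d) + max_cost (shift_code d) + bcost fresh_test +
     max_cost record_code + cycle_cost + 1"

text \<open>\<open>lft\<close> and \<open>rgt\<close> are the entries of an input list in the order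
  given; they have no geometric meaning.\<close>

locale join_input = tourney_search +
  fixes lft rgt :: "cell \<Rightarrow> cell"
  assumes nb_eq: "v \<in> cells n \<Longrightarrow> nb v = {lft v, rgt v}"
    and lft_neq_rgt: "v \<in> cells n \<Longrightarrow> lft v \<noteq> rgt v"
begin

abbreviation "ix \<equiv> cell_index n"

definition base :: nat where
  "base = 3 * (n * n) + 1"

lemmas ix_eq_iff [simp] = cell_index_eq_iff[where n = n]

lemma lft_cells [simp]: "v \<in> cells n \<Longrightarrow> lft v \<in> cells n"
  and rgt_cells [simp]: "v \<in> cells n \<Longrightarrow> rgt v \<in> cells n"
  using nb_eq[of v] nb_facts(1)[of "lft v" v] nb_facts(1)[of "rgt v" v] by simp_all

lemma lft_neq_self [simp]: "v \<in> cells n \<Longrightarrow> lft v \<noteq> v"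
  using nb_eq[of v] nbrs_irrefl[OF tourney, of v] by (metis insertI1)

lemma adj_neq_fld [simp]:
  assumes "v \<in> cells n" "k \<le> 3"
  shows "adj k (ix v) \<noteq> fld base f i" "fld base f i \<noteq> adj k (ix v)"
  using cell_index_less[OF assms(1)] assms(2) by (auto simp: adj_def fld_def base_def)

lemma fld_neq_0 [simp]: "fld base f i \<noteq> 0" "0 \<noteq> fld base f i"
  by (auto simp: fld_def base_def)

fun rail_mem :: "(nat \<Rightarrow> nat) \<Rightarrow> nat \<Rightarrow> cell \<times> cell \<times> cell \<times> cell \<Rightarrow> bool" where
  "rail_mem M j (v0, v1, v2, v3) \<longleftrightarrow> M (fld base 4 j) = ix v0 \<and> M (fld base 5 j) = ix v1 \<and>
     M (fld base 6 j) = ix v2 \<and> M (fld base 7 j) = ix v3"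

definition cell_mem :: "(nat \<Rightarrow> nat) \<Rightarrow> cell \<Rightarrow> bool" where
  "cell_mem M v \<longleftrightarrow> M (adj 1 (ix v)) = 2 \<and> M (adj 2 (ix v)) = ix (lft v) \<and>
     M (adj 3 (ix v)) = ix (rgt v) \<and>
     M (fld base 0 (ix v)) = nat (fst v) \<and> M (fld base 1 (ix v)) = nat (snd v)"

text \<open>Flags, queue and rail records are all determined by \<open>Q\<close> and
  \<open>ds\<close>. The adjacency lists keep their original entries until the switching phase. The
  counters in registers 3 and 7 are left to the loop invariants.\<close>

definition rel :: "cell list \<Rightarrow> (cell \<times> cell \<times> cell \<times> cell) list \<Rightarrow> state \<Rightarrow> bool" where
  "rel Q ds s \<longleftrightarrow> fst s 0 = n \<and> fst s 1 = n * n \<and> fst s 2 = base \<and>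
     fst s 6 = length Q \<and> fst s 13 = length ds \<and> snd s 0 = n \<and>
     (\<forall>v\<in>cells n. cell_mem (snd s) v) \<and>
     (\<forall>v\<in>cells n. snd s (fld base 2 (ix v)) = 0 \<longleftrightarrow> v \<notin> set Q) \<and>
     (\<forall>i<length Q. snd s (fld base 3 i) = ix (Q ! i)) \<and>
     (\<forall>j<length ds. rail_mem (snd s) j (ds ! j))"

lemma relD:
  assumes "rel Q ds s"
  shows "fst s 0 = n" "fst s 1 = n * n" "fst s 2 = base" "fst s 6 = length Q"
    "fst s 13 = length ds" "snd s 0 = n"
    "v \<in> cells n \<Longrightarrow> snd s (adj 1 (ix v)) = 2"
    "v \<in> cells n \<Longrightarrow> snd s (adj 2 (ix v)) = ix (lft v)"
    "v \<in> cells n \<Longrightarrow> snd s (adj 3 (ix v)) = ix (rgt v)"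
    "v \<in> cells n \<Longrightarrow> snd s (fld base 0 (ix v)) = nat (fst v)"
    "v \<in> cells n \<Longrightarrow> snd s (fld base 1 (ix v)) = nat (snd v)"
    "v \<in> cells n \<Longrightarrow> snd s (fld base 2 (ix v)) = 0 \<longleftrightarrow> v \<notin> set Q"
    "i < length Q \<Longrightarrow> snd s (fld base 3 i) = ix (Q ! i)"
    "j < length ds \<Longrightarrow> rail_mem (snd s) j (ds ! j)"
  using assms by (simp_all add: rel_def cell_mem_def)

lemma rel_cong_regs:
  assumes "rel Q ds s" "\<And>k. k \<in> {0, 1, 2, 6, 13} \<Longrightarrow> fst s' k = fst s k" "snd s' = snd s"
  shows "rel Q ds s'"
  using assms by (simp add: rel_def)

lemma cell_mem_upd_fld [simp]: "v \<in> cells n \<Longrightarrow> 2 \<le> f \<Longrightarrow> f < 8 \<Longrightarrow>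
    cell_mem (M(fld base f i := x)) v \<longleftrightarrow> cell_mem M v"
  by (simp add: cell_mem_def)

lemma rail_mem_upd_fld [simp]: "f < 4 \<or> f < 8 \<and> i \<noteq> j \<Longrightarrow>
    rail_mem (M(fld base f i := x)) j d \<longleftrightarrow> rail_mem M j d"
  by (cases d rule: prod_cases4) auto

lemma rel_mark:
  assumes r: "rel Q ds s" and x: "x \<in> cells n" "fst s 8 = ix x"
  shows "rel (Q @ [x]) ds (effect mark_code s)"
    "\<And>k. k \<noteq> 6 \<Longrightarrow> fst (effect mark_code s) k = fst s k"
proof -
  note D = relD[OF r]
  have M: "snd (effect mark_code s) =
      (snd s)(fld base 2 (ix x) := 1, fld base 3 (length Q) := ix x)"
    by (simp add: mark_code_def D x)
  have R: "fst (effect mark_code s) = (fst s)(6 := length Q + 1)"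
    by (simp add: mark_code_def D x)
  show "\<And>k. k \<noteq> 6 \<Longrightarrow> fst (effect mark_code s) k = fst s k" by (simp add: R)
  show "rel (Q @ [x]) ds (effect mark_code s)"
    unfolding rel_def
  proof (intro conjI ballI allI impI)
    fix v assume v: "v \<in> cells n"
    show "cell_mem (snd (effect mark_code s)) v"
      using r v unfolding M by (simp add: rel_def)
    show "snd (effect mark_code s) (fld base 2 (ix v)) = 0 \<longleftrightarrow> v \<notin> set (Q @ [x])"
      using v x D(12)[OF v] unfolding M by simp
  next
    fix i assume "i < length (Q @ [x])"
    then show "snd (effect mark_code s) (fld base 3 i) = ix ((Q @ [x]) ! i)"
      using D(13)[of i] unfolding M by (cases "i = length Q") (simp_all add: nth_append)
  next
    fix j assume "j < length ds"
    then show "rail_mem (snd (effect mark_code s)) j (ds ! j)" using D(14)[of j] unfolding M by simp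
  qed (use D in \<open>simp_all add: R M\<close>)
qed

lemma rel_step:
  assumes r: "rel Q ds s" and x: "x \<in> cells n" "fst s 8 = ix x"
  shows "rel (Q @ [x]) ds (effect step_code s)"
    "fst (effect step_code s) 8 = ix (if lft x \<notin> set Q then lft x else rgt x)"
    "\<And>k. k \<noteq> 6 \<Longrightarrow> k \<noteq> 8 \<Longrightarrow> fst (effect step_code s) k = fst s k"
proof -
  define s1 where "s1 = effect mark_code s"
  have r1: "rel (Q @ [x]) ds s1" and f1: "\<And>k. k \<noteq> 6 \<Longrightarrow> fst s1 k = fst s k"
    using rel_mark[OF assms] by (auto simp: s1_def)
  note D = relD[OF r1]
  \<comment> \<open>The flag is read after \<open>x\<close> has been marked; since
    \<open>lft x\<close> differs from \<open>x\<close>, the answer is that of the old queue.\<close>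
  have e: "effect step_code s = ((fst s1)(8 := ix (if lft x \<notin> set Q then lft x else rgt x)), snd s1)"
    using x D(12)[of "lft x"] by (simp add: step_code_def s1_def[symmetric] f1 D)
  show "rel (Q @ [x]) ds (effect step_code s)"
    using r1 by (rule rel_cong_regs) (auto simp: e)
  show "fst (effect step_code s) 8 = ix (if lft x \<notin> set Q then lft x else rgt x)" by (simp add: e)
  show "\<And>k. k \<noteq> 6 \<Longrightarrow> k \<noteq> 8 \<Longrightarrow> fst (effect step_code s) k = fst s k" by (simp add: e f1)
qed

lemma rel_start:
  assumes r: "rel Q ds s" and x: "x \<in> cells n" "fst s 8 = ix x"
  shows "rel (Q @ [x]) ds (effect start_code s)"
    "fst (effect start_code s) 8 = ix (lft x)" "fst (effect start_code s) 14 = ix (rgt x)"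
    "\<And>k. k \<noteq> 6 \<Longrightarrow> k \<noteq> 8 \<Longrightarrow> k \<noteq> 14 \<Longrightarrow> fst (effect start_code s) k = fst s k"
proof -
  define s1 where "s1 = effect mark_code s"
  have r1: "rel (Q @ [x]) ds s1" and f1: "\<And>k. k \<noteq> 6 \<Longrightarrow> fst s1 k = fst s k"
    using rel_mark[OF assms] by (auto simp: s1_def)
  note D = relD[OF r1]
  have e: "effect start_code s = ((fst s1)(14 := ix (rgt x), 8 := ix (lft x)), snd s1)"
    using x by (simp add: start_code_def s1_def[symmetric] f1 D)
  show "rel (Q @ [x]) ds (effect start_code s)"
    using r1 by (rule rel_cong_regs) (auto simp: e)
  show "fst (effect start_code s) 8 = ix (lft x)" "fst (effect start_code s) 14 = ix (rgt x)"
    by (simp_all add: e)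
  show "\<And>k. k \<noteq> 6 \<Longrightarrow> k \<noteq> 8 \<Longrightarrow> k \<noteq> 14 \<Longrightarrow> fst (effect start_code s) k = fst s k"
    by (simp add: e f1)
qed

lemma length_le_if_distinct: "distinct Q \<Longrightarrow> set Q \<subseteq> cells n \<Longrightarrow> length Q \<le> n * n"
  using card_mono[of "cells n" "set Q"] by (simp add: distinct_card card_cells cells_def)

text \<open>The potential counts the cells missing from the queue. That the start cell
  \<open>x\<close> ends up in the queue matters for the second walk, where it is the remaining loose
  end.\<close>

lemma exec_walk:
  assumes w: "walk_inv Q0 C Q x y" and r: "rel Q ds s" and x: "fst s 8 = ix x"
  shows "\<exists>t s' Q' x'. exec (While walk_test step_code) s t s' \<and> walk_inv Q0 C Q' x' y \<and>
    x \<in> set Q' \<and> x' \<in> set Q' \<and> rel Q' ds s' \<and> (\<forall>k. k \<noteq> 6 \<longrightarrow> k \<noteq> 8 \<longrightarrow> fst s' k = fst s k) \<and>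
    t + walk_cost * (n * n - length Q') \<le> walk_cost * (n * n - length Q) + bcost walk_test"
proof -
  \<comment> \<open>The start cell, fixed while \<open>x\<close> moves. The first iteration appends
    it; if there is none, the failing test has found it in the queue.\<close>
  define x0 where "x0 = x"
  define I where "I = (\<lambda>(Q, x) s'. walk_inv Q0 C Q x y \<and> rel Q ds s' \<and> fst s' 8 = ix x \<and>
    (x0 \<in> set Q \<or> x = x0) \<and>
    (\<forall>k. k \<noteq> 6 \<longrightarrow> k \<noteq> 8 \<longrightarrow> fst s' k = fst s k))"
  define \<Phi> where "\<Phi> = (\<lambda>(Q :: cell list, x :: cell). walk_cost * (n * n - length Q))"
  have test: "bval walk_test s \<longleftrightarrow> x \<notin> set Q" if "I (Q, x) s" for s Q x
  proof -
    have "rel Q ds s" "fst s 8 = ix x" "x \<in> cells n" using that by (auto simp: I_def walk_inv_def)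
    then show ?thesis using relD(3,12) by (simp add: walk_test_def)
  qed
  have "\<exists>t s' g'. exec (While walk_test step_code) s t s' \<and> I g' s' \<and> \<not> bval walk_test s' \<and>
      t + \<Phi> g' \<le> \<Phi> (Q, x) + bcost walk_test"
  proof (rule exec_While_potential)
    show "I (Q, x) s" using assms by (simp add: I_def x0_def)
    fix g s1 assume g: "I g s1" and b: "bval walk_test s1"
    obtain Q1 x1 where g_eq: "g = (Q1, x1)" by (cases g)
    have 1: "walk_inv Q0 C Q1 x1 y" "rel Q1 ds s1" "fst s1 8 = ix x1" "x1 \<in> cells n"
      "x0 \<in> set Q1 \<or> x1 = x0" "\<And>k. k \<noteq> 6 \<Longrightarrow> k \<noteq> 8 \<Longrightarrow> fst s1 k = fst s k"
      using g by (auto simp: g_eq I_def walk_inv_def)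
    have x1: "x1 \<notin> set Q1" using test[of Q1 x1 s1] g b by (simp add: g_eq)
    define x2 where "x2 = (if lft x1 \<notin> set Q1 then lft x1 else rgt x1)"
    have 2: "walk_inv Q0 C (Q1 @ [x1]) x2 y"
      unfolding x2_def by (rule walk_inv_step[OF 1(1) x1 nb_eq[OF 1(4)]])
    have "loop_free step_code" by (simp add: step_code_def mark_code_def)
    then obtain t where t: "exec step_code s1 t (effect step_code s1)" "t \<le> max_cost step_code"
      using exec_loop_free by blast
    have "I (Q1 @ [x1], x2) (effect step_code s1)"
      using 2 rel_step[OF 1(2,4,3)] 1(5,6) by (auto simp: I_def x2_def)
    \<comment> \<open>Without this bound truncated subtraction could hide that the potential
      drops.\<close>
    moreover have "length (Q1 @ [x1]) \<le> n * n"
      using 2 by (intro length_le_if_distinct) (auto simp: walk_inv_def)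
    then have "n * n - length Q1 = Suc (n * n - length (Q1 @ [x1]))" by simp
    then have "t + bcost walk_test + \<Phi> (Q1 @ [x1], x2) \<le> \<Phi> g"
      using t(2) unfolding \<Phi>_def g_eq by (simp add: walk_cost_def)
    ultimately show "\<exists>t s' g'. exec step_code s1 t s' \<and> I g' s' \<and> t + bcost walk_test + \<Phi> g' \<le> \<Phi> g"
      using t(1) by blast
  qed
  then obtain t s' Q' x' where "exec (While walk_test step_code) s t s'" "I (Q', x') s'"
    "\<not> bval walk_test s'" "t + \<Phi> (Q', x') \<le> \<Phi> (Q, x) + bcost walk_test"
    by auto
  moreover from this have "x' \<in> set Q'" using test by blast
  moreover from this have "x \<in> set Q'" using \<open>I (Q', x') s'\<close> by (auto simp: I_def x0_def)
  ultimately show ?thesis unfolding I_def \<Phi>_def prod.case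
    by (intro exI[of _ t] exI[of _ s'] exI[of _ Q'] exI[of _ x'] conjI) simp_all
qed

lemma exec_cycle:
  assumes Q: "distinct Q" "set Q \<subseteq> cells n" "\<And>v. v \<in> set Q \<Longrightarrow> nb v \<subseteq> set Q"
    and r: "rel Q ds s" and x: "x \<in> cells n" "x \<notin> set Q" "fst s 8 = ix x"
  shows "\<exists>t s' W. exec cycle_code s t s' \<and> distinct (Q @ W) \<and> set (Q @ W) \<subseteq> cells n \<and>
    (\<forall>v\<in>set (Q @ W). nb v \<subseteq> set (Q @ W)) \<and> x \<in> set W \<and>
    (\<forall>w\<in>set W. cycle_of \<C> w = cycle_of \<C> x) \<and> rel (Q @ W) ds s' \<and>
    (\<forall>k. k \<noteq> 6 \<longrightarrow> k \<noteq> 8 \<longrightarrow> k \<noteq> 14 \<longrightarrow> fst s' k = fst s k) \<and>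
    t + walk_cost * (n * n - length (Q @ W)) \<le> walk_cost * (n * n - length Q) + cycle_cost"
proof -
  define s1 where "s1 = effect start_code s"
  have "loop_free start_code" by (simp add: start_code_def mark_code_def)
  then obtain t1 where 1: "exec start_code s t1 s1" "t1 \<le> max_cost start_code"
    using exec_loop_free unfolding s1_def by blast
  note S = rel_start[OF r x(1,3), folded s1_def]
  have w1: "walk_inv (Q @ [x]) (cycle_of \<C> x) (Q @ [x]) (lft x) (rgt x)"
    using walk_inv_start[OF Q x(1,2) nb_eq[OF x(1)]] .
  obtain t2 s2 Q2 x2 where 2: "exec (While walk_test step_code) s1 t2 s2"
    "walk_inv (Q @ [x]) (cycle_of \<C> x) Q2 x2 (rgt x)" "x2 \<in> set Q2" "rel Q2 ds s2"
    "\<And>k. k \<noteq> 6 \<Longrightarrow> k \<noteq> 8 \<Longrightarrow> fst s2 k = fst s1 k"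
    "t2 + walk_cost * (n * n - length Q2) \<le> walk_cost * (n * n - length (Q @ [x])) + bcost walk_test"
    using exec_walk[OF w1 S(1,2)] by blast
  define s3 where "s3 = effect (Assign 8 (Reg 14)) s2"
  have 3: "exec (Assign 8 (Reg 14)) s2 2 s3"
    using exec.Assign[of 8 "Reg 14" s2] by (simp add: s3_def numeral_2_eq_2)
  have r3: "rel Q2 ds s3" using 2(4) by (rule rel_cong_regs) (auto simp: s3_def)
  have x3: "fst s3 8 = ix (rgt x)" using 2(5)[of 14] S(3) by (simp add: s3_def)
  have w3: "walk_inv (Q @ [x]) (cycle_of \<C> x) Q2 (rgt x) (rgt x)"
    using 2(2,3) by (rule walk_inv_switch)
  obtain t4 s4 Q4 x4 where 4: "exec (While walk_test step_code) s3 t4 s4"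
    "walk_inv (Q @ [x]) (cycle_of \<C> x) Q4 x4 (rgt x)" "rgt x \<in> set Q4" "x4 \<in> set Q4" "rel Q4 ds s4"
    "\<And>k. k \<noteq> 6 \<Longrightarrow> k \<noteq> 8 \<Longrightarrow> fst s4 k = fst s3 k"
    "t4 + walk_cost * (n * n - length Q4) \<le> walk_cost * (n * n - length Q2) + bcost walk_test"
    using exec_walk[OF w3 r3 x3] by blast
  note F = walk_inv_finish[OF walk_inv_switch[OF 4(2,4)] 4(3)]
  obtain W' where W': "Q4 = (Q @ [x]) @ W'" "\<And>w. w \<in> set W' \<Longrightarrow> cycle_of \<C> w = cycle_of \<C> x"
    using F(4) by blast
  define W where "W = x # W'"
  have Q4: "Q4 = Q @ W" by (simp add: W'(1) W_def)
  have "exec cycle_code s (t1 + (t2 + (2 + t4))) s4"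
    unfolding cycle_code_def by (rule exec.Seq[OF 1(1) exec.Seq[OF 2(1) exec.Seq[OF 3 4(1)]]])
  moreover have "walk_cost * (n * n - length (Q @ [x])) \<le> walk_cost * (n * n - length Q)"
    by (intro mult_le_mono2) simp
  then have "t1 + (t2 + (2 + t4)) + walk_cost * (n * n - length Q4) \<le>
      walk_cost * (n * n - length Q) + cycle_cost"
    using 1(2) 2(6) 4(7) unfolding cycle_cost_def by linarith
  moreover have "\<forall>k. k \<noteq> 6 \<longrightarrow> k \<noteq> 8 \<longrightarrow> k \<noteq> 14 \<longrightarrow> fst s4 k = fst s k"
    using 4(6) 2(5) S(4) by (simp add: s3_def)
  moreover have "x \<in> set W" "\<forall>w\<in>set W. cycle_of \<C> w = cycle_of \<C> x"
    using W'(2) unfolding W_def by simp_all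
  moreover have "\<forall>v\<in>set Q4. nb v \<subseteq> set Q4" using F(3) by (rule ballI)
  ultimately show ?thesis using F(1,2) 4(5) unfolding Q4
    by (intro exI[of _ "t1 + (t2 + (2 + t4))"] exI[of _ s4] exI[of _ W] conjI)
qed

end

section \<open>The search program\<close>

definition probe_code :: com where
  "probe_code = Seq (Assign 9 (Load (Fld 3 (Reg 7))))
     (Seq (Assign 10 (Load (Adj 2 (Reg 9)))) (Seq (tries_code knight_moves)
     (Seq (Assign 10 (Load (Adj 3 (Reg 9)))) (Seq (tries_code knight_moves)
     (Assign 7 (Add (Reg 7) (Const 1)))))))"

definition root_code :: com where
  "root_code = Seq (Cond (Equal (Load (Fld 2 (Reg 3))) (Const 0))
     (Seq (Assign 8 (Reg 3)) cycle_code) Skip) (Assign 3 (Add (Reg 3) (Const 1)))"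

definition search_test :: bexp where
  "search_test = Neg (Conj (Neg (Less (Reg 3) (Reg 1))) (Neg (Less (Reg 7) (Reg 6))))"

text \<open>One flat loop instead of a search nested in a scan over roots, so that a single
  potential covers both. A root is tried only when the queue is exhausted, as
  \<open>search_inv_root\<close> demands.\<close>

definition search_body :: com where
  "search_body = Cond (Less (Reg 7) (Reg 6)) probe_code root_code"

text \<open>The moves are tried once for each of the two edges at the cell; the summand 2 is the
  \<open>Skip\<close> at the end of both lists of tries.\<close>

definition probe_cost :: nat where
  "probe_cost = max_cost (Assign 9 (Load (Fld 3 (Reg 7)))) +
     max_cost (Assign 10 (Load (Adj 2 (Reg 9)))) + max_cost (Assign 10 (Load (Adj 3 (Reg 9)))) +
     2 * sum_list (map try_cost knight_moves) + 2 + max_cost (Assign 7 (Add (Reg 7) (Const 1))) +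
     bcost (Less (Reg 7) (Reg 6)) + bcost search_test"

definition root_cost :: nat where
  "root_cost = bcost (Equal (Load (Fld 2 (Reg 3))) (Const 0)) + 3 + cycle_cost +
     max_cost (Assign 3 (Add (Reg 3) (Const 1))) +
     bcost (Less (Reg 7) (Reg 6)) + bcost search_test"

lemma exec_loop_freeE:
  assumes "loop_free c"
  obtains t where "exec c s t (effect c s)" "t \<le> max_cost c"
  using exec_loop_free[OF assms] by blast

context join_input
begin

lemma search_inv_Q:
  assumes "search_inv Q p ds"
  shows "distinct Q" "set Q \<subseteq> cells n" "\<And>v. v \<in> set Q \<Longrightarrow> nb v \<subseteq> set Q"
  using assms by (simp_all add: search_inv_def)

lemma on_board_test_iff:
  assumes r: "rel Q ds s" and v: "v \<in> cells n" "fst s x = ix v" and d: "d \<in> set knight_moves"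
  shows "bval (on_board_test x d) s \<longleftrightarrow> v + d \<in> cells n"
proof -
  have "-2 \<le> fst d" "-2 \<le> snd d" using d by (auto simp: knight_moves_def)
  then show ?thesis
    using relD(1,3)[OF r] relD(10,11)[OF r v(1)] v
    by (simp add: shifted_in_cells_iff[OF v(1)] on_board_test_def inside_test_def conj_assoc)
qed

lemma aval_shift_exp:
  assumes "rel Q ds s" "v \<in> cells n" "fst s x = ix v" "v + d \<in> cells n" "d \<in> set knight_moves"
  shows "aval (shift_exp x d) s = ix (v + d)"
proof -
  have "-2 \<le> fst d" "-2 \<le> snd d" using assms(5) by (auto simp: knight_moves_def)
  then show ?thesis
    using relD(1)[OF assms(1)] cell_index_shift[OF assms(2,4)] assms(3)
    by (simp add: shift_exp_def)
qed

lemma rel_record: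
  assumes r: "rel Q ds s" and c: "v0 \<in> cells n" "v1 \<in> cells n" "v2 \<in> cells n" "v3 \<in> cells n"
    and R: "fst s 9 = ix v0" "fst s 10 = ix v1" "fst s 11 = ix v2" "fst s 12 = ix v3"
  shows "rel Q (ds @ [(v0, v1, v2, v3)]) (effect record_code s)"
    "fst (effect record_code s) 8 = ix v2"
    "\<And>k. k \<noteq> 8 \<Longrightarrow> k \<noteq> 13 \<Longrightarrow> fst (effect record_code s) k = fst s k"
proof -
  note D = relD[OF r]
  let ?l = "length ds"
  have M: "snd (effect record_code s) = (snd s)(fld base 4 ?l := ix v0, fld base 5 ?l := ix v1,
      fld base 6 ?l := ix v2, fld base 7 ?l := ix v3)"
    by (simp add: record_code_def D R)
  have F: "fst (effect record_code s) = (fst s)(13 := ?l + 1, 8 := ix v2)"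
    by (simp add: record_code_def D R)
  show "fst (effect record_code s) 8 = ix v2" by (simp add: F)
  show "\<And>k. k \<noteq> 8 \<Longrightarrow> k \<noteq> 13 \<Longrightarrow> fst (effect record_code s) k = fst s k" by (simp add: F)
  show "rel Q (ds @ [(v0, v1, v2, v3)]) (effect record_code s)"
    unfolding rel_def
  proof (intro conjI ballI allI impI)
    fix v assume v: "v \<in> cells n"
    show "cell_mem (snd (effect record_code s)) v"
      using r v unfolding M by (simp add: rel_def)
    show "snd (effect record_code s) (fld base 2 (ix v)) = 0 \<longleftrightarrow> v \<notin> set Q"
      using D(12)[OF v] unfolding M by simp
  next
    fix i assume "i < length Q"
    then show "snd (effect record_code s) (fld base 3 i) = ix (Q ! i)"
      using D(13)[of i] unfolding M by simp
  next
    fix j assume "j < length (ds @ [(v0, v1, v2, v3)])"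
    then show "rail_mem (snd (effect record_code s)) j ((ds @ [(v0, v1, v2, v3)]) ! j)"
      using D(14)[of j] unfolding M by (cases "j = ?l") (simp_all add: nth_append)
  qed (use D in \<open>simp_all add: F M\<close>)
qed

text \<open>Holds between the tries for one edge at the front cell; appending to the queue does not
  move that cell.\<close>

definition probe_inv :: "nat \<Rightarrow> nat \<Rightarrow> cell \<Rightarrow> cell \<Rightarrow> cell list \<Rightarrow>
    (cell \<times> cell \<times> cell \<times> cell) list \<Rightarrow> state \<Rightarrow> bool" where
  "probe_inv p i v0 v1 Q ds s \<longleftrightarrow> rel Q ds s \<and> search_inv Q p ds \<and> p < length Q \<and> Q ! p = v0 \<and>
     v1 \<in> nb v0 \<and> fst s 3 = i \<and> fst s 7 = p \<and> fst s 9 = ix v0 \<and> fst s 10 = ix v1"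

text \<open>If a translate leaves the board or \<open>v1 + d\<close> is no neighbour of
  \<open>v0 + d\<close>, there is no rail; if \<open>v0 + d\<close> is visited, a rail is already
  spanned; otherwise it is recorded. In every case a rail of this form is spanned
  afterwards.\<close>

lemma exec_try:
  assumes P: "probe_inv p i v0 v1 Q ds s" and d: "d \<in> set knight_moves"
  shows "\<exists>t s' W es. exec (try_code d) s t s' \<and> probe_inv p i v0 v1 (Q @ W) (ds @ es) s' \<and>
    ({{v0, v1}, {v0 + d, v1 + d}} \<in> rail_graph_edges n \<C> \<longrightarrow>
      spanned (ds @ es) {{v0, v1}, {v0 + d, v1 + d}}) \<and>
    t + walk_cost * (n * n - length (Q @ W)) \<le> walk_cost * (n * n - length Q) + try_cost d"
    (is "\<exists>t s' W es. ?P t s' W es")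
proof -
  have r: "rel Q ds s" and I: "search_inv Q p ds" and p: "p < length Q" and v0: "Q ! p = v0"
    and v1: "v1 \<in> nb v0" and R: "fst s 3 = i" "fst s 7 = p" "fst s 9 = ix v0" "fst s 10 = ix v1"
    using P by (simp_all add: probe_inv_def)
  let ?r = "{{v0, v1}, {v0 + d, v1 + d}}"
  have c: "v0 \<in> cells n" "v1 \<in> cells n" using nb_facts[OF v1] by simp_all
  have board: "bval (both_on_board_test d) s \<longleftrightarrow> v0 + d \<in> cells n \<and> v1 + d \<in> cells n"
    using on_board_test_iff[OF r c(1) R(3) d] on_board_test_iff[OF r c(2) R(4) d]
    by (simp add: both_on_board_test_def)
  have G: "v0 + d \<in> cells n" "v1 + d \<in> cells n" "v1 + d \<in> nb (v0 + d)"
    if "?r \<in> rail_graph_edges n \<C>"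
  proof -
    have "?r \<in> rails n (\<Union>\<C>)" using that by (simp add: rail_graph_edges_def)
    then have "?r \<subseteq> \<Union>\<C>" by (rule rails_subset)
    then show "v1 + d \<in> nb (v0 + d)" by (simp only: insert_subset nbrs_def mem_Collect_eq)
    then show "v0 + d \<in> cells n" "v1 + d \<in> cells n" using nb_facts by blast+
  qed
  have seen: "spanned ds ?r" if "?r \<in> rail_graph_edges n \<C>" "v0 + d \<in> set Q"
    using search_inv_rail_seen[OF I p, of v1 "v0 + d" "v1 + d"] that v0 by simp
  show ?thesis
  proof (cases "v0 + d \<in> cells n \<and> v1 + d \<in> cells n")
    case False
    have "exec (try_code d) s (bcost (both_on_board_test d) + 1) s"
      unfolding try_code_def using False board by (intro exec.Cond_False exec.Skip) simp
    moreover have "?r \<notin> rail_graph_edges n \<C>" using False G by blast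
    ultimately have "?P (bcost (both_on_board_test d) + 1) s [] []"
      using P by (simp add: try_cost_def)
    then show ?thesis by blast
  next
    case True
    then have c': "v0 + d \<in> cells n" "v1 + d \<in> cells n" by simp_all
    define s1 where "s1 = effect (shift_code d) s"
    have "loop_free (shift_code d)" by (simp add: shift_code_def)
    then obtain t1 where 1: "exec (shift_code d) s t1 s1" "t1 \<le> max_cost (shift_code d)"
      unfolding s1_def by (rule exec_loop_freeE)
    \<comment> \<open>The intermediate state of \<open>shift_code\<close>, in which the second shift
      is evaluated.\<close>
    define s' where "s' = ((fst s)(11 := ix (v0 + d)), snd s)"
    have r': "rel Q ds s'" using r by (rule rel_cong_regs) (auto simp: s'_def)
    have "aval (shift_exp 9 d) s = ix (v0 + d)" using aval_shift_exp[OF r c(1) R(3) c'(1) d] .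
    moreover have "aval (shift_exp 10 d) s' = ix (v1 + d)"
      using aval_shift_exp[OF r' c(2) _ c'(2) d, of 10] R(4) by (simp add: s'_def)
    ultimately have s1: "s1 = ((fst s)(11 := ix (v0 + d), 12 := ix (v1 + d)), snd s)"
      by (simp add: s1_def shift_code_def s'_def)
    have r1: "rel Q ds s1" using r by (rule rel_cong_regs) (auto simp: s1)
    have P1: "probe_inv p i v0 v1 Q ds s1" using P r1 by (simp add: probe_inv_def s1)
    have fresh: "bval fresh_test s1 \<longleftrightarrow> v0 + d \<notin> set Q \<and> v1 + d \<in> nb (v0 + d)"
    proof -
      have F: "fst s1 2 = base" "fst s1 11 = ix (v0 + d)" "fst s1 12 = ix (v1 + d)"
        using relD(3)[OF r1] by (simp_all add: s1)
      have "bval fresh_test s1 \<longleftrightarrow> snd s1 (fld base 2 (ix (v0 + d))) = 0 \<and>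
          (snd s1 (adj 2 (ix (v0 + d))) = ix (v1 + d) \<or> snd s1 (adj 3 (ix (v0 + d))) = ix (v1 + d))"
        unfolding fresh_test_def has_nbr_test_def bval.simps aval.simps aval_Fld aval_Adj F by blast
      also have "\<dots> \<longleftrightarrow> v0 + d \<notin> set Q \<and> (lft (v0 + d) = v1 + d \<or> rgt (v0 + d) = v1 + d)"
        unfolding relD(8,9,12)[OF r1 c'(1)] ix_eq_iff[OF lft_cells[OF c'(1)] c'(2)]
          ix_eq_iff[OF rgt_cells[OF c'(1)] c'(2)] ..
      also have "lft (v0 + d) = v1 + d \<or> rgt (v0 + d) = v1 + d \<longleftrightarrow> v1 + d \<in> nb (v0 + d)"
        unfolding nb_eq[OF c'(1)] insert_iff empty_iff by metis
      finally show ?thesis .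
    qed
    show ?thesis
    proof (cases "bval fresh_test s1")
      case False
      have "exec (try_code d) s (bcost (both_on_board_test d) + (t1 + (bcost fresh_test + 1))) s1"
        unfolding try_code_def using board True False
        by (intro exec.Cond_True exec.Seq[OF 1(1)] exec.Cond_False exec.Skip) simp_all
      moreover have "?r \<in> rail_graph_edges n \<C> \<longrightarrow> spanned ds ?r" using False fresh G(3) seen by blast
      ultimately have "?P (bcost (both_on_board_test d) + (t1 + (bcost fresh_test + 1))) s1 [] []"
        using P1 1(2) by (simp add: try_cost_def)
      then show ?thesis by blast
    next
      case True
      then have v2: "v0 + d \<notin> set Q" "v1 + d \<in> nb (v0 + d)" using fresh by simp_all
      let ?d = "(v0, v1, v0 + d, v1 + d)"
      define s2 where "s2 = effect record_code s1"
      have "loop_free record_code" by (simp add: record_code_def)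
      then obtain t2 where 2: "exec record_code s1 t2 s2" "t2 \<le> max_cost record_code"
        unfolding s2_def by (rule exec_loop_freeE)
      have S: "rel Q (ds @ [?d]) s2" "fst s2 8 = ix (v0 + d)"
        "\<And>k. k \<noteq> 8 \<Longrightarrow> k \<noteq> 13 \<Longrightarrow> fst s2 k = fst s1 k"
        using rel_record[OF r1 c c'] R by (simp_all add: s1 s2_def)
      obtain t3 s3 W where 3: "exec cycle_code s2 t3 s3" "distinct (Q @ W)"
        "set (Q @ W) \<subseteq> cells n" "\<forall>v\<in>set (Q @ W). nb v \<subseteq> set (Q @ W)" "v0 + d \<in> set W"
        "\<forall>w\<in>set W. cycle_of \<C> w = cycle_of \<C> (v0 + d)" "rel (Q @ W) (ds @ [?d]) s3"
        "\<forall>k. k \<noteq> 6 \<longrightarrow> k \<noteq> 8 \<longrightarrow> k \<noteq> 14 \<longrightarrow> fst s3 k = fst s2 k"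
        "t3 + walk_cost * (n * n - length (Q @ W)) \<le> walk_cost * (n * n - length Q) + cycle_cost"
        using exec_cycle[OF search_inv_Q[OF I] S(1) c'(1) v2(1) S(2)] by blast
      have sh: "parallel_edges (Q ! p) v1 (v0 + d) (v1 + d)"
        by (simp add: parallel_edges_def km_def v0)
      have km: "knight_move (km (Q ! p) (v0 + d))" using d by (simp add: knight_move_iff km_def v0)
      have v1': "v1 \<in> nb (Q ! p)" using v1 v0 by simp
      note new = search_inv_rail_new[OF I p v1' v2(2) sh km v2(1) 3(2,3) 3(4)[rule_format] 3(5)
          3(6)[rule_format], unfolded v0]
      have "fst s3 k = fst s k" if "k \<in> {3, 7, 9, 10}" for k
        using 3(8) S(3) that by (auto simp: s1)
      then have P3: "probe_inv p i v0 v1 (Q @ W) (ds @ [?d]) s3"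
        using new(1) 3(7) p v0 v1 R unfolding probe_inv_def by (simp add: nth_append)
      have ex: "exec (try_code d) s (bcost (both_on_board_test d) + (t1 + (bcost fresh_test + (t2 + t3)))) s3"
        unfolding try_code_def using board c' True
        by (intro exec.Cond_True exec.Seq[OF 1(1)] exec.Seq[OF 2(1) 3(1)]) simp_all
      have "?P (bcost (both_on_board_test d) + (t1 + (bcost fresh_test + (t2 + t3)))) s3 W [?d]"
      proof (intro conjI impI ex P3)
        show "spanned (ds @ [?d]) ?r" by (rule new(3))
        show "bcost (both_on_board_test d) + (t1 + (bcost fresh_test + (t2 + t3))) +
            walk_cost * (n * n - length (Q @ W)) \<le> walk_cost * (n * n - length Q) + try_cost d"
          using 1(2) 2(2) 3(9) unfolding try_cost_def by linarith
      qed
      then show ?thesis by blast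
    qed
  qed
qed

lemma exec_tries:
  assumes "probe_inv p i v0 v1 Q ds s" "set ms \<subseteq> set knight_moves"
  shows "\<exists>t s' W es. exec (tries_code ms) s t s' \<and> probe_inv p i v0 v1 (Q @ W) (ds @ es) s' \<and>
    (\<forall>d\<in>set ms. {{v0, v1}, {v0 + d, v1 + d}} \<in> rail_graph_edges n \<C> \<longrightarrow>
      spanned (ds @ es) {{v0, v1}, {v0 + d, v1 + d}}) \<and>
    t + walk_cost * (n * n - length (Q @ W)) \<le>
      walk_cost * (n * n - length Q) + (sum_list (map try_cost ms) + 1)"
  using assms
proof (induction ms arbitrary: Q ds s)
  case Nil
  have "exec (tries_code []) s 1 s" by (simp add: tries_code_def exec.Skip[unfolded One_nat_def])
  then show ?case using Nil
    by (intro exI[of _ 1] exI[of _ s] exI[of _ "[]"] conjI) simp_all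
next
  case (Cons d ms)
  have "d \<in> set knight_moves" using Cons.prems by simp
  then obtain t1 s1 W1 es1 where 1: "exec (try_code d) s t1 s1"
    "probe_inv p i v0 v1 (Q @ W1) (ds @ es1) s1"
    "{{v0, v1}, {v0 + d, v1 + d}} \<in> rail_graph_edges n \<C> \<longrightarrow>
      spanned (ds @ es1) {{v0, v1}, {v0 + d, v1 + d}}"
    "t1 + walk_cost * (n * n - length (Q @ W1)) \<le> walk_cost * (n * n - length Q) + try_cost d"
    using exec_try[OF Cons.prems(1)] by metis
  have "set ms \<subseteq> set knight_moves" using Cons.prems by simp
  then obtain t2 s2 W2 es2 where 2: "exec (tries_code ms) s1 t2 s2"
    "probe_inv p i v0 v1 ((Q @ W1) @ W2) ((ds @ es1) @ es2) s2"
    "\<forall>d\<in>set ms. {{v0, v1}, {v0 + d, v1 + d}} \<in> rail_graph_edges n \<C> \<longrightarrow>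
      spanned ((ds @ es1) @ es2) {{v0, v1}, {v0 + d, v1 + d}}"
    "t2 + walk_cost * (n * n - length ((Q @ W1) @ W2)) \<le>
      walk_cost * (n * n - length (Q @ W1)) + (sum_list (map try_cost ms) + 1)"
    using Cons.IH[OF 1(2)] by metis
  have "exec (tries_code (d # ms)) s (t1 + t2) s2"
    using exec.Seq[OF 1(1) 2(1)] by (simp add: tries_code_def)
  moreover have "\<forall>d\<in>set (d # ms). {{v0, v1}, {v0 + d, v1 + d}} \<in> rail_graph_edges n \<C> \<longrightarrow>
      spanned ((ds @ es1) @ es2) {{v0, v1}, {v0 + d, v1 + d}}"
    using 1(3) 2(3) spanned_append[of "ds @ es1" _ es2] by simp
  moreover have "t1 + t2 + walk_cost * (n * n - length ((Q @ W1) @ W2)) \<le>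
      walk_cost * (n * n - length Q) + (sum_list (map try_cost (d # ms)) + 1)"
    using 1(4) 2(4) unfolding list.map sum_list.Cons by linarith
  ultimately show ?case using 2(2) unfolding append_assoc
    by (intro exI[of _ "t1 + t2"] exI[of _ s2] exI[of _ "W1 @ W2"] exI[of _ "es1 @ es2"] conjI)
qed

definition loop_inv :: "cell list \<times> nat \<times> (cell \<times> cell \<times> cell \<times> cell) list \<times> nat \<Rightarrow> state \<Rightarrow> bool" where
  "loop_inv = (\<lambda>(Q, p, ds, i) s. rel Q ds s \<and> search_inv Q p ds \<and> fst s 7 = p \<and> fst s 3 = i \<and>
     i \<le> n * n \<and> (\<forall>v\<in>cells n. ix v < i \<longrightarrow> v \<in> set Q))"

text \<open>A cell is appended once, processed once and considered once as a root; the three terms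
  pay for these events separately.\<close>

definition loop_potential ::
    "cell list \<times> nat \<times> (cell \<times> cell \<times> cell \<times> cell) list \<times> nat \<Rightarrow> nat" where
  "loop_potential = (\<lambda>(Q, p, ds, i).
     walk_cost * (n * n - length Q) + probe_cost * (n * n - p) + root_cost * (n * n - i))"

lemma exec_probe:
  assumes I: "loop_inv (Q, p, ds, i) s" and p: "p < length Q"
  shows "\<exists>t s' W es. exec probe_code s t s' \<and> loop_inv (Q @ W, Suc p, ds @ es, i) s' \<and>
    t + walk_cost * (n * n - length (Q @ W)) + bcost (Less (Reg 7) (Reg 6)) + bcost search_test \<le>
      walk_cost * (n * n - length Q) + probe_cost"
proof -
  have r: "rel Q ds s" and S: "search_inv Q p ds" and R: "fst s 7 = p" "fst s 3 = i"
    and i: "i \<le> n * n" "\<And>v. v \<in> cells n \<Longrightarrow> ix v < i \<Longrightarrow> v \<in> set Q"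
    using I by (simp_all add: loop_inv_def)
  define v0 where "v0 = Q ! p"
  have c: "v0 \<in> cells n" using search_inv_Q(2)[OF S] p by (auto simp: v0_def)
  have lr: "lft v0 \<in> nb v0" "rgt v0 \<in> nb v0" using nb_eq[OF c] by simp_all
  define a1 where "a1 = Assign 9 (Load (Fld 3 (Reg 7)))"
  define a2 where "a2 = Assign 10 (Load (Adj 2 (Reg 9)))"
  define a3 where "a3 = Assign 10 (Load (Adj 3 (Reg 9)))"
  define a4 where "a4 = Assign 7 (Add (Reg 7) (Const 1))"
  have lf: "loop_free a1" "loop_free a2" "loop_free a3" "loop_free a4"
    by (simp_all add: a1_def a2_def a3_def a4_def)
  define s1 where "s1 = effect a1 s"
  define s2 where "s2 = effect a2 s1"
  obtain t1 where 1: "exec a1 s t1 s1" "t1 \<le> max_cost a1"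
    unfolding s1_def by (rule exec_loop_freeE[OF lf(1)])
  obtain t2 where 2: "exec a2 s1 t2 s2" "t2 \<le> max_cost a2"
    unfolding s2_def by (rule exec_loop_freeE[OF lf(2)])
  have s1: "s1 = ((fst s)(9 := ix v0), snd s)"
    using relD(3)[OF r] relD(13)[OF r p] R by (simp add: s1_def a1_def v0_def)
  have s2: "s2 = ((fst s)(9 := ix v0, 10 := ix (lft v0)), snd s)"
    using relD(8)[OF r c] by (simp add: s2_def a2_def s1)
  have r2: "rel Q ds s2" using r by (rule rel_cong_regs) (auto simp: s2)
  have "probe_inv p i v0 (lft v0) Q ds s2"
    using r2 S p lr R unfolding probe_inv_def by (simp add: s2 v0_def)
  then obtain t3 s3 W3 es3 where 3: "exec (tries_code knight_moves) s2 t3 s3"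
    "probe_inv p i v0 (lft v0) (Q @ W3) (ds @ es3) s3"
    "\<forall>d\<in>set knight_moves. {{v0, lft v0}, {v0 + d, lft v0 + d}} \<in> rail_graph_edges n \<C> \<longrightarrow>
      spanned (ds @ es3) {{v0, lft v0}, {v0 + d, lft v0 + d}}"
    "t3 + walk_cost * (n * n - length (Q @ W3)) \<le>
      walk_cost * (n * n - length Q) + (sum_list (map try_cost knight_moves) + 1)"
    using exec_tries[of p i v0 "lft v0" Q ds s2 knight_moves] by auto
  define s4 where "s4 = effect a3 s3"
  obtain t4 where 4: "exec a3 s3 t4 s4" "t4 \<le> max_cost a3"
    unfolding s4_def by (rule exec_loop_freeE[OF lf(3)])
  have r3: "rel (Q @ W3) (ds @ es3) s3" and R3: "fst s3 9 = ix v0"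
    using 3(2) by (simp_all add: probe_inv_def)
  have s4: "s4 = ((fst s3)(10 := ix (rgt v0)), snd s3)"
    using relD(9)[OF r3 c] R3 by (simp add: s4_def a3_def)
  have r4: "rel (Q @ W3) (ds @ es3) s4" using r3 by (rule rel_cong_regs) (auto simp: s4)
  have "probe_inv p i v0 (rgt v0) (Q @ W3) (ds @ es3) s4"
    using 3(2) r4 lr unfolding probe_inv_def by (simp add: s4)
  then obtain t5 s5 W5 es5 where 5: "exec (tries_code knight_moves) s4 t5 s5"
    "probe_inv p i v0 (rgt v0) ((Q @ W3) @ W5) ((ds @ es3) @ es5) s5"
    "\<forall>d\<in>set knight_moves. {{v0, rgt v0}, {v0 + d, rgt v0 + d}} \<in> rail_graph_edges n \<C> \<longrightarrow>
      spanned ((ds @ es3) @ es5) {{v0, rgt v0}, {v0 + d, rgt v0 + d}}"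
    "t5 + walk_cost * (n * n - length ((Q @ W3) @ W5)) \<le>
      walk_cost * (n * n - length (Q @ W3)) + (sum_list (map try_cost knight_moves) + 1)"
    using exec_tries[of p i v0 "rgt v0" "Q @ W3" "ds @ es3" s4 knight_moves] by auto
  define s6 where "s6 = effect a4 s5"
  obtain t6 where 6: "exec a4 s5 t6 s6" "t6 \<le> max_cost a4"
    unfolding s6_def by (rule exec_loop_freeE[OF lf(4)])
  define Q' where "Q' = Q @ (W3 @ W5)"
  define ds' where "ds' = ds @ (es3 @ es5)"
  have eqs: "(Q @ W3) @ W5 = Q'" "(ds @ es3) @ es5 = ds'" by (simp_all add: Q'_def ds'_def)
  have P5: "rel Q' ds' s5" "search_inv Q' p ds'" "p < length Q'" "Q' ! p = v0" "fst s5 3 = i" "fst s5 7 = p"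
    using 5(2) unfolding eqs by (simp_all add: probe_inv_def)
  have s6: "s6 = ((fst s5)(7 := Suc p), snd s5)" using P5(6) by (simp add: s6_def a4_def)
  have r6: "rel Q' ds' s6" using P5(1) by (rule rel_cong_regs) (auto simp: s6)
  have "search_inv Q' (Suc p) ds'"
  proof (rule search_inv_next[OF P5(2,3)], unfold P5(4))
    fix v1 d assume v1: "v1 \<in> nb v0" and d: "d \<in> set knight_moves"
      and rg: "{{v0, v1}, {v0 + d, v1 + d}} \<in> rail_graph_edges n \<C>"
    have ds': "ds' = (ds @ es3) @ es5" by (simp add: ds'_def)
    from v1 consider "v1 = lft v0" | "v1 = rgt v0" using nb_eq[OF c] by blast
    then show "spanned ds' {{v0, v1}, {v0 + d, v1 + d}}"
    proof cases
      case 1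
      then show ?thesis unfolding ds' using 3(3) d rg by (intro spanned_append[of "ds @ es3"]) simp
    next
      case 2
      then show ?thesis unfolding ds' using 5(3) d rg by simp
    qed
  qed
  then have "loop_inv (Q', Suc p, ds', i) s6"
    using r6 i P5(5) unfolding loop_inv_def by (simp add: s6 Q'_def)
  moreover have "exec probe_code s (t1 + (t2 + (t3 + (t4 + (t5 + t6))))) s6"
    unfolding probe_code_def a1_def[symmetric] a2_def[symmetric] a3_def[symmetric] a4_def[symmetric]
    by (intro exec.Seq[OF 1(1)] exec.Seq[OF 2(1)] exec.Seq[OF 3(1)] exec.Seq[OF 4(1)]
        exec.Seq[OF 5(1)] 6(1))
  moreover have "t1 + (t2 + (t3 + (t4 + (t5 + t6)))) + walk_cost * (n * n - length Q') +
      bcost (Less (Reg 7) (Reg 6)) + bcost search_test \<le> walk_cost * (n * n - length Q) + probe_cost"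
    using 1(2) 2(2) 3(4) 4(2) 5(4)[unfolded eqs] 6(2)
    unfolding probe_cost_def a1_def a2_def a3_def a4_def by linarith
  ultimately show ?thesis unfolding Q'_def ds'_def
    by (intro exI[of _ "t1 + (t2 + (t3 + (t4 + (t5 + t6))))"] exI[of _ s6] exI[of _ "W3 @ W5"]
        exI[of _ "es3 @ es5"] conjI)
qed

lemma exec_root:
  assumes I: "loop_inv (Q, p, ds, i) s" and p: "\<not> p < length Q" and i: "i < n * n"
  shows "\<exists>t s' W. exec root_code s t s' \<and> loop_inv (Q @ W, p, ds, Suc i) s' \<and>
    t + walk_cost * (n * n - length (Q @ W)) + bcost (Less (Reg 7) (Reg 6)) + bcost search_test \<le>
      walk_cost * (n * n - length Q) + root_cost"
proof -
  have r: "rel Q ds s" and S: "search_inv Q p ds" and R: "fst s 7 = p" "fst s 3 = i"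
    and all: "\<And>v. v \<in> cells n \<Longrightarrow> ix v < i \<Longrightarrow> v \<in> set Q"
    using I by (simp_all add: loop_inv_def)
  have "p \<le> length Q" using S by (simp add: search_inv_def)
  then have p: "p = length Q" using p by simp
  obtain x where x: "x \<in> cells n" "ix x = i" using cell_index_surj[OF i] .
  define b where "b = Equal (Load (Fld 2 (Reg 3))) (Const 0)"
  define a where "a = Assign 3 (Add (Reg 3) (Const 1))"
  have lf: "loop_free a" by (simp add: a_def)
  have b: "bval b s \<longleftrightarrow> x \<notin> set Q"
    using relD(3)[OF r] relD(12)[OF r x(1)] R x by (simp add: b_def)
  have "\<exists>t s' W. exec (Cond b (Seq (Assign 8 (Reg 3)) cycle_code) Skip) s t s' \<and>
      rel (Q @ W) ds s' \<and> search_inv (Q @ W) p ds \<and> x \<in> set (Q @ W) \<and>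
      fst s' 7 = p \<and> fst s' 3 = i \<and>
      t + walk_cost * (n * n - length (Q @ W)) \<le>
        walk_cost * (n * n - length Q) + bcost b + 3 + cycle_cost"
  proof (cases "x \<in> set Q")
    case True
    then have "exec (Cond b (Seq (Assign 8 (Reg 3)) cycle_code) Skip) s (bcost b + 1) s"
      using b by (intro exec.Cond_False exec.Skip) simp
    then show ?thesis using r S True R
      by (intro exI[of _ "bcost b + 1"] exI[of _ s] exI[of _ "[]"] conjI) simp_all
  next
    case False
    define s1 where "s1 = effect (Assign 8 (Reg 3)) s"
    have 1: "exec (Assign 8 (Reg 3)) s 2 s1"
      using exec.Assign[of 8 "Reg 3" s] by (simp add: s1_def numeral_2_eq_2)
    have r1: "rel Q ds s1" using r by (rule rel_cong_regs) (auto simp: s1_def)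
    have x1: "fst s1 8 = ix x" using R x by (simp add: s1_def)
    obtain t2 s2 W where 2: "exec cycle_code s1 t2 s2" "distinct (Q @ W)"
      "set (Q @ W) \<subseteq> cells n" "\<forall>v\<in>set (Q @ W). nb v \<subseteq> set (Q @ W)" "x \<in> set W"
      "\<forall>w\<in>set W. cycle_of \<C> w = cycle_of \<C> x" "rel (Q @ W) ds s2"
      "\<forall>k. k \<noteq> 6 \<longrightarrow> k \<noteq> 8 \<longrightarrow> k \<noteq> 14 \<longrightarrow> fst s2 k = fst s1 k"
      "t2 + walk_cost * (n * n - length (Q @ W)) \<le> walk_cost * (n * n - length Q) + cycle_cost"
      using exec_cycle[OF search_inv_Q[OF S] r1 x(1) False x1] by blast
    have "exec (Cond b (Seq (Assign 8 (Reg 3)) cycle_code) Skip) s (bcost b + (2 + t2)) s2"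
      using b False by (intro exec.Cond_True exec.Seq[OF 1 2(1)]) simp
    moreover have "search_inv (Q @ W) p ds"
      unfolding p by (rule search_inv_root[OF S[unfolded p] 2(2,3) 2(4)[rule_format] 2(6)[rule_format]])
    moreover have "fst s2 7 = p" "fst s2 3 = i" using 2(8) R by (simp_all add: s1_def)
    moreover have "bcost b + (2 + t2) + walk_cost * (n * n - length (Q @ W)) \<le>
        walk_cost * (n * n - length Q) + bcost b + 3 + cycle_cost"
      using 2(9) by linarith
    moreover have "x \<in> set (Q @ W)" using 2(5) by simp
    ultimately show ?thesis using 2(7)
      by (intro exI[of _ "bcost b + (2 + t2)"] exI[of _ s2] exI[of _ W] conjI)
  qed
  then obtain t1 s1 W where 1: "exec (Cond b (Seq (Assign 8 (Reg 3)) cycle_code) Skip) s t1 s1"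
    "rel (Q @ W) ds s1" "search_inv (Q @ W) p ds" "x \<in> set (Q @ W)" "fst s1 7 = p" "fst s1 3 = i"
    "t1 + walk_cost * (n * n - length (Q @ W)) \<le>
      walk_cost * (n * n - length Q) + bcost b + 3 + cycle_cost"
    by blast
  define s2 where "s2 = effect a s1"
  obtain t2 where 2: "exec a s1 t2 s2" "t2 \<le> max_cost a"
    unfolding s2_def by (rule exec_loop_freeE[OF lf])
  have s2: "s2 = ((fst s1)(3 := Suc i), snd s1)" using 1(6) by (simp add: s2_def a_def)
  have r2: "rel (Q @ W) ds s2" using 1(2) by (rule rel_cong_regs) (auto simp: s2)
  have "v \<in> set (Q @ W)" if "v \<in> cells n" "ix v < Suc i" for v
  proof (cases "ix v = i")
    case True
    then have "v = x" using x that(1) ix_eq_iff by blast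
    then show ?thesis using 1(4) by simp
  next
    case False
    then show ?thesis using all[OF that(1)] that(2) by simp
  qed
  then have "loop_inv (Q @ W, p, ds, Suc i) s2"
    using r2 1(3,5) i unfolding loop_inv_def by (simp add: s2)
  moreover have "exec root_code s (t1 + t2) s2"
    unfolding root_code_def b_def[symmetric] a_def[symmetric] by (rule exec.Seq[OF 1(1) 2(1)])
  moreover have "t1 + t2 + walk_cost * (n * n - length (Q @ W)) + bcost (Less (Reg 7) (Reg 6)) +
      bcost search_test \<le> walk_cost * (n * n - length Q) + root_cost"
    using 1(7) 2(2) unfolding root_cost_def a_def b_def by linarith
  ultimately show ?thesis
    by (intro exI[of _ "t1 + t2"] exI[of _ s2] exI[of _ W] conjI)
qed

lemma exec_search:
  assumes r: "rel [] [] s" and R: "fst s 7 = 0" "fst s 3 = 0"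
  shows "\<exists>t s' Q ds. exec (While search_test search_body) s t s' \<and> rel Q ds s' \<and>
    search_inv Q (length Q) ds \<and> cells n \<subseteq> set Q \<and>
    t \<le> (walk_cost + probe_cost + root_cost) * (n * n) + bcost search_test"
proof -
  have test: "bval search_test s \<longleftrightarrow> i < n * n \<or> p < length Q" if "loop_inv (Q, p, ds, i) s" for Q p ds i s
    using that relD(2,4)[of Q ds s] by (auto simp: loop_inv_def search_test_def)
  have "\<exists>t s' g'. exec (While search_test search_body) s t s' \<and> loop_inv g' s' \<and>
      \<not> bval search_test s' \<and>
      t + loop_potential g' \<le> loop_potential ([], 0, [], 0) + bcost search_test"
  proof (rule exec_While_potential)
    show "loop_inv ([], 0, [], 0) s"
      using assms search_inv_init by (simp add: loop_inv_def)
    fix g s1 assume g: "loop_inv g s1" and b: "bval search_test s1"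
    obtain Q p ds i where g_eq: "g = (Q, p, ds, i)" by (metis prod_cases4)
    have I: "loop_inv (Q, p, ds, i) s1" using g by (simp add: g_eq)
    then have p7: "bval (Less (Reg 7) (Reg 6)) s1 \<longleftrightarrow> p < length Q"
      using relD(4)[of Q ds s1] by (simp add: loop_inv_def)
    show "\<exists>t s' g'. exec search_body s1 t s' \<and> loop_inv g' s' \<and>
        t + bcost search_test + loop_potential g' \<le> loop_potential g"
    proof (cases "p < length Q")
      case True
      obtain t s' W es where 1: "exec probe_code s1 t s'" "loop_inv (Q @ W, Suc p, ds @ es, i) s'"
        "t + walk_cost * (n * n - length (Q @ W)) + bcost (Less (Reg 7) (Reg 6)) + bcost search_test \<le>
          walk_cost * (n * n - length Q) + probe_cost"
        using exec_probe[OF I True] by blast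
      have "length Q \<le> n * n"
        using I search_inv_Q[of Q p ds] by (intro length_le_if_distinct) (simp_all add: loop_inv_def)
      then have "n * n - p = Suc (n * n - Suc p)" using True by simp
      then have "probe_cost * (n * n - p) = probe_cost + probe_cost * (n * n - Suc p)" by simp
      then have "bcost (Less (Reg 7) (Reg 6)) + t + bcost search_test +
          loop_potential (Q @ W, Suc p, ds @ es, i) \<le> loop_potential g"
        using 1(3) unfolding loop_potential_def g_eq prod.case by linarith
      moreover have "exec search_body s1 (bcost (Less (Reg 7) (Reg 6)) + t) s'"
        unfolding search_body_def using p7 True by (intro exec.Cond_True 1(1)) simp
      ultimately show ?thesis using 1(2) by blast
    next
      case False
      then have i: "i < n * n" using test[OF I] b by blast
      obtain t s' W where 1: "exec root_code s1 t s'" "loop_inv (Q @ W, p, ds, Suc i) s'"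
        "t + walk_cost * (n * n - length (Q @ W)) + bcost (Less (Reg 7) (Reg 6)) + bcost search_test \<le>
          walk_cost * (n * n - length Q) + root_cost"
        using exec_root[OF I False i] by blast
      have "n * n - i = Suc (n * n - Suc i)" using i by simp
      then have "root_cost * (n * n - i) = root_cost + root_cost * (n * n - Suc i)" by simp
      then have "bcost (Less (Reg 7) (Reg 6)) + t + bcost search_test +
          loop_potential (Q @ W, p, ds, Suc i) \<le> loop_potential g"
        using 1(3) unfolding loop_potential_def g_eq prod.case by linarith
      moreover have "exec search_body s1 (bcost (Less (Reg 7) (Reg 6)) + t) s'"
        unfolding search_body_def using p7 False by (intro exec.Cond_False 1(1)) simp
      ultimately show ?thesis using 1(2) by blast
    qed
  qed
  then obtain t s' g where 1: "exec (While search_test search_body) s t s'" "loop_inv g s'"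
    "\<not> bval search_test s'" "t + loop_potential g \<le> loop_potential ([], 0, [], 0) + bcost search_test"
    by blast
  obtain Q p ds i where g: "g = (Q, p, ds, i)" by (metis prod_cases4)
  have I: "loop_inv (Q, p, ds, i) s'" using 1(2) by (simp add: g)
  \<comment> \<open>A failing test means an exhausted queue and no root candidate left, so the whole
    board has been visited and processed.\<close>
  then have "\<not> i < n * n" "\<not> p < length Q" using test 1(3) by blast+
  moreover have J: "search_inv Q p ds" "rel Q ds s'" "\<And>v. v \<in> cells n \<Longrightarrow> ix v < i \<Longrightarrow> v \<in> set Q"
    using I by (simp_all add: loop_inv_def)
  moreover have "p \<le> length Q" using J(1) by (simp add: search_inv_def)
  ultimately have "p = length Q" "cells n \<subseteq> set Q"
    using cell_index_less by (simp, meson dual_order.strict_trans1 not_le subsetI)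
  moreover have "t \<le> (walk_cost + probe_cost + root_cost) * (n * n) + bcost search_test"
    using 1(4) by (simp add: loop_potential_def algebra_simps)
  ultimately show ?thesis using 1(1) J(1,2) by blast
qed

end

section \<open>Initialisation and switching\<close>

definition row_test :: bexp where
  "row_test = Less (Reg 4) (Reg 0)"

text \<open>Squares \<open>n\<close> by repeated addition. Register 4 counts the additions;
  \<open>base_code\<close> resets it for its later role as a row number.\<close>

definition size_body :: com where
  "size_body = Seq (Assign 1 (Add (Reg 1) (Reg 0))) (Assign 4 (Add (Reg 4) (Const 1)))"

definition base_code :: com where
  "base_code = Seq (Assign 2 (Add (scaled 3 (Reg 1)) (Const 1))) (Assign 4 (Const 0))"

text \<open>Row and column are counted along with the index, which replaces division and
  remainder.\<close>

definition coord_body :: com where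
  "coord_body = Seq (Store (Fld 0 (Reg 3)) (Reg 4)) (Seq (Store (Fld 1 (Reg 3)) (Reg 5))
     (Seq (Assign 3 (Add (Reg 3) (Const 1))) (Seq (Assign 5 (Add (Reg 5) (Const 1)))
     (Cond (Equal (Reg 5) (Reg 0)) (Seq (Assign 5 (Const 0)) (Assign 4 (Add (Reg 4) (Const 1))))
        Skip))))"

definition init_code :: com where
  "init_code = Seq (Assign 0 (Load (Const 0))) (Seq (While row_test size_body)
     (Seq base_code (Seq (While row_test coord_body) (Assign 3 (Const 0)))))"

definition size_cost :: nat where
  "size_cost = max_cost size_body + bcost row_test"

definition coord_cost :: nat where
  "coord_cost = max_cost coord_body + bcost row_test"

definition init_cost :: nat where
  "init_cost = max_cost (Assign 0 (Load (Const 0))) + bcost row_test + max_cost base_code +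
     bcost row_test + max_cost (Assign 3 (Const 0))"

lemma exec_size_loop:
  "\<exists>t. exec (While row_test size_body) ((\<lambda>_. 0)(0 := n), M) t
     ((\<lambda>_. 0)(0 := n, 1 := n * n, 4 := n), M) \<and> t \<le> size_cost * n + bcost row_test"
proof -
  define I where "I = (\<lambda>r s. r \<le> n \<and> s = ((\<lambda>_ :: nat. 0 :: nat)(0 := n, 1 := r * n, 4 := r), M))"
  define \<Phi> where "\<Phi> = (\<lambda>r. size_cost * (n - r))"
  have "\<exists>t s' g'. exec (While row_test size_body) ((\<lambda>_. 0)(0 := n), M) t s' \<and> I g' s' \<and>
      \<not> bval row_test s' \<and> t + \<Phi> g' \<le> \<Phi> 0 + bcost row_test"
  proof (rule exec_While_potential)
    show "I 0 ((\<lambda>_. 0)(0 := n), M)" by (auto simp: I_def fun_eq_iff)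
    fix r s assume I: "I r s" and b: "bval row_test s"
    have r: "r < n" using I b by (simp add: I_def row_test_def)
    have "loop_free size_body" by (simp add: size_body_def)
    then obtain t where t: "exec size_body s t (effect size_body s)" "t \<le> max_cost size_body"
      by (rule exec_loop_freeE)
    have "I (Suc r) (effect size_body s)"
      using I r by (auto simp: I_def size_body_def fun_eq_iff)
    moreover have "n - r = Suc (n - Suc r)" using r by simp
    then have "t + bcost row_test + \<Phi> (Suc r) \<le> \<Phi> r"
      using t(2) by (simp add: \<Phi>_def size_cost_def)
    ultimately show "\<exists>t s' g'. exec size_body s t s' \<and> I g' s' \<and> t + bcost row_test + \<Phi> g' \<le> \<Phi> r"
      using t(1) by blast
  qed
  then obtain t s' r where 1: "exec (While row_test size_body) ((\<lambda>_. 0)(0 := n), M) t s'"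
    "I r s'" "\<not> bval row_test s'" "t + \<Phi> r \<le> \<Phi> 0 + bcost row_test" by blast
  then have "r = n" by (auto simp: I_def row_test_def)
  then have "s' = ((\<lambda>_. 0)(0 := n, 1 := n * n, 4 := n), M)" using 1(2) by (simp add: I_def)
  moreover have "t \<le> size_cost * n + bcost row_test" using 1(4) by (simp add: \<Phi>_def)
  ultimately show ?thesis using 1(1) by blast
qed

context join_input
begin

definition input_mem :: "(nat \<Rightarrow> nat) \<Rightarrow> bool" where
  "input_mem M \<longleftrightarrow> M 0 = n \<and> (\<forall>v\<in>cells n. M (adj 1 (ix v)) = 2 \<and>
     M (adj 2 (ix v)) = ix (lft v) \<and> M (adj 3 (ix v)) = ix (rgt v))"

lemma input_mem_upd_fld [simp]: "input_mem (M(fld base f i := x)) \<longleftrightarrow> input_mem M"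
  by (simp add: input_mem_def)

text \<open>The zero fields from 2 on include the visited flags, which makes every cell unvisited
  when the search begins.\<close>

definition coord_inv :: "nat \<Rightarrow> state \<Rightarrow> bool" where
  "coord_inv i s \<longleftrightarrow> i \<le> n * n \<and> input_mem (snd s) \<and>
     (\<forall>j<i. snd s (fld base 0 j) = j div n \<and> snd s (fld base 1 j) = j mod n) \<and>
     (\<forall>f j. 2 \<le> f \<longrightarrow> f < 8 \<longrightarrow> snd s (fld base f j) = 0) \<and>
     fst s 0 = n \<and> fst s 1 = n * n \<and> fst s 2 = base \<and> fst s 3 = i \<and> fst s 4 = i div n \<and>
     fst s 5 = i mod n \<and> fst s 6 = 0 \<and> fst s 7 = 0 \<and> fst s 13 = 0"

lemma coord_inv_step:
  assumes I: "coord_inv i s" and i: "i < n * n"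
  shows "coord_inv (Suc i) (effect coord_body s)"
proof -
  have n: "0 < n" using i by (cases n) auto
  have R: "fst s 0 = n" "fst s 1 = n * n" "fst s 2 = base" "fst s 3 = i" "fst s 4 = i div n"
    "fst s 5 = i mod n" "fst s 6 = 0" "fst s 7 = 0" "fst s 13 = 0" and "input_mem (snd s)"
    and old: "\<And>j. j < i \<Longrightarrow> snd s (fld base 0 j) = j div n \<and> snd s (fld base 1 j) = j mod n"
    and z: "\<And>f j. 2 \<le> f \<Longrightarrow> f < 8 \<Longrightarrow> snd s (fld base f j) = 0"
    using I by (simp_all add: coord_inv_def)
  have M: "snd (effect coord_body s) = (snd s)(fld base 0 i := i div n, fld base 1 i := i mod n)"
    by (simp add: coord_body_def R)
  have F: "fst (effect coord_body s) = (fst s)(3 := Suc i, 4 := Suc i div n, 5 := Suc i mod n)"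
    using n by (auto simp: coord_body_def R fun_eq_iff mod_Suc div_Suc)
  have "snd (effect coord_body s) (fld base 0 j) = j div n \<and>
      snd (effect coord_body s) (fld base 1 j) = j mod n" if "j < Suc i" for j
    using old[of j] that unfolding M by (cases "j = i") simp_all
  moreover have "snd (effect coord_body s) (fld base f j) = 0" if "2 \<le> f" "f < 8" for f j
    using z[OF that] that unfolding M by simp
  moreover have "input_mem (snd (effect coord_body s))"
    unfolding M using \<open>input_mem (snd s)\<close> by simp
  ultimately show ?thesis using i R unfolding coord_inv_def F by simp
qed

lemma exec_coord_loop:
  assumes "coord_inv 0 s"
  shows "\<exists>t s'. exec (While row_test coord_body) s t s' \<and> coord_inv (n * n) s' \<and>
    t \<le> coord_cost * (n * n) + bcost row_test"
proof -
  define \<Phi> where "\<Phi> = (\<lambda>i. coord_cost * (n * n - i))"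
  have test: "bval row_test s \<longleftrightarrow> i < n * n" if "coord_inv i s" for i s
  proof -
    have "bval row_test s \<longleftrightarrow> i div n < n" using that by (simp add: coord_inv_def row_test_def)
    also have "\<dots> \<longleftrightarrow> i < n * n"
    \<comment> \<open>For \<open>n = 0\<close> the quotient is the default value 0, and both sides
      are false.\<close>
    proof (cases "n = 0")
      case False
      then show ?thesis by (simp add: div_less_iff_less_mult)
    qed simp
    finally show ?thesis .
  qed
  have "\<exists>t s' g'. exec (While row_test coord_body) s t s' \<and> coord_inv g' s' \<and>
      \<not> bval row_test s' \<and> t + \<Phi> g' \<le> \<Phi> 0 + bcost row_test"
    using assms
  proof (rule exec_While_potential)
    fix i s assume I: "coord_inv i s" and b: "bval row_test s"
    have i: "i < n * n" using test[OF I] b by simp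
    have "loop_free coord_body" by (simp add: coord_body_def)
    then obtain t where t: "exec coord_body s t (effect coord_body s)" "t \<le> max_cost coord_body"
      by (rule exec_loop_freeE)
    have "n * n - i = Suc (n * n - Suc i)" using i by simp
    then have "t + bcost row_test + \<Phi> (Suc i) \<le> \<Phi> i"
      using t(2) by (simp add: \<Phi>_def coord_cost_def)
    then show "\<exists>t s' g'. exec coord_body s t s' \<and> coord_inv g' s' \<and> t + bcost row_test + \<Phi> g' \<le> \<Phi> i"
      using t(1) coord_inv_step[OF I i] by blast
  qed
  then obtain t s' i where 1: "exec (While row_test coord_body) s t s'" "coord_inv i s'"
    "\<not> bval row_test s'" "t + \<Phi> i \<le> \<Phi> 0 + bcost row_test" by blast
  have "i \<le> n * n" using 1(2) by (simp add: coord_inv_def)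
  then have "i = n * n" using test[OF 1(2)] 1(3) by simp
  moreover have "t \<le> coord_cost * (n * n) + bcost row_test" using 1(4) by (simp add: \<Phi>_def)
  ultimately show ?thesis using 1(1,2) by blast
qed

lemma exec_init:
  assumes M: "input_mem M" "\<And>a. base \<le> a \<Longrightarrow> M a = 0"
  shows "\<exists>t s. exec init_code (\<lambda>_. 0, M) t s \<and> rel [] [] s \<and> fst s 7 = 0 \<and> fst s 3 = 0 \<and>
    t \<le> (size_cost + coord_cost) * (n * n) + init_cost"
proof -
  define a1 where "a1 = Assign 0 (Load (Const 0))"
  define a2 where "a2 = Assign 3 (Const 0)"
  have lf: "loop_free a1" "loop_free a2" "loop_free base_code"
    by (simp_all add: a1_def a2_def base_code_def)
  have M0: "M 0 = n" using M(1) by (simp add: input_mem_def)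
  obtain t1 where 1: "exec a1 (\<lambda>_. 0, M) t1 ((\<lambda>_. 0)(0 := n), M)" "t1 \<le> max_cost a1"
    using exec_loop_freeE[OF lf(1), of "(\<lambda>_. 0, M)"] M0 by (auto simp: a1_def)
  define s2 where "s2 = ((\<lambda>_ :: nat. 0 :: nat)(0 := n, 1 := n * n, 4 := n), M)"
  obtain t2 where 2: "exec (While row_test size_body) ((\<lambda>_. 0)(0 := n), M) t2 s2"
    "t2 \<le> size_cost * n + bcost row_test"
    using exec_size_loop unfolding s2_def by blast
  define s3 where "s3 = effect base_code s2"
  obtain t3 where 3: "exec base_code s2 t3 s3" "t3 \<le> max_cost base_code"
    unfolding s3_def by (rule exec_loop_freeE[OF lf(3)])
  have "base \<le> fld base f j" for f j by (simp add: fld_def)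
  moreover have "Suc (3 * (n * n)) = base" by (simp add: base_def)
  ultimately have "coord_inv 0 s3"
    using M by (simp add: coord_inv_def s3_def s2_def base_code_def)
  then obtain t4 s4 where 4: "exec (While row_test coord_body) s3 t4 s4" "coord_inv (n * n) s4"
    "t4 \<le> coord_cost * (n * n) + bcost row_test"
    using exec_coord_loop by blast
  define s5 where "s5 = effect a2 s4"
  obtain t5 where 5: "exec a2 s4 t5 s5" "t5 \<le> max_cost a2"
    unfolding s5_def by (rule exec_loop_freeE[OF lf(2)])
  have s5: "s5 = ((fst s4)(3 := 0), snd s4)" by (simp add: s5_def a2_def)
  have C: "input_mem (snd s4)"
    "\<And>j. j < n * n \<Longrightarrow> snd s4 (fld base 0 j) = j div n \<and> snd s4 (fld base 1 j) = j mod n"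
    "\<And>f j. 2 \<le> f \<Longrightarrow> f < 8 \<Longrightarrow> snd s4 (fld base f j) = 0"
    using 4(2) by (simp_all add: coord_inv_def)
  have "cell_mem (snd s4) v" if v: "v \<in> cells n" for v
    using C(1) v C(2)[OF cell_index_less[OF v]] cell_index_div_mod[OF v]
    by (simp add: input_mem_def cell_mem_def)
  moreover have "snd s4 0 = n" using C(1) by (simp add: input_mem_def)
  ultimately have "rel [] [] s5" using 4(2) C(3) by (simp add: rel_def s5 coord_inv_def)
  moreover have "fst s5 7 = 0" "fst s5 3 = 0" using 4(2) by (simp_all add: s5 coord_inv_def)
  moreover have "exec init_code (\<lambda>_. 0, M) (t1 + (t2 + (t3 + (t4 + t5)))) s5"
    unfolding init_code_def a1_def[symmetric] a2_def[symmetric]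
    by (intro exec.Seq[OF 1(1)] exec.Seq[OF 2(1)] exec.Seq[OF 3(1)] exec.Seq[OF 4(1) 5(1)])
  moreover have "t1 + (t2 + (t3 + (t4 + t5))) \<le> (size_cost + coord_cost) * (n * n) + init_cost"
  proof -
    have "size_cost * n \<le> size_cost * (n * n)" by (intro mult_le_mono2) simp
    moreover have "init_cost = max_cost a1 + bcost row_test + max_cost base_code + bcost row_test +
        max_cost a2" unfolding init_cost_def a1_def a2_def ..
    ultimately show ?thesis using 1(2) 2(2) 3(2) 4(3) 5(2) unfolding add_mult_distrib by linarith
  qed
  ultimately show ?thesis by blast
qed

end

section \<open>Switching the recorded rails on the adjacency lists\<close>

definition load_rail_code :: com where
  "load_rail_code = Seq (Assign 9 (Load (Fld 4 (Reg 3)))) (Seq (Assign 10 (Load (Fld 5 (Reg 3))))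
     (Seq (Assign 11 (Load (Fld 6 (Reg 3)))) (Assign 12 (Load (Fld 7 (Reg 3))))))"

text \<open>Only the conditions on the current graph, deciding whether \<open>switch_rail\<close>
  acts; the geometric ones were settled when the rail was chosen.\<close>

definition rail_test :: bexp where
  "rail_test = Conj (Conj (has_nbr_test 9 10) (has_nbr_test 11 12))
     (Conj (Neg (has_nbr_test 9 11)) (Neg (has_nbr_test 10 12)))"

definition replace_code :: "nat \<Rightarrow> nat \<Rightarrow> nat \<Rightarrow> com" where
  "replace_code x y z = Cond (Equal (Load (Adj 2 (Reg x))) (Reg y))
     (Store (Adj 2 (Reg x)) (Reg z)) (Store (Adj 3 (Reg x)) (Reg z))"

definition swap_code :: com where
  "swap_code = Seq (replace_code 9 10 11) (Seq (replace_code 10 9 12)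
     (Seq (replace_code 11 12 9) (replace_code 12 11 10)))"

definition switch_body :: com where
  "switch_body = Seq load_rail_code (Seq (Cond rail_test swap_code Skip)
     (Assign 3 (Add (Reg 3) (Const 1))))"

definition switch_test :: bexp where
  "switch_test = Less (Reg 3) (Reg 13)"

definition switch_cost :: nat where
  "switch_cost = max_cost switch_body + bcost switch_test"

definition replace_nbr :: "(nat \<Rightarrow> nat) \<Rightarrow> nat \<Rightarrow> nat \<Rightarrow> nat \<Rightarrow> nat \<Rightarrow> nat" where
  "replace_nbr M i y z = (if M (adj 2 i) = y then M(adj 2 i := z) else M(adj 3 i := z))"

lemma effect_replace_code:
  "effect (replace_code x y z) s = (fst s, replace_nbr (snd s) (fst s x) (fst s y) (fst s z))"
  by (simp add: replace_code_def replace_nbr_def)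

text \<open>Distinctness makes the switch four exchanges of one neighbour in four different lists,
  so degrees stay two.\<close>

lemma nbrs_switched:
  fixes H :: graph
  assumes d: "distinct [v0, v1, v2, v3]"
  defines "H' \<equiv> H - {{v0, v1}, {v2, v3}} \<union> {{v0, v2}, {v1, v3}}"
  shows "nbrs H' v0 = insert v2 (nbrs H v0 - {v1})" "nbrs H' v1 = insert v3 (nbrs H v1 - {v0})"
    "nbrs H' v2 = insert v0 (nbrs H v2 - {v3})" "nbrs H' v3 = insert v1 (nbrs H v3 - {v2})"
    "v \<notin> {v0, v1, v2, v3} \<Longrightarrow> nbrs H' v = nbrs H v"
proof -
  have *: "w \<in> nbrs H' u \<longleftrightarrow> w \<in> nbrs H u \<and> \<not> (u = v0 \<and> w = v1 \<or> u = v1 \<and> w = v0) \<and>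
      \<not> (u = v2 \<and> w = v3 \<or> u = v3 \<and> w = v2) \<or> (u = v0 \<and> w = v2 \<or> u = v2 \<and> w = v0) \<or>
      (u = v1 \<and> w = v3 \<or> u = v3 \<and> w = v1)" for u w
    unfolding H'_def nbrs_def by (simp add: doubleton_eq_iff) blast
  have ne: "v0 \<noteq> v1" "v0 \<noteq> v2" "v0 \<noteq> v3" "v1 \<noteq> v2" "v1 \<noteq> v3" "v2 \<noteq> v3" using d by auto
  show "nbrs H' v0 = insert v2 (nbrs H v0 - {v1})" "nbrs H' v1 = insert v3 (nbrs H v1 - {v0})"
    "nbrs H' v2 = insert v0 (nbrs H v2 - {v3})" "nbrs H' v3 = insert v1 (nbrs H v3 - {v2})"
    by (rule set_eqI, simp add: * ne ne[symmetric], blast)+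
  show "nbrs H' v = nbrs H v" if "v \<notin> {v0, v1, v2, v3}"
    by (rule set_eqI) (use that * in simp)
qed

context join_input
begin

text \<open>\<open>cell_mem\<close> ties the entries to \<open>lft\<close> and \<open>rgt\<close>.
  During switching either entry may be replaced, so only the set of neighbours is kept.\<close>

definition adj_set :: "(nat \<Rightarrow> nat) \<Rightarrow> cell \<Rightarrow> cell set \<Rightarrow> bool" where
  "adj_set M v S \<longleftrightarrow> M (adj 1 (ix v)) = 2 \<and> (\<exists>a b. a \<noteq> b \<and> S = {a, b} \<and> a \<in> cells n \<and> b \<in> cells n \<and>
     M (adj 2 (ix v)) = ix a \<and> M (adj 3 (ix v)) = ix b)"

lemma adj_set_replace_same:
  assumes A: "adj_set M v S" and y: "y \<in> S" and z: "z \<in> cells n" "z \<notin> S"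
  shows "adj_set (replace_nbr M (ix v) (ix y) (ix z)) v (insert z (S - {y}))"
proof -
  obtain a b where ab: "a \<noteq> b" "S = {a, b}" "a \<in> cells n" "b \<in> cells n" "M (adj 1 (ix v)) = 2"
    "M (adj 2 (ix v)) = ix a" "M (adj 3 (ix v)) = ix b"
    using A unfolding adj_set_def by blast
  from y ab(2) consider "y = a" | "y = b" by blast
  then show ?thesis
  proof cases
    case 1
    have "insert z (S - {y}) = {z, b}" "z \<noteq> b" using ab z 1 by auto
    then show ?thesis using ab z(1) 1 unfolding adj_set_def replace_nbr_def
      by (intro conjI exI[of _ z] exI[of _ b]) simp_all
  next
    case 2
    have "insert z (S - {y}) = {a, z}" "a \<noteq> z" using ab z 2 by auto
    then show ?thesis using ab z(1) 2 unfolding adj_set_def replace_nbr_def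
      by (intro conjI exI[of _ a] exI[of _ z]) simp_all
  qed
qed

lemma adj_set_replace_other:
  "v \<in> cells n \<Longrightarrow> w \<in> cells n \<Longrightarrow> v \<noteq> w \<Longrightarrow>
    adj_set (replace_nbr M (ix v) y z) w S \<longleftrightarrow> adj_set M w S"
  by (simp add: adj_set_def replace_nbr_def)

lemma replace_nbr_frame [simp]:
  "v \<in> cells n \<Longrightarrow> replace_nbr M (ix v) y z (fld base f i) = M (fld base f i)"
  "replace_nbr M j y z 0 = M 0"
  by (simp_all add: replace_nbr_def)

lemma rail_mem_replace [simp]:
  "v \<in> cells n \<Longrightarrow> rail_mem (replace_nbr M (ix v) y z) j d \<longleftrightarrow> rail_mem M j d"
  by (cases d rule: prod_cases4) simp

lemma has_nbr_test_iff:
  assumes "adj_set (snd s) v S" "fst s x = ix v" "fst s y = ix w" "v \<in> cells n" "w \<in> cells n"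
  shows "bval (has_nbr_test x y) s \<longleftrightarrow> w \<in> S"
proof -
  obtain a b where ab: "S = {a, b}" "a \<in> cells n" "b \<in> cells n"
    "snd s (adj 2 (ix v)) = ix a" "snd s (adj 3 (ix v)) = ix b"
    using assms(1) unfolding adj_set_def by blast
  have "bval (has_nbr_test x y) s \<longleftrightarrow> ix a = ix w \<or> ix b = ix w"
    using ab assms(2,3) by (auto simp: has_nbr_test_def)
  also have "\<dots> \<longleftrightarrow> a = w \<or> b = w" using ab assms(5) by simp
  finally show ?thesis unfolding ab(1) by blast
qed

definition graph_mem :: "(nat \<Rightarrow> nat) \<Rightarrow> graph \<Rightarrow> bool" where
  "graph_mem M H \<longleftrightarrow> M 0 = n \<and> (\<forall>v\<in>cells n. adj_set M v (nbrs H v))"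

text \<open>Membership in \<open>rails\<close> yields the absence of new edges only for some
  quadruple describing the rail. By \<open>new_edges_eq\<close> the new edges do not depend on the
  quadruple, so it holds for the stored one.\<close>

lemma shifted_edge_rails_iff:
  assumes d: "shifted_edge (v0, v1, v2, v3)"
  shows "rail_of (v0, v1, v2, v3) \<in> rails n H \<longleftrightarrow>
    v1 \<in> nbrs H v0 \<and> v3 \<in> nbrs H v2 \<and> v2 \<notin> nbrs H v0 \<and> v3 \<notin> nbrs H v1"
proof
  assume r: "rail_of (v0, v1, v2, v3) \<in> rails n H"
  have "new_edges (rail_of (v0, v1, v2, v3)) = {{v0, v2}, {v1, v3}}"
    using d by (intro new_edges_eq) simp_all
  then have "{{v0, v2}, {v1, v3}} \<inter> H = {}" using new_edges_notin[OF r] by simp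
  moreover have "{{v0, v1}, {v2, v3}} \<subseteq> H" using rails_subset[OF r] by simp
  ultimately show "v1 \<in> nbrs H v0 \<and> v3 \<in> nbrs H v2 \<and> v2 \<notin> nbrs H v0 \<and> v3 \<notin> nbrs H v1"
    by (simp add: nbrs_def)
next
  assume "v1 \<in> nbrs H v0 \<and> v3 \<in> nbrs H v2 \<and> v2 \<notin> nbrs H v0 \<and> v3 \<notin> nbrs H v1"
  then have "{v0, v1} \<in> H" "{v2, v3} \<in> H" "{v0, v2} \<notin> H" "{v1, v3} \<notin> H"
    by (simp_all add: nbrs_def)
  moreover have "parallel_edges v0 v1 v2 v3" "{v0, v2} \<in> knight_graph n" "{v1, v3} \<in> knight_graph n"
    using d by simp_all
  ultimately show "rail_of (v0, v1, v2, v3) \<in> rails n H"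
    unfolding rails_def rail_of.simps by blast
qed

lemma graph_mem_swap:
  assumes G: "graph_mem M H" and d: "shifted_edge (v0, v1, v2, v3)"
    and r: "rail_of (v0, v1, v2, v3) \<in> rails n H"
    and c: "v0 \<in> cells n" "v1 \<in> cells n" "v2 \<in> cells n" "v3 \<in> cells n"
  shows "graph_mem (replace_nbr (replace_nbr (replace_nbr (replace_nbr M (ix v0) (ix v1) (ix v2))
    (ix v1) (ix v0) (ix v3)) (ix v2) (ix v3) (ix v0)) (ix v3) (ix v2) (ix v1))
    (switch (rail_of (v0, v1, v2, v3)) H)"
proof -
  have nb: "v1 \<in> nbrs H v0" "v3 \<in> nbrs H v2" "v2 \<notin> nbrs H v0" "v3 \<notin> nbrs H v1"
    using r shifted_edge_rails_iff[OF d] by simp_all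
  then have nb': "v0 \<in> nbrs H v1" "v2 \<in> nbrs H v3" "v0 \<notin> nbrs H v2" "v1 \<notin> nbrs H v3"
    using nbrs_sym by blast+
  have kg: "{v0, v2} \<in> knight_graph n" "{v1, v3} \<in> knight_graph n" "v0 \<noteq> v1"
    and par: "parallel_edges v0 v1 v2 v3"
    using d by simp_all
  \<comment> \<open>If \<open>v0 = v3\<close>, the adjacency of \<open>v2\<close> and
    \<open>v3\<close> contradicts the non-adjacency of \<open>v0\<close> and \<open>v2\<close>;
    \<open>v1 = v2\<close> is excluded likewise. \<open>v2 \<noteq> v3\<close> is
    \<open>v0 \<noteq> v1\<close> translated.\<close>
  have ne: "v0 \<noteq> v1" "v0 \<noteq> v2" "v0 \<noteq> v3" "v1 \<noteq> v2" "v1 \<noteq> v3" "v2 \<noteq> v3"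
    using nb nb' kg(3) knight_graph_neq[OF kg(1)] knight_graph_neq[OF kg(2)] par
    by (auto simp: parallel_edges_def km_def)
  define H' where "H' = H - {{v0, v1}, {v2, v3}} \<union> {{v0, v2}, {v1, v3}}"
  have sw: "switch (rail_of (v0, v1, v2, v3)) H = H'"
    using new_edges_eq[OF refl par] by (simp add: switch_def H'_def)
  have dist: "distinct [v0, v1, v2, v3]" using ne by simp
  note N = nbrs_switched[OF dist, where H = H, folded H'_def]
  have A: "adj_set M v (nbrs H v)" if "v \<in> cells n" for v using G that by (simp add: graph_mem_def)
  define M1 where "M1 = replace_nbr M (ix v0) (ix v1) (ix v2)"
  define M2 where "M2 = replace_nbr M1 (ix v1) (ix v0) (ix v3)"
  define M3 where "M3 = replace_nbr M2 (ix v2) (ix v3) (ix v0)"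
  define M4 where "M4 = replace_nbr M3 (ix v3) (ix v2) (ix v1)"
  note Ms = M1_def M2_def M3_def M4_def
  note other = adj_set_replace_other
  have "adj_set M4 v (nbrs H' v)" if v: "v \<in> cells n" for v
  proof -
    consider "v = v0" | "v = v1" | "v = v2" | "v = v3" | "v \<notin> {v0, v1, v2, v3}" by blast
    then show ?thesis
    proof cases
      case 1
      have "adj_set M1 v0 (nbrs H' v0)"
        unfolding N M1_def by (rule adj_set_replace_same[OF A[OF c(1)] nb(1) c(3) nb(3)])
      then show ?thesis using ne c unfolding 1 M2_def M3_def M4_def by (simp add: other)
    next
      case 2
      have "adj_set M1 v1 (nbrs H v1)" using A[OF c(2)] ne c unfolding M1_def by (simp add: other)
      then have "adj_set M2 v1 (nbrs H' v1)"
        unfolding N M2_def by (rule adj_set_replace_same[OF _ nb'(1) c(4) nb(4)])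
      then show ?thesis using ne c unfolding 2 M3_def M4_def by (simp add: other)
    next
      case 3
      have "adj_set M2 v2 (nbrs H v2)" using A[OF c(3)] ne c unfolding M1_def M2_def by (simp add: other)
      then have "adj_set M3 v2 (nbrs H' v2)"
        unfolding N M3_def by (rule adj_set_replace_same[OF _ nb(2) c(1) nb'(3)])
      then show ?thesis using ne c unfolding 3 M4_def by (simp add: other)
    next
      case 4
      have "adj_set M3 v3 (nbrs H v3)"
        using A[OF c(4)] ne c unfolding M1_def M2_def M3_def by (simp add: other)
      then show ?thesis
        unfolding 4 N M4_def by (rule adj_set_replace_same[OF _ nb'(2) c(2) nb'(4)])
    next
      case 5
      then have "v0 \<noteq> v" "v1 \<noteq> v" "v2 \<noteq> v" "v3 \<noteq> v" by auto
      then show ?thesis using A[OF v] N(5)[OF 5] c v unfolding Ms by (simp add: other)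
    qed
  qed
  moreover have "M4 0 = n" using G by (simp add: graph_mem_def Ms)
  ultimately show ?thesis unfolding sw graph_mem_def Ms by blast
qed

lemma switch_step:
  assumes G: "graph_mem (snd s) H" and d: "shifted_edge d" "rail_of d \<in> rail_graph_edges n \<C>"
    and R: "fst s 2 = base" "fst s 3 = j" "rail_mem (snd s) j d"
  shows "graph_mem (snd (effect switch_body s)) (switch_rail n (rail_of d) H)"
    "fst (effect switch_body s) 2 = base" "fst (effect switch_body s) 3 = Suc j"
    "fst (effect switch_body s) 13 = fst s 13"
    "rail_mem (snd (effect switch_body s)) i e \<longleftrightarrow> rail_mem (snd s) i e"
proof -
  obtain v0 v1 v2 v3 where d_eq: "d = (v0, v1, v2, v3)" by (metis prod_cases4)
  have "rail_of d \<in> rails n (\<Union>\<C>)" using d(2) by (simp add: rail_graph_edges_def)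
  then have "{{v0, v1}, {v2, v3}} \<subseteq> \<Union>\<C>" using rails_subset by (metis d_eq rail_of.simps)
  then have "{v0, v1} \<in> \<Union>\<C>" "{v2, v3} \<in> \<Union>\<C>" by (simp_all only: insert_subset)
  then have "{v0, v1} \<subseteq> cells n" "{v2, v3} \<subseteq> cells n"
    using tourney_edge_cells[OF tourney] by blast+
  then have c: "v0 \<in> cells n" "v1 \<in> cells n" "v2 \<in> cells n" "v3 \<in> cells n" by simp_all
  define s1 where "s1 = effect load_rail_code s"
  have s1: "s1 = ((fst s)(9 := ix v0, 10 := ix v1, 11 := ix v2, 12 := ix v3), snd s)"
    using R by (simp add: s1_def load_rail_code_def d_eq)
  have A: "adj_set (snd s1) v (nbrs H v)" if "v \<in> cells n" for v
    using G that by (simp add: graph_mem_def s1)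
  have F: "fst s1 9 = ix v0" "fst s1 10 = ix v1" "fst s1 11 = ix v2" "fst s1 12 = ix v3"
    by (simp_all add: s1)
  have test: "bval rail_test s1 \<longleftrightarrow> rail_of d \<in> rails n H"
    unfolding d_eq shifted_edge_rails_iff[OF d(1)[unfolded d_eq]] rail_test_def bval.simps
      has_nbr_test_iff[OF A F(1,2), OF c(1) c(1,2)] has_nbr_test_iff[OF A F(3,4), OF c(3) c(3,4)]
      has_nbr_test_iff[OF A F(1,3), OF c(1) c(1,3)] has_nbr_test_iff[OF A F(2,4), OF c(2) c(2,4)]
    by blast
  define s2 where "s2 = (if bval rail_test s1 then effect swap_code s1 else s1)"
  have e: "effect switch_body s = ((fst s2)(3 := fst s2 3 + 1), snd s2)"
    by (simp add: switch_body_def s1_def[symmetric] s2_def)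
  have swap: "effect swap_code s1 = (fst s1,
      replace_nbr (replace_nbr (replace_nbr (replace_nbr (snd s) (ix v0) (ix v1) (ix v2))
      (ix v1) (ix v0) (ix v3)) (ix v2) (ix v3) (ix v0)) (ix v3) (ix v2) (ix v1))"
    by (simp add: swap_code_def effect_replace_code F) (simp add: s1)
  have f2: "fst s2 = fst s1" by (simp add: s2_def swap)
  show "fst (effect switch_body s) 2 = base" "fst (effect switch_body s) 3 = Suc j"
    "fst (effect switch_body s) 13 = fst s 13"
    using R by (simp_all add: e f2 s1)
  show "rail_mem (snd (effect switch_body s)) i e \<longleftrightarrow> rail_mem (snd s) i e"
    using c by (simp add: e s2_def swap) (simp add: s1)
  show "graph_mem (snd (effect switch_body s)) (switch_rail n (rail_of d) H)"
  proof (cases "rail_of d \<in> rails n H")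
    case True
    then have "snd (effect switch_body s) = snd (effect swap_code s1)" using test by (simp add: e s2_def)
    then show ?thesis
      using graph_mem_swap[OF G d(1)[unfolded d_eq] True[unfolded d_eq] c] True
      by (simp add: swap switch_rail_def d_eq)
  next
    case False
    then have "snd (effect switch_body s) = snd s" using test by (simp add: e s2_def s1)
    then show ?thesis using G False by (simp add: switch_rail_def)
  qed
qed

lemma exec_switch:
  assumes G: "graph_mem (snd s) (\<Union>\<C>)" and R: "fst s 2 = base" "fst s 3 = 0" "fst s 13 = length ds"
    and ds: "\<And>d. d \<in> set ds \<Longrightarrow> shifted_edge d \<and> rail_of d \<in> rail_graph_edges n \<C>"
    and mem: "\<And>j. j < length ds \<Longrightarrow> rail_mem (snd s) j (ds ! j)"
  shows "\<exists>t s'. exec (While switch_test switch_body) s t s' \<and>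
    graph_mem (snd s') (fold (switch_rail n) (map rail_of ds) (\<Union>\<C>)) \<and>
    t \<le> switch_cost * length ds + bcost switch_test"
proof -
  define H where "H = (\<lambda>j. fold (switch_rail n) (map rail_of (take j ds)) (\<Union>\<C>))"
  define I where "I = (\<lambda>j (s :: state). j \<le> length ds \<and> graph_mem (snd s) (H j) \<and> fst s 2 = base \<and>
    fst s 3 = j \<and> fst s 13 = length ds \<and> (\<forall>i<length ds. rail_mem (snd s) i (ds ! i)))"
  define \<Phi> where "\<Phi> = (\<lambda>j. switch_cost * (length ds - j))"
  have "\<exists>t s' g'. exec (While switch_test switch_body) s t s' \<and> I g' s' \<and>
      \<not> bval switch_test s' \<and> t + \<Phi> g' \<le> \<Phi> 0 + bcost switch_test"
  proof (rule exec_While_potential)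
    show "I 0 s" using G R mem by (simp add: I_def H_def)
    fix j s assume I: "I j s" and b: "bval switch_test s"
    have j: "j < length ds" using I b by (simp add: I_def switch_test_def)
    have "loop_free switch_body"
      by (simp add: switch_body_def load_rail_code_def swap_code_def replace_code_def)
    then obtain t where t: "exec switch_body s t (effect switch_body s)" "t \<le> max_cost switch_body"
      by (rule exec_loop_freeE)
    have J: "graph_mem (snd s) (H j)" "fst s 2 = base" "fst s 3 = j" "fst s 13 = length ds"
      "\<And>i. i < length ds \<Longrightarrow> rail_mem (snd s) i (ds ! i)"
      using I by (simp_all add: I_def)
    have dj: "shifted_edge (ds ! j)" "rail_of (ds ! j) \<in> rail_graph_edges n \<C>" using ds[of "ds ! j"] j by simp_all
    note S = switch_step[OF J(1) dj J(2,3) J(5)[OF j]]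
    have "H (Suc j) = switch_rail n (rail_of (ds ! j)) (H j)"
      using j by (simp add: H_def take_Suc_conv_app_nth)
    then have "I (Suc j) (effect switch_body s)" using j J S by (simp add: I_def)
    moreover have "length ds - j = Suc (length ds - Suc j)" using j by simp
    then have "t + bcost switch_test + \<Phi> (Suc j) \<le> \<Phi> j"
      using t(2) by (simp add: \<Phi>_def switch_cost_def)
    ultimately show "\<exists>t s' g'. exec switch_body s t s' \<and> I g' s' \<and> t + bcost switch_test + \<Phi> g' \<le> \<Phi> j"
      using t(1) by blast
  qed
  then obtain t s' j where 1: "exec (While switch_test switch_body) s t s'" "I j s'"
    "\<not> bval switch_test s'" "t + \<Phi> j \<le> \<Phi> 0 + bcost switch_test" by blast
  then have "j = length ds" by (auto simp: I_def switch_test_def)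
  then have "graph_mem (snd s') (fold (switch_rail n) (map rail_of ds) (\<Union>\<C>))"
    using 1(2) by (simp add: I_def H_def)
  moreover have "t \<le> switch_cost * length ds + bcost switch_test" using 1(4) by (simp add: \<Phi>_def)
  ultimately show ?thesis using 1(1) by blast
qed

end

section \<open>The whole program\<close>

text \<open>Lists of length two give records of constant width, so the flattened input can be
  addressed without following lengths.\<close>

lemma concat_pairs_nth:
  assumes "\<forall>l\<in>set L. length l = 2"
  shows "length (concat (map (\<lambda>l. length l # l) L)) = 3 * length L"
    "i < length L \<Longrightarrow> k < 3 \<Longrightarrow> concat (map (\<lambda>l. length l # l) L) ! (3 * i + k) = (2 # L ! i) ! k"
proof -
  show "length (concat (map (\<lambda>l. length l # l) L)) = 3 * length L"
    using assms by (induction L) auto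
  show "concat (map (\<lambda>l. length l # l) L) ! (3 * i + k) = (2 # L ! i) ! k"
    if "i < length L" "k < 3"
    using that assms
  proof (induction L arbitrary: i)
    case (Cons l L)
    then have l: "length l = 2" by simp
    show ?case
    proof (cases i)
      case 0
      then show ?thesis using Cons.prems(2) l by (simp add: nth_append nth_Cons split: nat.split)
    next
      case (Suc j)
      have "concat (map (\<lambda>l. length l # l) (l # L)) ! (3 * i + k) =
          ((length l # l) @ concat (map (\<lambda>l. length l # l) L)) ! (length (length l # l) + (3 * j + k))"
        using l Suc by simp
      also have "\<dots> = concat (map (\<lambda>l. length l # l) L) ! (3 * j + k)" by (rule nth_append_length_plus)
      finally show ?thesis using Cons Suc by simp
    qed
  qed simp
qed

lemma encode_nth:
  assumes L: "\<forall>l\<in>set L. length l = 2"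
  shows "length (encode n L) = 3 * length L + 1" "encode n L ! 0 = n"
    "i < length L \<Longrightarrow> encode n L ! adj 1 i = 2" "i < length L \<Longrightarrow> encode n L ! adj 2 i = L ! i ! 0"
    "i < length L \<Longrightarrow> encode n L ! adj 3 i = L ! i ! 1"
  using concat_pairs_nth(1)[OF L] concat_pairs_nth(2)[OF L, of i 0]
    concat_pairs_nth(2)[OF L, of i 1] concat_pairs_nth(2)[OF L, of i 2]
  by (simp_all add: encode_def adj_def numeral_2_eq_2 numeral_3_eq_3)

lemma encode_index_cases:
  assumes "j < 3 * N + 1"
  obtains "j = 0" | i where "i < N" "j = adj 1 i" | i where "i < N" "j = adj 2 i"
    | i where "i < N" "j = adj 3 i"
proof (cases "j = 0")
  case False
  define i where "i = (j - 1) div 3"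
  have "j = 3 * i + (j - 1) mod 3 + 1" using False by (simp add: i_def)
  moreover have "(j - 1) mod 3 < 3" by simp
  ultimately have "j = adj 1 i \<or> j = adj 2 i \<or> j = adj 3 i" unfolding adj_def by linarith
  moreover have "i < N" using assms False unfolding i_def by linarith
  ultimately show thesis using that by blast
qed (use that in simp)

context join_input
begin

text \<open>The output lists are read off from memory, in whatever order of entries the switches
  have left.\<close>

lemma graph_mem_output:
  assumes G: "graph_mem M H"
  shows "\<exists>L. adjacency_lists n H L \<and> (\<forall>i<length (encode n L). M i = encode n L ! i)"
proof -
  define L where "L = map (\<lambda>i. [M (adj 2 i), M (adj 3 i)]) [0..<n * n]"
  have len: "length L = n * n" "\<forall>l\<in>set L. length l = 2" by (auto simp: L_def)
  have nth: "L ! i = [M (adj 2 i), M (adj 3 i)]" if "i < n * n" for i using that by (simp add: L_def)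
  have A: "adj_set M v (nbrs H v)" if "v \<in> cells n" for v using G that by (simp add: graph_mem_def)
  have "distinct (L ! ix v) \<and> set (L ! ix v) = ix ` {w. {v, w} \<in> H}" if v: "v \<in> cells n" for v
  proof -
    obtain a b where "a \<noteq> b" "nbrs H v = {a, b}" "a \<in> cells n" "b \<in> cells n"
      "M (adj 2 (ix v)) = ix a" "M (adj 3 (ix v)) = ix b"
      using A[OF v] unfolding adj_set_def by blast
    then show ?thesis using nth[OF cell_index_less[OF v]] unfolding nbrs_def by simp
  qed
  then have "adjacency_lists n H L" unfolding adjacency_lists_def using len(1) by blast
  moreover have "M j = encode n L ! j" if "j < length (encode n L)" for j
  proof -
    note E = encode_nth[OF len(2)]
    have "j < 3 * (n * n) + 1" using that E(1) len(1) by simp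
    then show ?thesis
    proof (cases rule: encode_index_cases)
      case 1
      then show ?thesis using G E(2) by (simp add: graph_mem_def)
    next
      case (2 i)
      obtain v where "v \<in> cells n" "ix v = i" using cell_index_surj[OF 2(1)] .
      then have "M (adj 1 i) = 2" using A[of v] by (auto simp: adj_set_def)
      then show ?thesis using 2 E(3)[of i] len(1) by simp
    next
      case (3 i)
      then show ?thesis using E(4)[of i] len(1) nth[of i] by simp
    next
      case (4 i)
      then show ?thesis using E(5)[of i] len(1) nth[of i] by simp
    qed
  qed
  ultimately show ?thesis by blast
qed

lemma rel_graph_mem:
  assumes r: "rel Q ds s"
  shows "graph_mem (snd s) (\<Union>\<C>)"
proof -
  have "adj_set (snd s) v (nb v)" if v: "v \<in> cells n" for v
    unfolding adj_set_def using relD(7-9)[OF r v] nb_eq[OF v] lft_neq_rgt[OF v] v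
    by (intro conjI exI[of _ "lft v"] exI[of _ "rgt v"]) simp_all
  then show ?thesis using relD(6)[OF r] by (simp add: graph_mem_def)
qed

end

definition join_code :: com where
  "join_code = Seq init_code (Seq (While search_test search_body)
     (Seq (Assign 3 (Const 0)) (While switch_test switch_body)))"

definition join_time :: "nat \<Rightarrow> nat" where
  "join_time n = (size_cost + coord_cost + walk_cost + probe_cost + root_cost + switch_cost) * (n * n) +
     (init_cost + bcost search_test + 2 + bcost switch_test)"

lemma (in join_input) exec_join:
  assumes M: "input_mem M" "\<And>a. base \<le> a \<Longrightarrow> M a = 0"
  shows "\<exists>t s H. exec join_code (\<lambda>_. 0, M) t s \<and> t \<le> join_time n \<and> join n \<C> H \<and> graph_mem (snd s) H"
proof -
  obtain t1 s1 where 1: "exec init_code (\<lambda>_. 0, M) t1 s1" "rel [] [] s1" "fst s1 7 = 0" "fst s1 3 = 0"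
    "t1 \<le> (size_cost + coord_cost) * (n * n) + init_cost"
    using exec_init[OF M] by blast
  obtain t2 s2 Q ds where 2: "exec (While search_test search_body) s1 t2 s2" "rel Q ds s2"
    "search_inv Q (length Q) ds" "cells n \<subseteq> set Q"
    "t2 \<le> (walk_cost + probe_cost + root_cost) * (n * n) + bcost search_test"
    using exec_search[OF 1(2-4)] by blast
  define s3 where "s3 = ((fst s2)(3 := 0), snd s2)"
  have 3: "exec (Assign 3 (Const 0)) s2 2 s3"
    using exec.Assign[of 3 "Const 0" s2] by (simp add: s3_def numeral_2_eq_2)
  have r3: "rel Q ds s3" using 2(2) by (rule rel_cong_regs) (auto simp: s3_def)
  define H where "H = fold (switch_rail n) (map rail_of ds) (\<Union>\<C>)"
  have "fst s3 3 = 0" by (simp add: s3_def)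
  then obtain t4 s4 where 4: "exec (While switch_test switch_body) s3 t4 s4" "graph_mem (snd s4) H"
    "t4 \<le> switch_cost * length ds + bcost switch_test"
    using exec_switch[OF rel_graph_mem[OF r3] relD(3)[OF r3] _ relD(5)[OF r3] _ relD(14)[OF r3]]
      search_inv_rail(1,2)[OF 2(3)] unfolding H_def by blast
  have "spanning_forest \<C> (rail_graph_edges n \<C>) (rail_ends \<C>) (set (map rail_of ds))"
    using 2(3,4) by (rule search_inv_spanning_forest)
  moreover have "distinct (map rail_of ds)" using 2(3) by (simp add: search_inv_def)
  ultimately have "join n \<C> H" unfolding join_def H_def by blast
  moreover have "exec join_code (\<lambda>_. 0, M) (t1 + (t2 + (2 + t4))) s4"
    unfolding join_code_def by (rule exec.Seq[OF 1(1) exec.Seq[OF 2(1) exec.Seq[OF 3 4(1)]]])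
  moreover have "t1 + (t2 + (2 + t4)) \<le> join_time n"
  proof -
    have "length ds \<le> length Q" using 2(3) by (simp add: search_inv_def)
    also have "length Q \<le> n * n" using search_inv_Q[OF 2(3)] by (intro length_le_if_distinct)
    finally have "switch_cost * length ds \<le> switch_cost * (n * n)" by (intro mult_le_mono2)
    then show ?thesis using 1(5) 2(5) 4(3) unfolding join_time_def add_mult_distrib by linarith
  qed
  ultimately show ?thesis using 4(2) by blast
qed

text \<open>The input format fixes only the set of entries. Degree two and distinctness leave
  exactly two entries, and their order in \<open>L\<close> defines \<open>l\<close> and
  \<open>r\<close>.\<close>

lemma tourney_adjacency_lists:
  assumes t: "tourney n \<C>" and L: "adjacency_lists n (\<Union>\<C>) L"
  shows "\<exists>l r. \<forall>v\<in>cells n. nbrs (\<Union>\<C>) v = {l v, r v} \<and> l v \<noteq> r v \<and>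
    L ! cell_index n v = [cell_index n (l v), cell_index n (r v)]"
proof -
  have "\<exists>a b. nbrs (\<Union>\<C>) v = {a, b} \<and> a \<noteq> b \<and> L ! cell_index n v = [cell_index n a, cell_index n b]"
    if v: "v \<in> cells n" for v
  proof -
    let ?l = "L ! cell_index n v"
    obtain a b where ab: "a \<noteq> b" "nbrs (\<Union>\<C>) v = {a, b}" using tourney_nbrs[OF t v] .
    have c: "a \<in> cells n" "b \<in> cells n" using nbrs_cells[OF t, of _ v] ab(2) by blast+
    then have ne: "cell_index n a \<noteq> cell_index n b" using ab(1) by (simp add: cell_index_eq_iff)
    have l: "distinct ?l" "set ?l = cell_index n ` nbrs (\<Union>\<C>) v"
      using L v unfolding adjacency_lists_def nbrs_def by blast+
    then have s: "set ?l = {cell_index n a, cell_index n b}" using ab(2) by simp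
    then have "length ?l = 2" using distinct_card[OF l(1)] ne by simp
    then obtain x y where xy: "?l = [x, y]" by (auto simp: numeral_2_eq_2 length_Suc_conv)
    then have "x = cell_index n a \<and> y = cell_index n b \<or> x = cell_index n b \<and> y = cell_index n a"
      using s by (auto simp: doubleton_eq_iff)
    moreover have "nbrs (\<Union>\<C>) v = {b, a}" using ab(2) by (simp add: insert_commute)
    ultimately show ?thesis using ab xy by metis
  qed
  then show ?thesis by metis
qed

lemma implements_join: "implements_join join_code join_time"
  unfolding implements_join_def
proof (intro allI impI, elim conjE)
  fix n \<C> L assume t: "tourney n \<C>" and L: "adjacency_lists n (\<Union>\<C>) L"
  obtain l r where lr: "\<And>v. v \<in> cells n \<Longrightarrow> nbrs (\<Union>\<C>) v = {l v, r v}"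
    "\<And>v. v \<in> cells n \<Longrightarrow> l v \<noteq> r v"
    "\<And>v. v \<in> cells n \<Longrightarrow> L ! cell_index n v = [cell_index n (l v), cell_index n (r v)]"
    using tourney_adjacency_lists[OF t L] by metis
  interpret join_input n \<C> l r using t lr by unfold_locales
  have len: "length L = n * n" using L by (simp add: adjacency_lists_def)
  have "length x = 2" if "x \<in> set L" for x
  proof -
    obtain i where i: "i < n * n" "x = L ! i" using \<open>x \<in> set L\<close> len by (auto simp: in_set_conv_nth)
    obtain v where v: "v \<in> cells n" "cell_index n v = i" using cell_index_surj[OF i(1)] .
    show ?thesis using lr(3)[OF v(1)] v(2) i(2) by simp
  qed
  then have L2: "\<forall>x\<in>set L. length x = 2" by blast
  note E = encode_nth[OF L2]
  define M where "M = snd (initial_state (encode n L))"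
  have init: "initial_state (encode n L) = (\<lambda>_. 0, M)" by (simp add: M_def initial_state_def)
  have M: "M i = (if i < base then encode n L ! i else 0)" for i
    using E(1) len by (simp add: M_def initial_state_def base_def)
  have "M (adj k (cell_index n v)) = encode n L ! adj k (cell_index n v)" if "v \<in> cells n" "k \<le> 3" for k v
    using cell_index_less[OF that(1)] that(2) by (simp add: M adj_def base_def)
  then have "input_mem M"
    unfolding input_mem_def using E(3-5) len cell_index_less lr(3) E(2) by (simp add: M base_def)
  moreover have "M a = 0" if "base \<le> a" for a using that by (simp add: M)
  ultimately obtain t s H where J: "exec join_code (\<lambda>_. 0, M) t s" "t \<le> join_time n" "join n \<C> H"
    "graph_mem (snd s) H"
    using exec_join by blast
  obtain L' where L': "adjacency_lists n H L'" "\<forall>i<length (encode n L'). snd s i = encode n L' ! i"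
    using graph_mem_output[OF J(4)] by blast
  show "\<exists>t s' H L'. exec join_code (initial_state (encode n L)) t s' \<and> t \<le> join_time n \<and>
      join n \<C> H \<and> adjacency_lists n H L' \<and> holds_output s' (encode n L')"
    unfolding init holds_output_def using J(1-3) L' by blast
qed

lemma join_time_bigo: "(\<lambda>n. real (join_time n)) \<in> O(\<lambda>n. real n ^ 2)"
proof -
  obtain a b where T: "\<And>n. join_time n = a * (n * n) + b" unfolding join_time_def by blast
  have "real (join_time n) \<le> real (a + b) * (real n)^2" if "1 \<le> n" for n
  proof -
    have "b * 1 \<le> b * (n * n)" using that by (intro mult_le_mono2) simp
    then have "join_time n \<le> (a + b) * (n * n)" by (simp add: T algebra_simps)
    then have "real (join_time n) \<le> real ((a + b) * (n * n))" by (simp only: of_nat_le_iff)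
    then show ?thesis by (simp add: power2_eq_square)
  qed
  then show ?thesis
    by (intro bigoI[of _ "real (a + b)"] eventually_sequentiallyI[of 1]) simp
qed

theorem theorem3:
  shows "(\<forall>n k \<C> H. tourney n \<C> \<and> card \<C> = k \<and> join n \<C> H \<longrightarrow>
            (\<exists>\<C>'. tourney n \<C>' \<and> H = \<Union>\<C>' \<and> card \<C>' \<le> k)) \<and>
         (\<exists>P T. implements_join P T \<and> (\<lambda>n. real (T n)) \<in> O(\<lambda>n. real n ^ 2))"
proof (intro conjI allI impI)
  fix n k \<C> H assume "tourney n \<C> \<and> card \<C> = k \<and> join n \<C> H"
  then show "\<exists>\<C>'. tourney n \<C>' \<and> H = \<Union>\<C>' \<and> card \<C>' \<le> k" using join_tourney by metis
next
  show "\<exists>P T. implements_join P T \<and> (\<lambda>n. real (T n)) \<in> O(\<lambda>n. real n ^ 2)"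
    using implements_join join_time_bigo by blast
qed

end
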